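(* The configuration LP has an integrality gap of at most $1.749$ in the Graph Balancing case.
   Context: Graph Balancing: given a weighted undirected multigraph $G=(V,E,r,w)$ (loops allowed), where $r(e)$ is the set of endpoints of edge $e$ and $w:E\to\mathbb R_{>0}$, orient every edge so as to minimize the maximum weighted in-degree $\max_{v\in V}\sum_{e\in\delta^-(v)} w(e)$. For $v\in V$ and $\tau\in\mathbb R$, the configurations are $\mathcal C(v,\tau)=\{C\subseteq\delta(v): w(C)\le\tau\}$, where $\delta(v)$ is the set of edges incident to $v$. The configuration LP with parameter $\tau$ is the feasibility program: $\sum_{C\in\mathcal C(v,\tau)} x_{v,C}\le 1$ for all $v\in V$; $\sum_{v\in r(e)}\sum_{C\in\mathcal C(v,\tau): e\in C} x_{v,C}\ge 1$ for all $e\in E$; $x\ge 0$. Its optimum $\mathrm{OPT}^*$ is the smallest $\tau$ for which it is feasible. The integrality gap is the supremum over instances of the ratio between the optimal integral orientation value and $\mathrm{OPT}^*$. *)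

theory Defs
  imports Complex_Main "HOL-Library.FuncSet" "HOL-Library.Extended_Real"
begin

record ('v, 'e) weighted_multigraph =
  verts :: "'v set"
  edges :: "'e set"
  ends :: "'e \<Rightarrow> 'v set"
  weight :: "'e \<Rightarrow> real"

text \<open>Parallel edges are distinct elements of type \<open>'e\<close> with the same endpoint set;
  a loop is an edge whose endpoint set is a singleton.\<close>

definition wf_graph :: "('v, 'e) weighted_multigraph \<Rightarrow> bool" where
  "wf_graph G \<longleftrightarrow> finite (verts G) \<and> finite (edges G) \<and>
     (\<forall>e\<in>edges G. ends G e \<subseteq> verts G \<and> card (ends G e) \<in> {1, 2} \<and> weight G e > 0)"

definition incident :: "('v, 'e) weighted_multigraph \<Rightarrow> 'v \<Rightarrow> 'e set" where
  "incident G v = {e \<in> edges G. v \<in> ends G e}"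

text \<open>An orientation maps each edge to its head, one of its endpoints.\<close>

definition orientations :: "('v, 'e) weighted_multigraph \<Rightarrow> ('e \<Rightarrow> 'v) set" where
  "orientations G = (\<Pi>\<^sub>E e\<in>edges G. ends G e)"

definition in_edges :: "('v, 'e) weighted_multigraph \<Rightarrow> ('e \<Rightarrow> 'v) \<Rightarrow> 'v \<Rightarrow> 'e set" where
  "in_edges G h v = {e \<in> edges G. h e = v}"

definition max_indegree :: "('v, 'e) weighted_multigraph \<Rightarrow> ('e \<Rightarrow> 'v) \<Rightarrow> real" where
  "max_indegree G h = Max ((\<lambda>v. \<Sum>e\<in>in_edges G h v. weight G e) ` verts G)"

definition opt_integral :: "('v, 'e) weighted_multigraph \<Rightarrow> real" where
  "opt_integral G = Min (max_indegree G ` orientations G)"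

definition configs :: "('v, 'e) weighted_multigraph \<Rightarrow> 'v \<Rightarrow> real \<Rightarrow> 'e set set" where
  "configs G v \<tau> = {C. C \<subseteq> incident G v \<and> (\<Sum>e\<in>C. weight G e) \<le> \<tau>}"

definition config_LP_solution ::
  "('v, 'e) weighted_multigraph \<Rightarrow> real \<Rightarrow> ('v \<Rightarrow> 'e set \<Rightarrow> real) \<Rightarrow> bool" where
  "config_LP_solution G \<tau> x \<longleftrightarrow>
     (\<forall>v\<in>verts G. (\<Sum>C\<in>configs G v \<tau>. x v C) \<le> 1) \<and>
     (\<forall>e\<in>edges G. (\<Sum>v\<in>ends G e. \<Sum>C\<in>{C \<in> configs G v \<tau>. e \<in> C}. x v C) \<ge> 1) \<and>
     (\<forall>v\<in>verts G. \<forall>C\<in>configs G v \<tau>. x v C \<ge> 0)"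

definition config_LP_feasible :: "('v, 'e) weighted_multigraph \<Rightarrow> real \<Rightarrow> bool" where
  "config_LP_feasible G \<tau> \<longleftrightarrow> (\<exists>x. config_LP_solution G \<tau> x)"

text \<open>For a graph with at least one edge this infimum is a minimum; see
  \<open>opt_LP_is_least\<close> below.\<close>

definition opt_LP :: "('v, 'e) weighted_multigraph \<Rightarrow> real" where
  "opt_LP G = Inf {\<tau>. config_LP_feasible G \<tau>}"

text \<open>Graphs without edges are left out: their LP is feasible for every real \<open>\<tau>\<close>, negative
  ones included, so no smallest \<open>\<tau>\<close> exists. The argument only fixes the types of
  vertices and edges.\<close>

definition integrality_gap :: "('v, 'e) weighted_multigraph itself \<Rightarrow> ereal" where
  "integrality_gap _ =
     (SUP G \<in> {G :: ('v, 'e) weighted_multigraph. wf_graph G \<and> edges G \<noteq> {}}.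
        ereal (opt_integral G / opt_LP G))"

lemma finite_incident: "wf_graph G \<Longrightarrow> finite (incident G v)"
  by (simp add: wf_graph_def incident_def)

lemma weight_nonneg:
  assumes "wf_graph G" "C \<subseteq> incident G v"
  shows "0 \<le> (\<Sum>e\<in>C. weight G e)"
proof (rule sum_nonneg)
  fix e assume "e \<in> C"
  then have "e \<in> edges G" using assms(2) by (auto simp: incident_def)
  then show "0 \<le> weight G e" using assms(1) by (simp add: wf_graph_def less_imp_le)
qed

lemma feasible_nonneg:
  assumes "wf_graph G" "edges G \<noteq> {}" "config_LP_feasible G \<tau>"
  shows "0 \<le> \<tau>"
proof (rule ccontr)
  assume "\<not> 0 \<le> \<tau>"
  then have "configs G v \<tau> = {}" for v
    using weight_nonneg[OF assms(1), of _ v] by (auto simp: configs_def dest: order_trans)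
  with assms(3) have "edges G = {}"
    by (simp add: config_LP_feasible_def config_LP_solution_def)
  with assms(2) show False by simp
qed

lemma feasible_cong:
  assumes "\<And>v. configs G v \<sigma> = configs G v \<tau>" "config_LP_feasible G \<sigma>"
  shows "config_LP_feasible G \<tau>"
  using assms(2) unfolding config_LP_feasible_def config_LP_solution_def assms(1) .

lemma feasible_total_weight:
  assumes wf: "wf_graph G"
  shows "config_LP_feasible G (\<Sum>e\<in>edges G. weight G e)" (is "config_LP_feasible G ?W")
proof -
  define x where "x = (\<lambda>v C. if C = incident G v then 1 else (0::real))"
  have fin: "finite (edges G)" using wf by (simp add: wf_graph_def)
  have conf: "configs G v ?W = Pow (incident G v)" for v
  proof -
    have "(\<Sum>e\<in>C. weight G e) \<le> ?W" if "C \<subseteq> incident G v" for C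
      using that fin wf by (intro sum_mono2) (auto simp: wf_graph_def incident_def less_imp_le)
    then show ?thesis by (auto simp: configs_def)
  qed
  have sum1: "(\<Sum>C\<in>Pow (incident G v). x v C) = 1" for v
    using finite_incident[OF wf, of v] by (simp add: x_def sum.delta)
  have sum2: "(\<Sum>C\<in>{C \<in> Pow (incident G v). e \<in> C}. x v C) = 1"
    if "e \<in> edges G" "v \<in> ends G e" for e v
  proof -
    have "finite {C \<in> Pow (incident G v). e \<in> C}"
      using finite_incident[OF wf, of v] by simp
    then show ?thesis
      using that by (simp add: x_def sum.delta incident_def)
  qed
  have "(\<Sum>v\<in>ends G e. \<Sum>C\<in>{C \<in> configs G v ?W. e \<in> C}. x v C) \<ge> 1"
    if e: "e \<in> edges G" for e
  proof -
    have "(\<Sum>v\<in>ends G e. \<Sum>C\<in>{C \<in> configs G v ?W. e \<in> C}. x v C) = real (card (ends G e))"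
      unfolding conf using sum2[OF e] by simp
    moreover have "card (ends G e) \<ge> 1" using wf e by (auto simp: wf_graph_def)
    ultimately show ?thesis by simp
  qed
  then have "config_LP_solution G ?W x"
    unfolding config_LP_solution_def using sum1 conf by (auto simp: x_def)
  then show ?thesis by (auto simp: config_LP_feasible_def)
qed

lemma opt_LP_is_least:
  assumes wf: "wf_graph G" and ne: "edges G \<noteq> {}"
  shows "config_LP_feasible G (opt_LP G)"
    and "\<And>\<tau>. config_LP_feasible G \<tau> \<Longrightarrow> opt_LP G \<le> \<tau>"
proof -
  let ?F = "{\<tau>. config_LP_feasible G \<tau>}"
  let ?S = "(\<lambda>C. \<Sum>e\<in>C. weight G e) ` Pow (edges G)"
  have finS: "finite ?S" using wf by (simp add: wf_graph_def)
  have ex: "\<exists>s \<in> ?S \<inter> ?F. s \<le> \<tau>" if "\<tau> \<in> ?F" for \<tau>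
  proof -
    let ?T = "{s \<in> ?S. s \<le> \<tau>}"
    have finT: "finite ?T" using finS by simp
    have "0 \<in> ?T" using feasible_nonneg[OF wf ne] that by (auto intro!: image_eqI[of _ _ "{}"])
    then have m: "Max ?T \<in> ?T" using finT Max_in by blast
    have "configs G v \<tau> = configs G v (Max ?T)" for v
    proof -
      have "(\<Sum>e\<in>C. weight G e) \<le> \<tau> \<longleftrightarrow> (\<Sum>e\<in>C. weight G e) \<le> Max ?T"
        if "C \<subseteq> incident G v" for C
      proof
        assume "(\<Sum>e\<in>C. weight G e) \<le> \<tau>"
        moreover have "C \<in> Pow (edges G)" using that by (auto simp: incident_def)
        ultimately show "(\<Sum>e\<in>C. weight G e) \<le> Max ?T" using finT by (intro Max_ge) auto
      next
        assume "(\<Sum>e\<in>C. weight G e) \<le> Max ?T"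
        then show "(\<Sum>e\<in>C. weight G e) \<le> \<tau>" using m by simp
      qed
      then show ?thesis by (auto simp: configs_def)
    qed
    then have "config_LP_feasible G (Max ?T)" using feasible_cong that by blast
    then show ?thesis using m by auto
  qed
  have fin: "finite (?S \<inter> ?F)" using finS by simp
  have "?S \<inter> ?F \<noteq> {}" using ex feasible_total_weight[OF wf] by blast
  then have m: "Min (?S \<inter> ?F) \<in> ?S \<inter> ?F" using fin Min_in by blast
  have low: "Min (?S \<inter> ?F) \<le> \<tau>" if "\<tau> \<in> ?F" for \<tau>
    using ex[OF that] fin by (meson Min_le order_trans)
  have "opt_LP G = Min (?S \<inter> ?F)"
    unfolding opt_LP_def using m low by (intro cInf_eq_minimum) auto
  then show "config_LP_feasible G (opt_LP G)"
    and "\<And>\<tau>. config_LP_feasible G \<tau> \<Longrightarrow> opt_LP G \<le> \<tau>"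
    using m low by auto
qed

end

theory Submission
  imports Defs
begin

text \<open>Scale so that \<open>opt_LP\<close> is 1 and put \<open>T = 1.749\<close>. Choose an orientation that lexicographically
  minimises first the number of edges held by overloaded vertices (load above \<open>T\<close>) and then a sequence
  of potentials read off from a search that starts at these vertices. The search maintains sets
  \<open>Q \<subseteq> P\<close>: edges of weight above 1/2 are counted if their holder is in \<open>P\<close>, edges of weight above 0.42 if
  it is in \<open>Q\<close>, and the light ones if it is in \<open>Q\<close>, but only once in a phase of \<open>K\<close> stages; other ends of counted
  edges are added to \<open>P\<close> or \<open>Q\<close>. By optimality an edge cannot be flipped when it is counted first, not even
  after moving light edges out of the way, so the vertex it leads to is almost full.

  If an overloaded vertex exists, the final sets yield a dual solution of the configuration LP. Edge
  values are discounted by 0.93 per phase; the holder of an edge keeps its value except for a charge which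
  it cedes to the other end, and the value of a vertex is the sum of what it keeps and what it receives.
  Since every reached vertex is full up to the edge that triggered its entry, its value is at least
  the value of each configuration, and larger at an overloaded vertex. As the vertex values and the edge
  values have the same sum, this contradicts weak duality.\<close>

section \<open>Selecting an orientation\<close>

text \<open>The blocked flip of an edge of weight up to 1 guarantees only a load above
  \<open>T\<close> - 1 = 0.749 at the vertex it leads to, which can be less than what a
  configuration of weight 1 is worth. A vertex that holds big edges and was reached by a big edge
  therefore enters \<open>P\<close> at first, where only big edges have value: a configuration
  contains at most one of them, so big edges can be weighed against big edges. Only in
  \<open>Q\<close> do the other edges count as well.

  The second obstacle is a vertex of \<open>Q\<close> with load at most \<open>T\<close> - 0.42
  whose configuration consists of light edges held elsewhere. Such a vertex has room for a light
  edge. Hence each of these edges either has a holder that enters \<open>Q\<close> in a later phase,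
  or it is loose, and loose edges count one phase late. In both cases the discount of 7 percent
  applies at the vertex. The holder of loose edges loses 7 percent of their weight; this is
  affordable because much loose weight could be moved away to make room for the blocked flip.
  Counting light edges only once per phase is what makes this comparison of phases possible.\<close>

lemma lex_min:
  fixes f :: "nat \<Rightarrow> 'a \<Rightarrow> nat"
  assumes "finite S" "S \<noteq> {}"
  shows "\<exists>h\<in>S. \<forall>h'\<in>S. \<forall>i<N. (\<forall>j<i. f j h' = f j h) \<longrightarrow> f i h \<le> f i h'"
proof (induction N)
  case 0
  then show ?case using assms(2) by auto
next
  case (Suc N)
  then obtain h0 where h0: "h0 \<in> S"
    and m: "\<And>h' i. h' \<in> S \<Longrightarrow> i < N \<Longrightarrow> (\<forall>j<i. f j h' = f j h0) \<Longrightarrow> f i h0 \<le> f i h'"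
    by blast
  define S' where "S' = {h\<in>S. \<forall>j<N. f j h = f j h0}"
  have "finite S'" "h0 \<in> S'" using assms(1) h0 by (auto simp: S'_def)
  then have "arg_min_on (f N) S' \<in> S'" "\<And>h'. h' \<in> S' \<Longrightarrow> f N (arg_min_on (f N) S') \<le> f N h'"
    by (auto intro: arg_min_if_finite(1) arg_min_least)
  then obtain h where h: "h \<in> S'" and hm: "\<And>h'. h' \<in> S' \<Longrightarrow> f N h \<le> f N h'" by blast
  have "f i h \<le> f i h'" if "h' \<in> S" "i < Suc N" "\<forall>j<i. f j h' = f j h" for h' i
  proof (cases "i = N")
    case True
    then have "h' \<in> S'" using that h by (auto simp: S'_def)
    then show ?thesis using hm True by simp
  next
    case False
    then have "i < N" using that by simp
    then have "\<forall>j<i. f j h' = f j h0" "f i h = f i h0" using that(3) h by (auto simp: S'_def)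
    then show ?thesis using m[OF that(1) \<open>i < N\<close>] by simp
  qed
  moreover have "h \<in> S" using h by (simp add: S'_def)
  ultimately show ?case by blast
qed

section \<open>The staged search and its costs\<close>

locale balancing =
  fixes V :: "'v set" and E :: "'e set" and r :: "'e \<Rightarrow> 'v set" and w :: "'e \<Rightarrow> real"
  assumes finite_V: "finite V" and finite_E: "finite E"
    and r_sub: "e \<in> E \<Longrightarrow> r e \<subseteq> V"
    and r_card: "e \<in> E \<Longrightarrow> card (r e) \<in> {1, 2}"
    and w_pos: "e \<in> E \<Longrightarrow> 0 < w e"
    and w_le_1: "e \<in> E \<Longrightarrow> w e \<le> 1"
begin

abbreviation T :: real where "T \<equiv> 1749/1000"

definition oris :: "('e \<Rightarrow> 'v) set" where
  "oris = (\<Pi>\<^sub>E e\<in>E. r e)"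

definition load :: "('e \<Rightarrow> 'v) \<Rightarrow> 'v \<Rightarrow> real" where
  "load h v = (\<Sum>e\<in>{e\<in>E. h e = v}. w e)"

definition bad :: "('e \<Rightarrow> 'v) \<Rightarrow> 'v set" where
  "bad h = {v\<in>V. T < load h v}"

text \<open>A configuration of weight at most 1 contains at most one big and at most two heavy
  edges. The bound 0.42 is the light weight that is moved at most in \<open>flip_loose\<close>;
  0.749 is \<open>T\<close> - 1.\<close>

definition big :: "'e \<Rightarrow> bool" where "big e \<longleftrightarrow> 1/2 < w e"
definition heavy :: "'e \<Rightarrow> bool" where "heavy e \<longleftrightarrow> 42/100 < w e \<and> w e \<le> 1/2"
definition light :: "'e \<Rightarrow> bool" where "light e \<longleftrightarrow> w e \<le> 42/100"
definition mid :: "'e \<Rightarrow> bool" where "mid e \<longleftrightarrow> 1/2 < w e \<and> w e < 749/1000"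

definition bigs :: "('e \<Rightarrow> 'v) \<Rightarrow> 'v \<Rightarrow> 'e set" where
  "bigs h v = {g\<in>E. h g = v \<and> big g}"

text \<open>The sets are arguments, not read off from the orientation, so that the sets of one
  orientation can be applied to a modified one.\<close>

definition counted :: "bool \<Rightarrow> 'v set \<Rightarrow> 'v set \<Rightarrow> ('e \<Rightarrow> 'v) \<Rightarrow> 'e set" where
  "counted l P Q h = {e\<in>E. big e \<and> h e \<in> P \<or> heavy e \<and> h e \<in> Q \<or> light e \<and> l \<and> h e \<in> Q}"

text \<open>The two exceptional rules for entering \<open>Q\<close>. An edge of weight between 1/2 and 0.749 that brought
  \<open>x\<close> into \<open>P\<close> (recorded in \<open>A\<close>) pulls \<open>x\<close> into \<open>Q\<close> although \<open>x\<close> holds a big edge, provided that its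
  holder is in \<open>Q\<close> and satisfies \<open>forward\<close>. Conversely, the last set of \<open>nextQ\<close> pulls a vertex into
  \<open>Q\<close> when the other end of its only big edge is there.\<close>

definition forward :: "'v set \<Rightarrow> ('e \<Rightarrow> 'v) \<Rightarrow> 'e \<Rightarrow> bool" where
  "forward Q h e \<longleftrightarrow> bigs h (h e) = {e} \<or>
     w e \<le> 55/100 \<and> (\<exists>g. g \<noteq> e \<and> bigs h (h e) = {e, g} \<and>
       (74/100 < w g \<or> (\<exists>x\<in>r g. x \<noteq> h e \<and> x \<in> Q)))"

definition nextP :: "'v set \<Rightarrow> 'e set \<Rightarrow> 'v set" where
  "nextP P C = P \<union> (\<Union>e\<in>C. r e)"

definition nextA :: "'v set \<Rightarrow> ('e \<times> 'v) set \<Rightarrow> 'e set \<Rightarrow> ('e \<times> 'v) set" where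
  "nextA P A C = A \<union> {(e, x). e \<in> C \<and> x \<in> r e \<and> x \<notin> P}"

definition nextQ :: "'v set \<Rightarrow> 'v set \<Rightarrow> ('e \<times> 'v) set \<Rightarrow> ('e \<Rightarrow> 'v) \<Rightarrow> 'e set \<Rightarrow> 'v set" where
  "nextQ B Q A h C = Q \<union>
     {x. \<exists>e\<in>C. x \<in> r e \<and> x \<noteq> h e \<and>
        (\<not> big e \<or> bigs h x = {} \<or> mid e \<and> (e, x) \<in> A \<and> h e \<in> Q - B \<and> forward Q h e)} \<union>
     {v. \<exists>e\<in>C. h e = v \<and> mid e \<and> bigs h v = {e} \<and> (\<exists>x\<in>r e. x \<noteq> v \<and> x \<in> Q)}"

text \<open>The sum \<open>card P + card Q\<close> can grow at most \<open>2 * card V\<close> times, so \<open>K\<close> stages are enough for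
  everything to become stationary between two stages at which light edges are counted.\<close>

definition K :: nat where "K = 2 * card V + 3"

primrec st :: "('e \<Rightarrow> 'v) \<Rightarrow> nat \<Rightarrow> 'v set \<times> 'v set \<times> ('e \<times> 'v) set" where
  "st h 0 = (bad h, bad h, {})"
| "st h (Suc n) = (case st h n of (P, Q, A) \<Rightarrow>
     let C = counted (K dvd n) P Q h in (nextP P C, nextQ (bad h) Q A h C, nextA P A C))"

definition PP where "PP h n = fst (st h n)"
definition QQ where "QQ h n = fst (snd (st h n))"
definition AA where "AA h n = snd (snd (st h n))"
definition CC where "CC h n = counted (K dvd n) (PP h n) (QQ h n) h"

lemma st_eq: "st h n = (PP h n, QQ h n, AA h n)"
  by (simp add: PP_def QQ_def AA_def)

lemma PQA_0: "PP h 0 = bad h" "QQ h 0 = bad h" "AA h 0 = {}"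
  by (simp_all add: PP_def QQ_def AA_def)

lemma PQA_Suc:
  "PP h (Suc n) = nextP (PP h n) (CC h n)"
  "QQ h (Suc n) = nextQ (bad h) (QQ h n) (AA h n) h (CC h n)"
  "AA h (Suc n) = nextA (PP h n) (AA h n) (CC h n)"
  unfolding CC_def
  by (simp_all add: PP_def QQ_def AA_def Let_def split: prod.split)

text \<open>\<open>cost (Suc n)\<close> encodes a lexicographic pair: few counted edges, then large sets \<open>P\<close> and \<open>Q\<close>.\<close>

fun cost :: "nat \<Rightarrow> ('e \<Rightarrow> 'v) \<Rightarrow> nat" where
  "cost 0 h = card {e\<in>E. h e \<in> bad h}"
| "cost (Suc n) h = card (CC h n) * (2 * card V + 1)
     + (2 * card V - (card (PP h (Suc n)) + card (QQ h (Suc n))))"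

definition optimal :: "nat \<Rightarrow> ('e \<Rightarrow> 'v) \<Rightarrow> bool" where
  "optimal N h \<longleftrightarrow> h \<in> oris \<and>
     (\<forall>h'\<in>oris. \<forall>i<N. (\<forall>j<i. cost j h' = cost j h) \<longrightarrow> cost i h \<le> cost i h')"

lemma finite_oris: "finite oris"
  unfolding oris_def using finite_subset[OF r_sub finite_V] by (intro finite_PiE finite_E)

lemma oris_nonempty: "oris \<noteq> {}"
  proof -
  have "r e \<noteq> {}" if "e \<in> E" for e using r_card[OF that] by auto
  then show ?thesis unfolding oris_def PiE_eq_empty_iff by blast
qed

lemma ex_optimal: "\<exists>h. optimal N h"
  using lex_min[OF finite_oris oris_nonempty, of N cost] by (auto simp: optimal_def)

lemma optimalD:
  assumes "optimal N h" "h' \<in> oris" "i < N" "\<And>j. j < i \<Longrightarrow> cost j h' = cost j h"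
  shows "cost i h \<le> cost i h'"
  using assms unfolding optimal_def by blast

lemma head_in: "h \<in> oris \<Longrightarrow> e \<in> E \<Longrightarrow> h e \<in> r e"
  by (auto simp: oris_def)

lemma CC_sub: "CC h n \<subseteq> E"
  by (auto simp: counted_def CC_def)

lemma finite_CC: "finite (CC h n)"
  using CC_sub finite_E finite_subset by blast

lemma nextP_sub: "P \<subseteq> V \<Longrightarrow> C \<subseteq> E \<Longrightarrow> nextP P C \<subseteq> V"
  using r_sub unfolding nextP_def by blast

lemma nextQ_sub: "h \<in> oris \<Longrightarrow> Q \<subseteq> P \<Longrightarrow> C \<subseteq> E \<Longrightarrow> nextQ B Q A h C \<subseteq> nextP P C"
  using head_in unfolding nextP_def nextQ_def by blast

lemma PQ_sub: assumes "h \<in> oris" shows "QQ h n \<subseteq> PP h n \<and> PP h n \<subseteq> V"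
proof (induction n)
  case 0
  then show ?case by (auto simp: PQA_0 bad_def)
next
  case (Suc n)
  show ?case unfolding PQA_Suc
    using nextP_sub[OF conjunct2[OF Suc] CC_sub] nextQ_sub[OF assms conjunct1[OF Suc] CC_sub] by blast
qed

lemma finite_PQ: assumes "h \<in> oris" shows "finite (PP h n)" "finite (QQ h n)"
  using PQ_sub[OF assms, of n] finite_V by (meson finite_subset)+

lemma PQ_card_le: assumes "h \<in> oris" shows "card (PP h n) + card (QQ h n) \<le> 2 * card V"
  proof -
  have "PP h n \<subseteq> V" "QQ h n \<subseteq> V" using PQ_sub[OF assms, of n] by auto
  then show ?thesis using card_mono[OF finite_V, of "PP h n"] card_mono[OF finite_V, of "QQ h n"] by linarith
qed

lemma PQ_Suc_mono: "PP h n \<subseteq> PP h (Suc n)" "QQ h n \<subseteq> QQ h (Suc n)" "AA h n \<subseteq> AA h (Suc n)"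
  by (auto simp: PQA_Suc nextP_def nextQ_def nextA_def)

lemma PQ_mono: assumes "m \<le> n"
  shows "PP h m \<subseteq> PP h n" "QQ h m \<subseteq> QQ h n" "AA h m \<subseteq> AA h n"
  using lift_Suc_mono_le[of "PP h", OF PQ_Suc_mono(1) assms]
    lift_Suc_mono_le[of "QQ h", OF PQ_Suc_mono(2) assms]
    lift_Suc_mono_le[of "AA h", OF PQ_Suc_mono(3) assms] by blast+

text \<open>It is enough to know that \<open>Q\<close> does not shrink under \<open>h'\<close>: with
  equal counted edges and equal \<open>P\<close>, a strictly larger \<open>Q\<close> would
  contradict optimality. So both searches coincide up to stage \<open>i\<close>. In the comparison
  of \<open>cost (Suc i)\<close> the second component is at most \<open>2 * card V\<close> and
  cannot outweigh the first.\<close>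

lemma optimal_same_prefix:
  assumes opt: "optimal N h" and h': "h' \<in> oris" and N: "Suc i < N"
    and bad: "bad h' = bad h" and heads: "{e\<in>E. h' e \<in> bad h} = {e\<in>E. h e \<in> bad h}"
    and C: "\<And>j. j < i \<Longrightarrow> counted (K dvd j) (PP h j) (QQ h j) h' = CC h j"
    and Q: "\<And>j. j < i \<Longrightarrow> QQ h (Suc j) \<subseteq> nextQ (bad h) (QQ h j) (AA h j) h' (CC h j)"
  shows "card (CC h i) \<le> card (counted (K dvd i) (PP h i) (QQ h i) h')"
proof -
  have h: "h \<in> oris" using opt by (simp add: optimal_def)
  have "st h' j = st h j \<and> (\<forall>k\<le>j. cost k h' = cost k h)" if "j \<le> i" for j
    using that
  proof (induction j)
    case 0
    then show ?case using bad heads by simp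
  next
    case (Suc j)
    then have IH: "st h' j = st h j" "\<forall>k\<le>j. cost k h' = cost k h" and ji: "j < i" by auto
    then have eq: "PP h' j = PP h j" "QQ h' j = QQ h j" "AA h' j = AA h j"
      by (auto simp: PP_def QQ_def AA_def)
    have CC: "CC h' j = CC h j" unfolding CC_def[of h'] eq using C[OF ji] .
    have P': "PP h' (Suc j) = PP h (Suc j)" and A': "AA h' (Suc j) = AA h (Suc j)"
      unfolding PQA_Suc CC eq by simp_all
    have Q': "QQ h (Suc j) \<subseteq> QQ h' (Suc j)"
      unfolding PQA_Suc(2)[of h'] CC eq bad using Q[OF ji] .
    have "cost (Suc j) h \<le> cost (Suc j) h'"
      using opt h' IH(2) N ji unfolding optimal_def by (auto simp: less_Suc_eq_le simp del: cost.simps)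
    then have "card (PP h' (Suc j)) + card (QQ h' (Suc j)) \<le> card (PP h (Suc j)) + card (QQ h (Suc j))"
      using PQ_card_le[OF h', of "Suc j"] PQ_card_le[OF h, of "Suc j"] by (simp add: CC)
    then have "card (QQ h' (Suc j)) \<le> card (QQ h (Suc j))" using P' by simp
    then have Qe: "QQ h' (Suc j) = QQ h (Suc j)"
      using card_seteq[OF finite_PQ(2)[OF h'] Q'] by simp
    have "st h' (Suc j) = st h (Suc j)" using P' A' Qe by (simp add: st_eq)
    moreover have "cost (Suc j) h' = cost (Suc j) h" using P' Qe CC by simp
    ultimately show ?case using IH(2) by (auto simp: le_Suc_eq simp del: cost.simps)
  qed
  from this[of i] have st: "st h' i = st h i" and c: "\<forall>k<Suc i. cost k h' = cost k h" by auto
  have eq: "PP h' i = PP h i" "QQ h' i = QQ h i" using st by (auto simp: PP_def QQ_def)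
  have "cost (Suc i) h \<le> cost (Suc i) h'" using opt h' N c unfolding optimal_def by blast
  then have le: "card (CC h i) * (2 * card V + 1) \<le> card (CC h' i) * (2 * card V + 1) + 2 * card V"
    by simp
  have "card (CC h i) \<le> card (CC h' i)"
  proof (rule ccontr)
    assume "\<not> ?thesis"
    then have "(card (CC h' i) + 1) * (2 * card V + 1) \<le> card (CC h i) * (2 * card V + 1)"
      by (intro mult_le_mono1) simp
    then show False using le by (simp add: algebra_simps)
  qed
  then show ?thesis by (simp add: CC_def eq)
qed

end

section \<open>Flipping an edge while light edges make way\<close>

context balancing begin

definition divert :: "('e \<Rightarrow> 'v) \<Rightarrow> 'e \<Rightarrow> 'v \<Rightarrow> 'e set \<Rightarrow> ('e \<Rightarrow> 'v) \<Rightarrow> 'e \<Rightarrow> 'v" where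
  "divert h e v X g = (\<lambda>q. if q = e then v else if q \<in> X then g q else h q)"

lemma bad_sub_QQ: "bad h \<subseteq> QQ h n"
  using PQ_mono(2)[of 0 n h] by (simp add: PQA_0)

lemma load_outside:
  assumes "h \<in> oris" "x \<notin> V" shows "load h x = 0"
proof -
  have "{e\<in>E. h e = x} = {}" using head_in[OF assms(1)] r_sub assms(2) by blast
  then show ?thesis by (simp only: load_def sum.empty)
qed

lemma load_mono:
  assumes "{e\<in>E. h' e = x} \<subseteq> {e\<in>E. h e = x}" shows "load h' x \<le> load h x"
  unfolding load_def using assms w_pos by (intro sum_mono2) (auto simp: finite_E less_imp_le)

lemma not_bad_iff: "h \<in> oris \<Longrightarrow> x \<notin> bad h \<longleftrightarrow> load h x \<le> T"
  using load_outside[of h x] by (cases "x \<in> V") (auto simp: bad_def)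

text \<open>Otherwise the diverted orientation is better than \<open>h\<close>. It creates no
  overloaded vertex. If the old holder of \<open>e\<close> was overloaded, \<open>cost 0\<close>
  drops; if not, the search is unchanged before stage \<open>i\<close>, and at stage
  \<open>i\<close> the edge \<open>e\<close> is no longer counted while no diverted edge becomes
  counted.\<close>

lemma flip_load:
  assumes opt: "optimal N h" and N: "Suc i < N"
    and e: "e \<in> CC h i" and first: "\<And>j. j < i \<Longrightarrow> e \<notin> CC h j"
    and v: "v \<in> r e" "v \<noteq> h e" "v \<notin> QQ h i" "big e \<Longrightarrow> v \<notin> PP h i"
    and X: "X \<subseteq> {q\<in>E. light q \<and> h q = v}"
    and g: "\<And>q. q \<in> X \<Longrightarrow> g q \<in> r q" "\<And>q. q \<in> X \<Longrightarrow> g q \<noteq> v"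
      "\<And>q. q \<in> X \<Longrightarrow> g q \<notin> QQ h (K * (i div K))"
      "\<And>q. q \<in> X \<Longrightarrow> load h (g q) + (\<Sum>q'\<in>{q'\<in>X. g q' = g q}. w q') \<le> T"
  shows "T < load h v - (\<Sum>q\<in>X. w q) + w e"
proof (rule ccontr)
  assume neg: "\<not> ?thesis"
  define h' where "h' = divert h e v X g"
  have h: "h \<in> oris" using opt by (simp add: optimal_def)
  have eE: "e \<in> E" using e CC_sub by blast
  have eX: "e \<notin> X" using X v(2) by auto
  have finX: "finite X" using X by (rule finite_subset) (simp add: finite_E)
  have h'e: "h' e = v" by (simp add: h'_def divert_def)
  have h'X: "h' q = g q" if "q \<in> X" for q using that eX by (auto simp: h'_def divert_def)
  have h'o: "h' q = h q" if "q \<noteq> e" "q \<notin> X" for q using that by (auto simp: h'_def divert_def)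
  have h': "h' \<in> oris"
  proof -
    have "h' q \<in> r q" if "q \<in> E" for q
      using that head_in[OF h] v(1) g(1) by (simp add: h'_def divert_def)
    moreover have "h' q = undefined" if "q \<notin> E" for q
      using that h eE X by (auto simp: h'_def divert_def oris_def PiE_def extensional_def)
    ultimately show ?thesis by (auto simp: oris_def)
  qed
  have vB: "v \<notin> bad h" using v(3) bad_sub_QQ by blast
  have gB: "g q \<notin> bad h" if "q \<in> X" for q using g(3)[OF that] bad_sub_QQ by blast
  have loadv: "load h' v \<le> T"
  proof -
    have "{q\<in>E. h' q = v} = insert e ({q\<in>E. h q = v} - X)"
      using eE X g(2) by (auto simp: h'_def divert_def)
    moreover have "e \<notin> {q\<in>E. h q = v} - X" using v(2) by auto
    ultimately have "load h' v = w e + (\<Sum>q\<in>{q\<in>E. h q = v} - X. w q)"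
      by (simp add: load_def finite_E)
    also have "\<dots> = w e + (load h v - (\<Sum>q\<in>X. w q))"
      using X by (subst sum_diff) (auto simp: load_def finite_E)
    finally show ?thesis using neg by simp
  qed
  have loadg: "load h' (g q) \<le> T" if q: "q \<in> X" for q
  proof -
    have "{q'\<in>E. h' q' = g q} \<subseteq> {q'\<in>E. h q' = g q} \<union> {q'\<in>X. g q' = g q}"
      using g(2)[OF q] by (auto simp: h'_def divert_def split: if_splits)
    then have "load h' (g q) \<le> (\<Sum>q'\<in>{q'\<in>E. h q' = g q} \<union> {q'\<in>X. g q' = g q}. w q')"
      unfolding load_def using finX X w_pos
      by (intro sum_mono2) (auto simp: finite_E less_imp_le)
    also have "\<dots> \<le> load h (g q) + (\<Sum>q'\<in>{q'\<in>X. g q' = g q}. w q')"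
    proof -
      have "0 \<le> (\<Sum>q'\<in>{q'\<in>E. h q' = g q} \<inter> {q'\<in>X. g q' = g q}. w q')"
        using w_pos by (intro sum_nonneg) (auto simp: less_imp_le)
      then show ?thesis unfolding load_def using finX by (subst sum_Un) (auto simp: finite_E)
    qed
    finally show ?thesis using g(4)[OF q] by simp
  qed
  have loado: "load h' x \<le> load h x" if "x \<noteq> v" "x \<notin> g ` X" for x
    using that by (intro load_mono) (auto simp: h'_def divert_def split: if_splits)
  have loadeq: "load h' x = load h x" if "x \<noteq> v" "x \<notin> g ` X" "x \<noteq> h e" for x
  proof -
    have "{q\<in>E. h' q = x} = {q\<in>E. h q = x}"
      using that X by (auto simp: h'_def divert_def split: if_splits)
    then show ?thesis by (simp add: load_def)
  qed
  have bad_sub: "bad h' \<subseteq> bad h"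
  proof
    fix x assume x: "x \<in> bad h'"
    have "\<not> load h' x \<le> T" using x by (simp add: bad_def)
    then have "x \<noteq> v" "x \<notin> g ` X" using loadv loadg by blast+
    with x loado[of x] show "x \<in> bad h" by (auto simp: bad_def)
  qed
  have notB: "h e \<notin> bad h"
  proof
    assume p: "h e \<in> bad h"
    have "{q\<in>E. h' q \<in> bad h'} \<subset> {q\<in>E. h q \<in> bad h}"
    proof
      show "{q\<in>E. h' q \<in> bad h'} \<subseteq> {q\<in>E. h q \<in> bad h}"
        using bad_sub vB gB by (auto simp: h'_def divert_def split: if_splits)
      have "e \<notin> {q\<in>E. h' q \<in> bad h'}" using h'e vB bad_sub by auto
      then show "{q\<in>E. h' q \<in> bad h'} \<noteq> {q\<in>E. h q \<in> bad h}" using p eE by blast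
    qed
    then have "cost 0 h' < cost 0 h" by (simp add: psubset_card_mono finite_E)
    moreover have "cost 0 h \<le> cost 0 h'" by (rule optimalD[OF opt h']) (use N in simp_all)
    ultimately show False by simp
  qed
  have bad_eq: "bad h' = bad h"
  proof
    show "bad h \<subseteq> bad h'"
    proof
      fix x assume x: "x \<in> bad h"
      then have "x \<noteq> v" "x \<notin> g ` X" "x \<noteq> h e" using vB gB notB by auto
      with x loadeq[of x] show "x \<in> bad h'" by (auto simp: bad_def)
    qed
  qed (rule bad_sub)
  have heads: "{q\<in>E. h' q \<in> bad h} = {q\<in>E. h q \<in> bad h}"
    using vB gB notB X by (auto simp: h'_def divert_def split: if_splits)
  have light_not: "\<not> big q" "\<not> heavy q" if "light q" for q
    using that by (auto simp: light_def big_def heavy_def)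
  have XC: "q \<notin> CC h j" if "q \<in> X" "j \<le> i" for q j
    using that X v(3) PQ_mono(2)[OF that(2), of h] light_not[of q] by (auto simp: CC_def counted_def)
  \<comment> \<open>Light edges count only at multiples of \<open>K\<close>. The last one up to
    \<open>i\<close> is \<open>K * (i div K)\<close>, and at that stage the new holder is still
    outside of \<open>Q\<close>.\<close>
  have XC': "q \<notin> counted (K dvd j) (PP h j) (QQ h j) h'" if q: "q \<in> X" and j: "j \<le> i" for q j
  proof
    assume a: "q \<in> counted (K dvd j) (PP h j) (QQ h j) h'"
    have "light q" using q X by auto
    then have "K dvd j" "g q \<in> QQ h j" using a light_not[of q] h'X[OF q] by (auto simp: counted_def)
    moreover have "j \<le> K * (i div K)" using \<open>K dvd j\<close> j
      by (metis div_le_mono dvd_mult_div_cancel mult_le_mono2)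
    ultimately show False using g(3)[OF q] PQ_mono(2)[of j "K * (i div K)" h] by blast
  qed
  have eC': "e \<notin> counted (K dvd j) (PP h j) (QQ h j) h'" if "j \<le> i" for j
    using PQ_mono(1,2)[OF that, of h] v(3,4) h'e by (auto simp: counted_def)
  have oC: "q \<in> counted (K dvd j) (PP h j) (QQ h j) h' \<longleftrightarrow> q \<in> CC h j" if "q \<noteq> e" "q \<notin> X" for q j
    using h'o[OF that] by (simp add: CC_def counted_def)
  have "card (CC h i) \<le> card (counted (K dvd i) (PP h i) (QQ h i) h')"
  proof (rule optimal_same_prefix[OF opt h' N bad_eq heads])
    fix j assume j: "j < i"
    show "counted (K dvd j) (PP h j) (QQ h j) h' = CC h j"
      using XC XC' eC' oC first[OF j] j by (metis less_imp_le_nat set_eqI)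
    \<comment> \<open>A big \<open>e\<close> with holder in \<open>P\<close> at stage
      \<open>j\<close> would have been counted there, \<open>v\<close> is outside of
      \<open>P\<close> if \<open>e\<close> is big, and diverted edges are light.\<close>
    have bigs_eq: "bigs h' u = bigs h u" if u: "u \<in> PP h j" for u
    proof -
      have "u \<noteq> v \<and> u \<noteq> h e" if "big e"
        using that u v(4) PQ_mono(1)[of j i h] j first[OF j] eE by (auto simp: CC_def counted_def)
      then have "q \<in> bigs h' u \<longleftrightarrow> q \<in> bigs h u" for q
        using light_not(1)[of q] X h'X[of q] h'e h'o[of q] by (cases "q = e"; cases "q \<in> X") (auto simp: bigs_def)
      then show ?thesis by blast
    qed
    have heq: "h' q = h q" if "q \<in> CC h j" for q
      using that XC[of q j] first[OF j] j h'o[of q] by (metis less_imp_le_nat)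
    have PQ: "QQ h j \<subseteq> PP h j" using PQ_sub[OF h] by blast
    have QS: "QQ h (Suc j) \<subseteq> QQ h i" using j by (intro PQ_mono) simp
    show "QQ h (Suc j) \<subseteq> nextQ (bad h) (QQ h j) (AA h j) h' (CC h j)"
    proof
      fix x assume xQ: "x \<in> QQ h (Suc j)"
      then have xv: "x \<noteq> v" using QS v(3) by blast
      from xQ consider "x \<in> QQ h j"
        | e1 where "e1 \<in> CC h j" "x \<in> r e1" "x \<noteq> h e1" "\<not> big e1"
        | e1 where "e1 \<in> CC h j" "x \<in> r e1" "x \<noteq> h e1" "bigs h x = {}"
        | e1 where "e1 \<in> CC h j" "x \<in> r e1" "x \<noteq> h e1" "mid e1" "(e1, x) \<in> AA h j"
            "h e1 \<in> QQ h j - bad h" "forward (QQ h j) h e1"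
        | e1 where "e1 \<in> CC h j" "h e1 = x" "mid e1" "bigs h x = {e1}" "\<exists>y\<in>r e1. y \<noteq> x \<and> y \<in> QQ h j"
        unfolding PQA_Suc nextQ_def by blast
      then show "x \<in> nextQ (bad h) (QQ h j) (AA h j) h' (CC h j)"
      proof cases
        case 1
        then show ?thesis by (simp add: nextQ_def)
      next
        case 2
        then show ?thesis using heq[of e1] unfolding nextQ_def by auto
      next
        case 3
        \<comment> \<open>Only \<open>v\<close> can gain a big edge, and \<open>x\<close> differs
          from \<open>v\<close>.\<close>
        have "q \<notin> bigs h' x" for q
          using 3 light_not(1)[of q] X h'X[of q] h'e h'o[of q] xv
          by (cases "q = e"; cases "q \<in> X") (auto simp: bigs_def)
        then have "bigs h' x = {}" by blast
        then show ?thesis using 3 heq[of e1] unfolding nextQ_def by auto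
      next
        case 4
        have "h' e1 = h e1" using heq 4 by blast
        moreover have "bigs h' (h e1) = bigs h (h e1)" using bigs_eq PQ 4 by blast
        ultimately have "forward (QQ h j) h' e1" using 4(7) by (simp add: forward_def)
        then show ?thesis using 4 \<open>h' e1 = h e1\<close> unfolding nextQ_def by auto
      next
        case 5
        have "h' e1 = h e1" using heq 5 by blast
        have "x \<in> PP h j"
          using 5 light_not by (auto simp: CC_def counted_def mid_def heavy_def light_def)
        then have "bigs h' x = {e1}" using bigs_eq 5 by blast
        then show ?thesis using 5 \<open>h' e1 = h e1\<close> unfolding nextQ_def by auto
      qed
    qed
  qed
  moreover have "counted (K dvd i) (PP h i) (QQ h i) h' \<subset> CC h i"
    using XC XC' eC' oC e by (metis order_refl psubsetI subsetI)
  ultimately show False using psubset_card_mono[OF finite_CC] by (metis leD)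
qed

end

section \<open>Phases and triggers\<close>

text \<open>Adding elements one at a time raises the sum by less than \<open>n\<close> per step, so
  it cannot jump over the interval from \<open>n\<close> to \<open>2 * n\<close>.\<close>

lemma subset_sum_between:
  fixes w :: "'a \<Rightarrow> real"
  assumes "finite S" "n \<le> (\<Sum>q\<in>S. w q)" "0 < n" "\<And>q. q \<in> S \<Longrightarrow> 0 \<le> w q \<and> w q < n"
  shows "\<exists>X\<subseteq>S. n \<le> (\<Sum>q\<in>X. w q) \<and> (\<Sum>q\<in>X. w q) < 2 * n"
  using assms
proof (induction S rule: finite_induct)
  case empty
  then show ?case by simp
next
  case (insert q S)
  show ?case
  proof (cases "n \<le> (\<Sum>q\<in>S. w q)")
    case True
    then show ?thesis using insert.IH insert.prems by (meson insertI2 subset_insertI2)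
  next
    case False
    then have "(\<Sum>q\<in>insert q S. w q) < 2 * n"
      using insert.hyps insert.prems(3)[of q] by simp
    then show ?thesis using insert.prems(1) by blast
  qed
qed

lemma bounded_not_increasing:
  fixes f :: "nat \<Rightarrow> nat"
  assumes "\<And>n. f n \<le> b"
  shows "\<exists>n\<le>b. f (Suc n) \<le> f n"
proof (rule ccontr)
  assume "\<not> ?thesis"
  then have a: "f n < f (Suc n)" if "n \<le> b" for n using that by (meson not_le)
  have "n \<le> Suc b \<Longrightarrow> n \<le> f n" for n
  proof (induction n)
    case (Suc n)
    then show ?case using a[of n] by simp
  qed simp
  from this[of "Suc b"] show False using assms[of "Suc b"] by simp
qed

context balancing begin

text \<open>These are the light edges that \<open>v\<close> can give away: at their other ends there
  is room for a total weight of 0.42.\<close>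

definition loose_at :: "('e \<Rightarrow> 'v) \<Rightarrow> 'v set \<Rightarrow> 'v \<Rightarrow> 'e set" where
  "loose_at h Q v = {q\<in>E. light q \<and> h q = v \<and> (\<exists>x\<in>r q. x \<noteq> v \<and> x \<notin> Q \<and> load h x \<le> T - 42/100)}"

lemma flip_full:
  assumes "optimal N h" "Suc i < N" "e \<in> CC h i" "\<And>j. j < i \<Longrightarrow> e \<notin> CC h j"
    and "v \<in> r e" "v \<noteq> h e" "v \<notin> QQ h i" "big e \<Longrightarrow> v \<notin> PP h i"
  shows "T < load h v + w e"
  using flip_load[OF assms, of "{}" h] by simp

text \<open>If the loose edges weighed more than the excess \<open>n\<close>, some of them could
  make way for \<open>e\<close>: a single one of weight at least \<open>n\<close>, or a set of
  weight between \<open>n\<close> and \<open>2 * n\<close>. As \<open>n\<close> is at most 0.2, the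
  moved weight is at most 0.42 in both cases and fits even if it all goes to the same
  vertex.\<close>

lemma flip_loose:
  assumes opt: "optimal N h" "Suc i < N" "e \<in> CC h i" "\<And>j. j < i \<Longrightarrow> e \<notin> CC h j"
    and v: "v \<in> r e" "v \<noteq> h e" "v \<notin> QQ h i" "big e \<Longrightarrow> v \<notin> PP h i"
    and n: "load h v + w e - T \<le> 2/10" and Q: "QQ h (K * (i div K)) \<subseteq> Q"
  shows "(\<Sum>q\<in>loose_at h Q v. w q) \<le> load h v + w e - T"
proof (rule ccontr)
  define n where "n = load h v + w e - T"
  assume "\<not> ?thesis"
  then have gt: "n \<le> (\<Sum>q\<in>loose_at h Q v. w q)" by (simp add: n_def)
  have n0: "0 < n" using flip_full[OF assms(1-8)] by (simp add: n_def)
  have fin: "finite (loose_at h Q v)" by (simp add: loose_at_def finite_E)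
  have wl: "0 \<le> w q \<and> w q \<le> 42/100" if "q \<in> loose_at h Q v" for q
    using that w_pos[of q] by (auto simp: loose_at_def light_def)
  obtain X where X: "X \<subseteq> loose_at h Q v" "n \<le> (\<Sum>q\<in>X. w q)" "(\<Sum>q\<in>X. w q) \<le> 42/100"
  proof (cases "\<exists>q\<in>loose_at h Q v. n \<le> w q")
    case True
    then obtain q where "q \<in> loose_at h Q v" "n \<le> w q" by blast
    then show ?thesis using that[of "{q}"] wl by simp
  next
    case False
    then have "0 \<le> w q \<and> w q < n" if "q \<in> loose_at h Q v" for q using wl[OF that] that by auto
    then obtain X where "X \<subseteq> loose_at h Q v" "n \<le> (\<Sum>q\<in>X. w q)" "(\<Sum>q\<in>X. w q) < 2 * n"
      using subset_sum_between[OF fin gt n0] by blast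
    then show ?thesis using that[of X] n by (simp add: n_def)
  qed
  define g where "g = (\<lambda>q. SOME x. x \<in> r q \<and> x \<noteq> v \<and> x \<notin> Q \<and> load h x \<le> T - 42/100)"
  have g: "g q \<in> r q" "g q \<noteq> v" "g q \<notin> Q" "load h (g q) \<le> T - 42/100" if "q \<in> X" for q
  proof -
    have "\<exists>x. x \<in> r q \<and> x \<noteq> v \<and> x \<notin> Q \<and> load h x \<le> T - 42/100"
      using that X(1) by (auto simp: loose_at_def)
    from someI_ex[OF this] show "g q \<in> r q" "g q \<noteq> v" "g q \<notin> Q" "load h (g q) \<le> T - 42/100"
      by (auto simp: g_def)
  qed
  have finX: "finite X" using X(1) fin finite_subset by blast
  have "T < load h v - (\<Sum>q\<in>X. w q) + w e"
  proof (rule flip_load[OF assms(1-8), of X g])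
    show "X \<subseteq> {q \<in> E. light q \<and> h q = v}" using X(1) by (auto simp: loose_at_def)
    fix q assume q: "q \<in> X"
    show "g q \<in> r q" "g q \<noteq> v" using g q by auto
    show "g q \<notin> QQ h (K * (i div K))" using g(3)[OF q] Q by blast
    have "(\<Sum>q'\<in>{q'\<in>X. g q' = g q}. w q') \<le> (\<Sum>q\<in>X. w q)"
      using finX X(1) wl by (intro sum_mono2) auto
    then show "load h (g q) + (\<Sum>q'\<in>{q'\<in>X. g q' = g q}. w q') \<le> T"
      using g(4)[OF q] X(3) by simp
  qed
  then show False using X(2) by (simp add: n_def)
qed

lemma K_pos: "0 < K" by (simp add: K_def)

lemma not_K_dvd: assumes "K * m < i" "i < K * Suc m" shows "\<not> K dvd i"
proof
  assume "K dvd i"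
  then obtain k where "i = K * k" by blast
  then have "m < k" "k < Suc m" using assms nat_mult_less_cancel_disj[of K] by blast+
  then show False by simp
qed

lemma st_Suc_cong:
  assumes "st h (Suc n) = st h n" "\<not> K dvd n" "\<not> K dvd Suc n"
  shows "st h (Suc (Suc n)) = st h (Suc n)"
  using assms by (simp split: prod.splits)

text \<open>Strictly between two multiples of \<open>K\<close> the transition does not depend on the
  stage. \<open>P\<close> and \<open>Q\<close> must pause once within \<open>2 * card V\<close>
  growth steps, then \<open>A\<close> pauses too, and a state that repeats stays until the next
  multiple. Stability from two stages before that multiple makes the end of a phase a fixed point
  (\<open>phase_closed\<close>); stability from one stage before excludes entries at multiples of
  \<open>K\<close>.\<close>

lemma st_stable:
  assumes h: "h \<in> oris" shows "st h (K * Suc m - 2) = st h (K * Suc m)"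
    and "st h (K * Suc m - 1) = st h (K * Suc m)"
proof -
  define f where "f n = card (PP h (K * m + 1 + n)) + card (QQ h (K * m + 1 + n))" for n
  obtain n where n: "n \<le> 2 * card V" "f (Suc n) \<le> f n"
    using bounded_not_increasing[of f "2 * card V"] PQ_card_le[OF h] by (auto simp: f_def)
  define a where "a = K * m + 1 + n"
  have KS: "K * Suc m = K * m + 2 * card V + 3" by (simp add: K_def)
  have ndvd: "\<not> K dvd i" if "K * m < i" "i < K * Suc m" for i
    using that by (rule not_K_dvd)
  have "card (PP h (Suc a)) + card (QQ h (Suc a)) \<le> card (PP h a) + card (QQ h a)"
    using n(2) by (simp add: f_def a_def)
  moreover have "card (PP h a) \<le> card (PP h (Suc a))" "card (QQ h a) \<le> card (QQ h (Suc a))"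
    using card_mono[OF finite_PQ(1)[OF h] PQ_Suc_mono(1)] card_mono[OF finite_PQ(2)[OF h] PQ_Suc_mono(2)] by blast+
  ultimately have P: "PP h (Suc a) = PP h a" and Q: "QQ h (Suc a) = QQ h a"
    using card_seteq[OF finite_PQ(1)[OF h] PQ_Suc_mono(1)[of h a]] card_seteq[OF finite_PQ(2)[OF h] PQ_Suc_mono(2)[of h a]]
    by simp_all
  have "\<forall>e\<in>CC h a. r e \<subseteq> PP h a" using P unfolding PQA_Suc nextP_def by blast
  then have "AA h (Suc a) = AA h a" unfolding PQA_Suc nextA_def by blast
  then have sa: "st h (Suc a) = st h a" using P Q by (simp only: st_eq)
  have steps: "a + i < K * Suc m \<Longrightarrow> st h (Suc (a + i)) = st h (a + i)" for i
  proof (induction i)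
    case 0
    then show ?case using sa by simp
  next
    case (Suc i)
    then show ?case using st_Suc_cong[of h "a + i"] ndvd[of "a + i"] ndvd[of "Suc (a + i)"] by (simp add: a_def)
  qed
  have eqs: "a + i \<le> K * Suc m \<Longrightarrow> st h (a + i) = st h a" for i
  proof (induction i)
    case (Suc i)
    then show ?case using steps[of i] by (simp del: st.simps)
  qed simp
  have le: "a \<le> K * Suc m - 2" "2 \<le> K * Suc m" using n(1) KS by (auto simp: a_def)
  then show "st h (K * Suc m - 2) = st h (K * Suc m)"
    using eqs[of "K * Suc m - 2 - a"] eqs[of "K * Suc m - a"] by (simp del: st.simps)
  show "st h (K * Suc m - 1) = st h (K * Suc m)"
    using eqs[of "K * Suc m - 1 - a"] eqs[of "K * Suc m - a"] le by (simp del: st.simps)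
qed

text \<open>The outcome of phase \<open>m\<close>, in which light edges are counted at the first
  stage \<open>K * m\<close> only.\<close>

definition Qm :: "('e \<Rightarrow> 'v) \<Rightarrow> nat \<Rightarrow> 'v set" where "Qm h m = QQ h (K * Suc m)"
definition Pm :: "('e \<Rightarrow> 'v) \<Rightarrow> nat \<Rightarrow> 'v set" where "Pm h m = PP h (K * Suc m)"
definition Am :: "('e \<Rightarrow> 'v) \<Rightarrow> nat \<Rightarrow> ('e \<times> 'v) set" where "Am h m = AA h (K * Suc m)"

lemma phase_closed:
  assumes h: "h \<in> oris"
  shows "nextP (Pm h m) (counted False (Pm h m) (Qm h m) h) = Pm h m"
    and "nextQ (bad h) (Qm h m) (Am h m) h (counted False (Pm h m) (Qm h m) h) = Qm h m"
proof -
  let ?n = "K * Suc m - 2"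
  have "K * m < ?n" "?n < K * Suc m" "Suc ?n = K * Suc m - 1" by (auto simp: K_def)
  then have nd: "\<not> K dvd ?n" by (intro not_K_dvd)
  have s: "st h ?n = (Pm h m, Qm h m, Am h m)" "st h (Suc ?n) = (Pm h m, Qm h m, Am h m)"
    using st_stable[OF h, of m] \<open>Suc ?n = _\<close> by (simp_all only: Pm_def Qm_def Am_def st_eq)
  have "PP h ?n = Pm h m" "QQ h ?n = Qm h m" "AA h ?n = Am h m" "PP h (Suc ?n) = Pm h m" "QQ h (Suc ?n) = Qm h m"
    using s by (simp_all add: PP_def QQ_def AA_def del: st.simps)
  then show "nextP (Pm h m) (counted False (Pm h m) (Qm h m) h) = Pm h m"
    and "nextQ (bad h) (Qm h m) (Am h m) h (counted False (Pm h m) (Qm h m) h) = Qm h m"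
    using PQA_Suc(1,2)[of h ?n] nd by (simp_all add: CC_def)
qed

end

section \<open>Entry times, closed phases and blocked flips\<close>

locale optimal_orientation = balancing +
  fixes h :: "'b \<Rightarrow> 'a"
  assumes opt: "optimal (K * (2 * card V + 3)) h"
begin

abbreviation B where "B \<equiv> bad h"

text \<open>A phase that adds nothing. One exists among the first \<open>2 * card V + 1\<close>
  because \<open>P\<close> and \<open>Q\<close> have no room for more growth, so optimality for the
  stages below \<open>K * (2 * card V + 3)\<close> covers every stage in use
  (\<open>stage_ok\<close>).\<close>

definition m0 :: nat where
  "m0 = (SOME m. m \<le> 2 * card V \<and> PP h (K * m) = Pm h m \<and> QQ h (K * m) = Qm h m)"

definition Pf where "Pf = Pm h m0"
definition Qf where "Qf = Qm h m0"
text \<open>The name \<open>pi\<close> shadows the circle constant. Stages of entry are turned into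
  phases by \<open>pp\<close> and \<open>qq\<close>, on which the discount depends.\<close>

definition pi where "pi v = (LEAST n. v \<in> PP h n)"
definition qi where "qi v = (LEAST n. v \<in> QQ h n)"
definition pp where "pp v = pi v div K"
definition qq where "qq v = qi v div K"

text \<open>The reference set is \<open>Q\<close> at the start of the phase in which
  \<open>v\<close> enters, the last time before the entry that light edges could be counted.\<close>

definition loose :: "'a \<Rightarrow> 'b set" where "loose v = loose_at h (QQ h (K * qq v)) v"

text \<open>The edge \<open>e\<close> is responsible for the entry of \<open>x\<close> into \<open>P\<close>.\<close>

definition primary :: "'b \<Rightarrow> 'a \<Rightarrow> bool" where
  "primary e x \<longleftrightarrow> e \<in> E \<and> big e \<and> x \<in> r e \<and> h e \<in> Pf \<and> x \<in> Pf \<and> pi (h e) < pi x"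

lemma h_oris: "h \<in> oris"
  using opt by (simp add: optimal_def)

lemma m0: "m0 \<le> 2 * card V" "PP h (K * m0) = Pf" "QQ h (K * m0) = Qf"
proof -
  let ?f = "\<lambda>m. card (PP h (K * m)) + card (QQ h (K * m))"
  obtain m where m: "m \<le> 2 * card V" "?f (Suc m) \<le> ?f m"
    using bounded_not_increasing[of ?f "2 * card V"] PQ_card_le[OF h_oris] by blast
  have sub: "PP h (K * m) \<subseteq> PP h (K * Suc m)" "QQ h (K * m) \<subseteq> QQ h (K * Suc m)"
    by (intro PQ_mono; simp)+
  moreover have "card (PP h (K * m)) \<le> card (PP h (K * Suc m))" "card (QQ h (K * m)) \<le> card (QQ h (K * Suc m))"
    using card_mono[OF finite_PQ(1)[OF h_oris] sub(1)] card_mono[OF finite_PQ(2)[OF h_oris] sub(2)] by blast+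
  ultimately have "card (PP h (K * Suc m)) \<le> card (PP h (K * m))" "card (QQ h (K * Suc m)) \<le> card (QQ h (K * m))"
    using m(2) by linarith+
  then have "PP h (K * m) = PP h (K * Suc m)" "QQ h (K * m) = QQ h (K * Suc m)"
    using card_seteq[OF finite_PQ(1)[OF h_oris] sub(1)] card_seteq[OF finite_PQ(2)[OF h_oris] sub(2)]
    by blast+
  then have "\<exists>m. m \<le> 2 * card V \<and> PP h (K * m) = Pm h m \<and> QQ h (K * m) = Qm h m"
    using m(1) unfolding Pm_def Qm_def by blast
  from someI_ex[OF this] show "m0 \<le> 2 * card V" "PP h (K * m0) = Pf" "QQ h (K * m0) = Qf"
    by (auto simp: m0_def Pf_def Qf_def)
qed

lemma PQf: "Qf \<subseteq> Pf" "Pf \<subseteq> V" "B \<subseteq> Qf"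
  using PQ_sub[OF h_oris, of "K * m0"] m0(2,3) bad_sub_QQ[of h "K * m0"] by auto

lemma pi_le: "v \<in> PP h n \<Longrightarrow> pi v \<le> n" and qi_le: "v \<in> QQ h n \<Longrightarrow> qi v \<le> n"
  unfolding pi_def qi_def by (auto intro: Least_le)

lemma in_PP_iff: assumes "v \<in> Pf" shows "v \<in> PP h n \<longleftrightarrow> pi v \<le> n"
proof
  assume "pi v \<le> n"
  then have "PP h (pi v) \<subseteq> PP h n" by (rule PQ_mono)
  moreover have "v \<in> PP h (pi v)" unfolding pi_def by (rule LeastI[of _ "K * m0"]) (simp add: m0 assms)
  ultimately show "v \<in> PP h n" by (rule subsetD)
qed (rule pi_le)

lemma in_QQ_iff: assumes "v \<in> Qf" shows "v \<in> QQ h n \<longleftrightarrow> qi v \<le> n"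
proof
  assume "qi v \<le> n"
  then have "QQ h (qi v) \<subseteq> QQ h n" by (rule PQ_mono)
  moreover have "v \<in> QQ h (qi v)" unfolding qi_def by (rule LeastI[of _ "K * m0"]) (simp add: m0 assms)
  ultimately show "v \<in> QQ h n" by (rule subsetD)
qed (rule qi_le)

lemma in_Pf: "v \<in> PP h n \<Longrightarrow> n \<le> K * Suc m0 \<Longrightarrow> v \<in> Pf" and in_Qf: "v \<in> QQ h n \<Longrightarrow> n \<le> K * Suc m0 \<Longrightarrow> v \<in> Qf"
  unfolding Pf_def Qf_def Pm_def Qm_def using PQ_mono[of n "K * Suc m0" h] by blast+

text \<open>The sets at a positive multiple of \<open>K\<close> are already those of the stage
  before. Hence membership in \<open>Pm h m\<close> is the same as entry in a phase up to
  \<open>m\<close>, although \<open>Pm\<close> is taken at the first stage of the next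
  phase.\<close>

lemma pi_not_dvd: assumes "v \<in> Pf" "0 < pi v" shows "\<not> K dvd pi v"
proof
  assume "K dvd pi v"
  then obtain i where i: "pi v = K * i" by blast
  with assms(2) obtain k where k: "pi v = K * Suc k" by (cases i) auto
  have "v \<in> PP h (K * Suc k - 1)"
    using in_PP_iff[OF assms(1), of "K * Suc k"] st_stable(2)[OF h_oris, of k] k by (simp add: PP_def)
  then show False using pi_le[of v "K * Suc k - 1"] k K_pos assms(2) by simp
qed

lemma qi_not_dvd: assumes "v \<in> Qf" "0 < qi v" shows "\<not> K dvd qi v"
proof
  assume "K dvd qi v"
  then obtain i where i: "qi v = K * i" by blast
  with assms(2) obtain k where k: "qi v = K * Suc k" by (cases i) auto
  have "v \<in> QQ h (K * Suc k - 1)"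
    using in_QQ_iff[OF assms(1), of "K * Suc k"] st_stable(2)[OF h_oris, of k] k by (simp add: QQ_def)
  then show False using qi_le[of v "K * Suc k - 1"] k K_pos assms(2) by simp
qed

lemma in_Pm_iff: assumes "v \<in> Pf" shows "v \<in> Pm h m \<longleftrightarrow> pp v \<le> m"
proof -
  have "pp v \<le> m \<longleftrightarrow> pi v < Suc m * K"
    unfolding less_Suc_eq_le[symmetric] pp_def by (rule div_less_iff_less_mult[OF K_pos])
  moreover have "pi v \<noteq> K * Suc m"
  proof
    assume a: "pi v = K * Suc m"
    then have "\<not> K dvd pi v" using pi_not_dvd[OF assms] K_pos by simp
    then show False unfolding a by simp
  qed
  ultimately have "pp v \<le> m \<longleftrightarrow> pi v \<le> K * Suc m" by (auto simp: mult.commute[of K])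
  then show ?thesis by (simp add: Pm_def in_PP_iff[OF assms])
qed

lemma in_Qm_iff: assumes "v \<in> Qf" shows "v \<in> Qm h m \<longleftrightarrow> qq v \<le> m"
proof -
  have "qq v \<le> m \<longleftrightarrow> qi v < Suc m * K"
    unfolding less_Suc_eq_le[symmetric] qq_def by (rule div_less_iff_less_mult[OF K_pos])
  moreover have "qi v \<noteq> K * Suc m"
  proof
    assume a: "qi v = K * Suc m"
    then have "\<not> K dvd qi v" using qi_not_dvd[OF assms] K_pos by simp
    then show False unfolding a by simp
  qed
  ultimately have "qq v \<le> m \<longleftrightarrow> qi v \<le> K * Suc m" by (auto simp: mult.commute[of K])
  then show ?thesis by (simp add: Qm_def in_QQ_iff[OF assms])
qed

lemma m0_le: "v \<in> Pf \<Longrightarrow> pp v \<le> m0" "v \<in> Qf \<Longrightarrow> qq v \<le> m0"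
  using in_Pm_iff[of v m0] in_Qm_iff[of v m0] unfolding Pf_def[symmetric] Qf_def[symmetric] by blast+

lemma Pm_sub: assumes "m \<le> m0" shows "Pm h m \<subseteq> Pf" "Qm h m \<subseteq> Qf"
proof -
  have "K * Suc m \<le> K * Suc m0" using assms by simp
  from PQ_mono[OF this] show "Pm h m \<subseteq> Pf" "Qm h m \<subseteq> Qf" by (auto simp: Pm_def Qm_def Pf_def Qf_def)
qed

lemma pp_le_qq: assumes "v \<in> Qf" shows "pi v \<le> qi v" "pp v \<le> qq v"
proof -
  have "v \<in> PP h (qi v)" using PQ_sub[OF h_oris] in_QQ_iff[OF assms, of "qi v"] by blast
  then show "pi v \<le> qi v" by (rule pi_le)
  then show "pp v \<le> qq v" by (simp add: pp_def qq_def div_le_mono)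
qed

lemma bad_index: assumes "v \<in> B" shows "pi v = 0" "qi v = 0" "pp v = 0" "qq v = 0"
  using assms pi_le[of v 0] qi_le[of v 0] unfolding pp_def qq_def PQA_0 by simp_all

lemma qi_pos: "v \<in> Qf \<Longrightarrow> v \<notin> B \<Longrightarrow> 0 < qi v" and pi_pos: "v \<in> Pf \<Longrightarrow> v \<notin> B \<Longrightarrow> 0 < pi v"
  using in_QQ_iff[of v 0] in_PP_iff[of v 0] unfolding PQA_0 by simp_all

lemma stage_bound: "v \<in> Qf \<Longrightarrow> qi v \<le> K * m0" "v \<in> Pf \<Longrightarrow> pi v \<le> K * m0"
  using qi_le[of v "K * m0"] pi_le[of v "K * m0"] unfolding m0 by simp_all

lemma stage_ok: assumes "i \<le> K * m0" shows "Suc i < K * (2 * card V + 3)"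
proof -
  have "K * m0 < K * Suc m0" using K_pos by simp
  moreover have "K * Suc m0 < K * (2 * card V + 3)" using m0(1) K_pos
    by (intro mult_less_mono2) simp_all
  ultimately show ?thesis using assms by (meson Suc_leI le_less_trans)
qed

text \<open>By the end of the phase in which the holder enters, the edge has been counted, and the
  sets at the end of a phase are closed under the rules.\<close>

lemma big_pending:
  assumes e: "e \<in> E" "big e" "h e \<in> Pf" "x \<in> r e"
  shows "x \<in> Pf" "pp x \<le> pp (h e)"
proof -
  have m: "pp (h e) \<le> m0" using m0_le e by blast
  have "e \<in> counted False (Pm h (pp (h e))) (Qm h (pp (h e))) h"
    using e in_Pm_iff[OF e(3)] by (simp add: counted_def)
  then have x: "x \<in> Pm h (pp (h e))"
    using phase_closed(1)[OF h_oris, of "pp (h e)"] e(4) unfolding nextP_def by blast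
  then show "x \<in> Pf" using Pm_sub[OF m] by blast
  then show "pp x \<le> pp (h e)" using in_Pm_iff x by blast
qed

lemma heavy_pending:
  assumes e: "e \<in> E" "heavy e" "h e \<in> Qf" "x \<in> r e" "x \<noteq> h e"
  shows "x \<in> Qf" "qq x \<le> qq (h e)"
proof -
  have m: "qq (h e) \<le> m0" using m0_le e by blast
  have nb: "\<not> big e" using e(2) by (simp add: heavy_def big_def)
  have "e \<in> counted False (Pm h (qq (h e))) (Qm h (qq (h e))) h"
    using e in_Qm_iff[OF e(3)] by (simp add: counted_def)
  then have x: "x \<in> Qm h (qq (h e))"
    using phase_closed(2)[OF h_oris, of "qq (h e)"] e(4,5) nb unfolding nextQ_def by blast
  then show "x \<in> Qf" using Pm_sub[OF m] by blast
  then show "qq x \<le> qq (h e)" using in_Qm_iff x by blast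
qed

text \<open>The first multiple of \<open>K\<close> not before \<open>qi v\<close>, hence the stage
  at which the light edges held by \<open>v\<close> are counted first; a positive
  \<open>qi v\<close> is never a multiple itself.\<close>

definition light_stage :: "'a \<Rightarrow> nat" where
  "light_stage v = (if qi v = 0 then 0 else K * Suc (qq v))"

lemma light_stage:
  assumes q: "q \<in> E" "light q" "h q \<in> Qf"
  shows "q \<in> CC h (light_stage (h q))" "j < light_stage (h q) \<Longrightarrow> q \<notin> CC h j" "light_stage (h q) \<le> K * m0"
proof -
  let ?v = "h q"
  have nb: "\<not> big q" "\<not> heavy q" using q(2) by (auto simp: light_def big_def heavy_def)
  have le: "qi ?v \<le> light_stage ?v"
    using dividend_less_times_div[OF K_pos, of "qi ?v"] by (simp add: light_stage_def qq_def)
  have dvd: "K dvd light_stage ?v" by (simp add: light_stage_def)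
  show "q \<in> CC h (light_stage ?v)" using q le dvd in_QQ_iff[OF q(3)] by (simp add: CC_def counted_def)
  show "q \<notin> CC h j" if j: "j < light_stage ?v"
  proof
    assume "q \<in> CC h j"
    then have a: "K dvd j" "qi ?v \<le> j" using nb in_QQ_iff[OF q(3)] by (auto simp: CC_def counted_def)
    have p: "0 < qi ?v" "j < K * Suc (qq ?v)" using j by (auto simp: light_stage_def split: if_splits)
    have "K * qq ?v \<le> qi ?v" by (simp add: qq_def)
    moreover have "K * qq ?v \<noteq> qi ?v" using qi_not_dvd[OF q(3) p(1)] by (metis dvd_triv_left)
    ultimately have "\<not> K dvd j" using not_K_dvd[of "qq ?v" j] a(2) p(2) by simp
    then show False using a(1) by blast
  qed
  show "light_stage ?v \<le> K * m0"
  proof (cases "qi ?v = 0")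
    case False
    then have "qi ?v \<noteq> K * m0" using qi_not_dvd[OF q(3)] by (metis dvd_triv_left neq0_conv)
    then have "qi ?v < K * m0" using stage_bound(1)[OF q(3)] by simp
    then have "Suc (qq ?v) \<le> m0"
      unfolding qq_def Suc_le_eq div_less_iff_less_mult[OF K_pos] by (simp only: mult.commute)
    then have "K * Suc (qq ?v) \<le> K * m0" by (rule mult_le_mono2)
    then show ?thesis by (simp add: light_stage_def)
  qed (simp add: light_stage_def)
qed

text \<open>If \<open>x\<close> enters a phase later than the holder, it was outside of
  \<open>Q\<close> when \<open>q\<close> was first counted, so the flip of \<open>q\<close> was
  blocked. If both enter in the same phase and \<open>x\<close> had room for 0.42, then
  \<open>x\<close> was outside of \<open>Q\<close> at the start of that phase, and \<open>q\<close>
  would be loose.\<close>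

lemma light_pending:
  assumes q: "q \<in> E" "light q" "h q \<in> Qf" "x \<in> r q" "x \<noteq> h q"
  shows "x \<in> Qf" "qq x \<le> Suc (qq (h q))"
    and "qq x = Suc (qq (h q)) \<Longrightarrow> T < load h x + w q"
    and "qq x = qq (h q) \<Longrightarrow> q \<notin> loose (h q) \<Longrightarrow> T - 42/100 < load h x"
proof -
  let ?v = "h q" and ?j = "light_stage (h q)"
  have nb: "\<not> big q" using q(2) by (auto simp: light_def big_def)
  have x: "x \<in> QQ h (Suc ?j)"
    using light_stage(1)[OF q(1-3)] q(4,5) nb unfolding PQA_Suc nextQ_def by blast
  have "Suc ?j \<le> K * Suc m0" using light_stage(3)[OF q(1-3)] K_pos by simp
  then show xQ: "x \<in> Qf" using in_Qf x by blast
  have K1: "1 < K" by (simp add: K_def)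
  have qx: "qi x \<le> Suc ?j" using qi_le x by blast
  then have "qq x \<le> Suc ?j div K" by (simp add: qq_def div_le_mono)
  moreover have "Suc (K * n) div K = n" for n using K1 using div_mult_self2[of K 1 n] by simp
  ultimately have qqx: "qq x \<le> (if qi ?v = 0 then 0 else Suc (qq ?v))"
    using K1 by (auto simp: light_stage_def simp del: mult_Suc_right split: if_splits)
  then show "qq x \<le> Suc (qq ?v)" by (auto split: if_splits)
  show "T < load h x + w q" if a: "qq x = Suc (qq ?v)"
  proof (rule flip_full[OF opt stage_ok[OF light_stage(3)[OF q(1-3)]] light_stage(1,2)[OF q(1-3)]])
    have "qi ?v \<noteq> 0" using qqx a by (auto split: if_splits)
    then have j: "?j = K * Suc (qq ?v)" by (simp add: light_stage_def)
    have "?j \<le> qi x" unfolding j using a by (metis qq_def times_div_less_eq_dividend)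
    moreover have "0 < qi x" using calculation j K_pos by (cases "qi x") auto
    then have "qi x \<noteq> ?j" using qi_not_dvd[OF xQ] j by (metis dvd_triv_left)
    ultimately show "x \<notin> QQ h ?j" using qi_le[of x ?j] by linarith
  qed (use q nb in auto)
  show "T - 42/100 < load h x" if a: "qq x = qq ?v" "q \<notin> loose ?v"
  proof (rule ccontr)
    assume l: "\<not> ?thesis"
    then have xB: "x \<notin> B" using not_bad_iff[OF h_oris] by auto
    have "K * qq x \<le> qi x" by (simp add: qq_def)
    moreover have "K * qq x \<noteq> qi x" using qi_not_dvd[OF xQ qi_pos[OF xQ xB]] by (metis dvd_triv_left)
    ultimately have "x \<notin> QQ h (K * qq ?v)" using in_QQ_iff[OF xQ] a(1) by simp
    then have "q \<in> loose ?v" using q l unfolding loose_def loose_at_def by auto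
    then show False using a(2) by blast
  qed
qed

text \<open>What optimality yields when the flip of \<open>e\<close> towards \<open>v\<close> fails;
  the bound 0.2 comes from \<open>flip_loose\<close>.\<close>

definition trigger :: "'a \<Rightarrow> 'b \<Rightarrow> bool" where
  "trigger v e \<longleftrightarrow> e \<in> E \<and> v \<in> r e \<and> v \<noteq> h e \<and> T < load h v + w e \<and>
     (load h v + w e - T \<le> 2/10 \<longrightarrow> (\<Sum>q\<in>loose v. w q) \<le> load h v + w e - T)"

lemma triggerI:
  assumes i: "i \<le> K * m0" "i \<le> qi v" and e: "e \<in> CC h i" "\<And>j. j < i \<Longrightarrow> e \<notin> CC h j"
    and v: "v \<in> r e" "v \<noteq> h e" "v \<notin> QQ h i" "big e \<Longrightarrow> v \<notin> PP h i"
  shows "trigger v e"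
proof -
  have "i div K \<le> qq v" using i(2) by (simp add: qq_def div_le_mono)
  then have "QQ h (K * (i div K)) \<subseteq> QQ h (K * qq v)" by (intro PQ_mono) simp
  then have "(\<Sum>q\<in>loose v. w q) \<le> load h v + w e - T" if "load h v + w e - T \<le> 2/10"
    unfolding loose_def using flip_loose[OF opt stage_ok[OF i(1)] e v that] by blast
  then show ?thesis
    using flip_full[OF opt stage_ok[OF i(1)] e v] e(1) CC_sub v(1,2) unfolding trigger_def by blast
qed

lemma CC_head: "e \<in> CC h j \<Longrightarrow> e \<in> E \<and> h e \<in> PP h j"
  using PQ_sub[OF h_oris, of j] by (auto simp: CC_def counted_def)

lemma CC_ends: "e \<in> CC h j \<Longrightarrow> x \<in> r e \<Longrightarrow> x \<in> PP h (Suc j)"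
  unfolding PQA_Suc nextP_def by blast

lemma CC_next:
  assumes "e \<in> CC h j" "x \<in> r e" "x \<noteq> h e" "\<not> big e \<or> bigs h x = {}"
  shows "x \<in> QQ h (Suc j)"
  using assms unfolding PQA_Suc nextQ_def by blast

lemma P_entry:
  assumes v: "v \<in> Pf" "v \<notin> B"
  obtains j e where "pi v = Suc j" "e \<in> CC h j" "v \<in> r e" "v \<noteq> h e" "v \<notin> PP h j"
proof -
  obtain j where j: "pi v = Suc j" using pi_pos[OF v] by (cases "pi v") auto
  have nj: "v \<notin> PP h j" using in_PP_iff[OF v(1), of j] j by simp
  have "v \<in> PP h (Suc j)" using in_PP_iff[OF v(1), of "Suc j"] j by simp
  then obtain e where e: "e \<in> CC h j" "v \<in> r e" using nj unfolding PQA_Suc nextP_def by blast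
  then have "v \<noteq> h e" using CC_head nj by blast
  then show ?thesis using that[OF j e] nj by blast
qed

lemma primary_entry:
  assumes v: "v \<in> Pf" "pi v = Suc j" and e: "e \<in> CC h j" "v \<in> r e" "big e"
  shows "primary e v" "v \<noteq> h e" "e \<in> E" "big e \<Longrightarrow> (e, v) \<in> AA h (Suc j)"
proof -
  have nv: "v \<notin> PP h j" using in_PP_iff[OF v(1), of j] v(2) by simp
  have he: "h e \<in> PP h j" "e \<in> E" using CC_head[OF e(1)] by auto
  have "j \<le> K * Suc m0" using stage_bound(2)[OF v(1)] v(2) by simp
  then have "h e \<in> Pf" using in_Pf he(1) by blast
  moreover have "pi (h e) < pi v" using pi_le[OF he(1)] v(2) by simp
  ultimately show "primary e v" using e he v by (simp add: primary_def)
  show "v \<noteq> h e" "e \<in> E" using nv he by auto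
  show "(e, v) \<in> AA h (Suc j)" using e nv by (simp add: PQA_Suc nextA_def)
qed

text \<open>Entering \<open>P\<close> without entering \<open>Q\<close> in the same phase is
  possible only if the edge that led to \<open>v\<close> is big and \<open>v\<close> holds a big
  edge, since otherwise the first rule of \<open>nextQ\<close> admits \<open>v\<close> at
  once.\<close>

lemma primary_exists:
  assumes v: "v \<in> Pf" and "v \<in> Qf \<Longrightarrow> pp v < qq v"
  shows "\<exists>e. primary e v \<and> v \<noteq> h e" "bigs h v \<noteq> {}"
proof -
  have vB: "v \<notin> B" using assms(2) bad_index PQf(3) by fastforce
  obtain j e where je: "pi v = Suc j" "e \<in> CC h j" "v \<in> r e" "v \<noteq> h e" "v \<notin> PP h j"
    using P_entry[OF v vB] .
  have nQ: "v \<notin> QQ h (Suc j)"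
  proof
    assume a: "v \<in> QQ h (Suc j)"
    have "Suc j \<le> K * Suc m0" using stage_bound(2)[OF v] je(1) by simp
    then have "v \<in> Qf" using in_Qf a by blast
    moreover have "qi v \<le> pi v" using qi_le[OF a] je(1) by simp
    then have "qq v \<le> pp v" by (simp add: qq_def pp_def div_le_mono)
    ultimately show False using assms(2) by simp
  qed
  then have "big e" and b: "bigs h v \<noteq> {}" using CC_next[OF je(2-4)] by blast+
  then show "\<exists>e. primary e v \<and> v \<noteq> h e" using primary_entry[OF v je(1-3)] by blast
  show "bigs h v \<noteq> {}" by (rule b)
qed

lemma primary_in_AA:
  assumes "primary e x" shows "(e, x) \<in> AA h (pi x)"
proof -
  have e: "e \<in> E" "big e" "x \<in> r e" "h e \<in> Pf" "x \<in> Pf" "pi (h e) < pi x" using assms by (auto simp: primary_def)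
  obtain j where j: "pi x = Suc j" using e(6) by (cases "pi x") auto
  have "h e \<in> PP h j" using in_PP_iff[OF e(4)] e(6) j by simp
  then have "e \<in> CC h j" using e by (simp add: CC_def counted_def)
  then show ?thesis using primary_entry(4)[OF e(5) j _ e(3,2)] e(2) j by simp
qed

lemma AA_entry: "(e, x) \<in> AA h n \<Longrightarrow> \<exists>j<n. e \<in> CC h j \<and> x \<in> r e \<and> x \<notin> PP h j"
proof (induction n)
  case (Suc n)
  then show ?case by (auto simp: PQA_Suc nextA_def less_Suc_eq)
qed (simp add: PQA_0)

lemma mid_big: "mid e \<Longrightarrow> big e" by (simp add: mid_def big_def)

text \<open>By the end of the phase on the right both \<open>v\<close> is in \<open>P\<close> and
  \<open>x\<close> is in \<open>Q\<close>, so the last rule of \<open>nextQ\<close> has taken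
  effect.\<close>

lemma backward:
  assumes g: "mid g" "bigs h v = {g}" and v: "v \<in> Pf" and x: "x \<in> r g" "x \<noteq> v" "x \<in> Qf"
  shows "v \<in> Qf" "qq v \<le> max (qq x) (pp v)"
proof -
  let ?m = "max (qq x) (pp v)"
  have m: "?m \<le> m0" using m0_le v x by simp
  have gv: "g \<in> E" "h g = v" using g(2) by (auto simp: bigs_def)
  have "v \<in> Pm h ?m" "x \<in> Qm h ?m" using in_Pm_iff[OF v] in_Qm_iff[OF x(3)] by auto
  moreover have "g \<in> counted False (Pm h ?m) (Qm h ?m) h"
    using gv mid_big[OF g(1)] calculation(1) by (simp add: counted_def)
  ultimately have v': "v \<in> Qm h ?m"
    using phase_closed(2)[OF h_oris, of ?m] gv(2) g x unfolding nextQ_def by blast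
  then show "v \<in> Qf" using Pm_sub[OF m] by blast
  then show "qq v \<le> ?m" using in_Qm_iff v' by blast
qed

lemma forwarded:
  assumes e: "mid e" "primary e x" "x \<noteq> h e" "h e \<in> Qf" "h e \<notin> B"
    and m: "qq (h e) \<le> m" "m \<le> m0" and fw: "forward (Qm h m) h e"
  shows "x \<in> Qf" "qq x \<le> m"
proof -
  have p: "e \<in> E" "big e" "x \<in> r e" "h e \<in> Pf" "x \<in> Pf" using e(2) by (auto simp: primary_def)
  have "pp x \<le> pp (h e)" "pp (h e) \<le> qq (h e)"
    using big_pending(2)[OF p(1,2,4,3)] pp_le_qq(2)[OF e(4)] by auto
  then have "pp x \<le> m" "pp (h e) \<le> m" using m by auto
  then have x: "x \<in> Pm h m" and he: "h e \<in> Pm h m" using in_Pm_iff p(4,5) by auto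
  have "pi x \<le> K * Suc m" using x pi_le by (simp add: Pm_def)
  then have "(e, x) \<in> Am h m" using primary_in_AA[OF e(2)] PQ_mono(3) unfolding Am_def by blast
  moreover have "h e \<in> Qm h m" using in_Qm_iff[OF e(4)] m by simp
  moreover have "e \<in> counted False (Pm h m) (Qm h m) h" using p he by (simp add: counted_def)
  ultimately have x': "x \<in> Qm h m"
    using phase_closed(2)[OF h_oris, of m] e(1,3,5) p(3) fw unfolding nextQ_def by blast
  then show "x \<in> Qf" using Pm_sub[OF m(2)] by blast
  then show "qq x \<le> m" using in_Qm_iff x' by blast
qed

lemma primary_trigger:
  assumes v: "v \<in> Qf" "pi v = Suc j" and e: "e \<in> CC h j" "v \<in> r e" "big e"
  shows "trigger v e"
proof -
  have vP: "v \<in> Pf" using v PQf by blast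
  have nv: "v \<notin> PP h j" using in_PP_iff[OF vP, of j] v(2) by simp
  show ?thesis
  proof (rule triggerI[of j])
    show "j \<le> K * m0" using stage_bound(2)[OF vP] v(2) by simp
    show "j \<le> qi v" using pp_le_qq(1)[OF v(1)] v(2) by simp
    show "e \<notin> CC h i" if "i < j" for i
      using CC_ends[OF _ e(2), of i] PQ_mono(1)[of "Suc i" j h] that nv by auto
    show "v \<noteq> h e" using primary_entry(2)[OF vP v(2) e] .
    show "v \<notin> QQ h j" using nv PQ_sub[OF h_oris] by blast
  qed (use e nv in auto)
qed

text \<open>The alternatives follow the rules of \<open>nextQ\<close>, the first one split by weight
  class. In the alternative with \<open>g\<close> the vertex is pulled in by an edge that it holds,
  which cannot be flipped towards it; the big edge that brought \<open>v\<close> into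
  \<open>P\<close> serves as trigger instead. In the last alternative too, the flip is blocked at
  the entry into \<open>P\<close>, not into \<open>Q\<close>.\<close>

lemma trigger_exists:
  assumes v: "v \<in> Qf" "v \<notin> B"
  shows "\<exists>e. trigger v e \<and>
    (heavy e \<and> h e \<in> Qf \<and> qq (h e) \<le> qq v
     \<or> light e
     \<or> big e \<and> bigs h v = {} \<and> h e \<in> Pf \<and> pp (h e) \<le> qq v
     \<or> primary e v \<and> (\<exists>g x. mid g \<and> bigs h v = {g} \<and> x \<in> r g \<and> x \<noteq> v \<and> x \<in> Qf \<and> qi x < qi v)
     \<or> mid e \<and> primary e v \<and> h e \<in> Qf \<and> h e \<notin> B \<and> qi (h e) < qi v \<and>
         forward (QQ h (qi v - 1)) h e)"
proof -
  have vP: "v \<in> Pf" using v PQf by blast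
  obtain i where i: "qi v = Suc i" using qi_pos[OF v] by (cases "qi v") auto
  have iK: "i \<le> K * m0" using stage_bound(1)[OF v(1)] i by simp
  have iK': "i \<le> K * Suc m0" using iK by simp
  have nQ: "v \<notin> QQ h i" using in_QQ_iff[OF v(1), of i] i by simp
  have "v \<in> QQ h (Suc i)" using in_QQ_iff[OF v(1), of "Suc i"] i by simp
  then consider (plain) e where "e \<in> CC h i" "v \<in> r e" "v \<noteq> h e" "\<not> big e \<or> bigs h v = {}"
    | (fwd) e where "e \<in> CC h i" "v \<in> r e" "v \<noteq> h e" "big e" "mid e" "(e, v) \<in> AA h i" "h e \<in> QQ h i - B"
        "forward (QQ h i) h e"
    | (bwd) g x where "g \<in> CC h i" "h g = v" "mid g" "bigs h v = {g}" "x \<in> r g" "x \<noteq> v" "x \<in> QQ h i"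
    unfolding PQA_Suc nextQ_def using nQ mid_big by blast
  then show ?thesis
  proof cases
    case plain
    have first: "e \<notin> CC h j" if "j < i" for j
    proof
      assume "e \<in> CC h j"
      then have "v \<in> QQ h (Suc j)" using CC_next plain by blast
      then show False using nQ PQ_mono(2)[of "Suc j" i h] that by auto
    qed
    \<comment> \<open>A vertex without big edges enters \<open>Q\<close> together with
      \<open>P\<close>.\<close>
    have nP: "v \<notin> PP h i" if b: "big e"
    proof
      assume a: "v \<in> PP h i"
      obtain j e' where j: "pi v = Suc j" "e' \<in> CC h j" "v \<in> r e'" "v \<noteq> h e'" "v \<notin> PP h j"
        using P_entry[OF vP v(2)] .
      have "v \<in> QQ h (Suc j)" using CC_next[OF j(2-4)] plain(4) b by blast
      moreover have "Suc j \<le> i" using pi_le[OF a] j(1) by simp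
      ultimately show False using nQ PQ_mono(2)[of "Suc j" i h] by blast
    qed
    have tr: "trigger v e"
      by (rule triggerI[OF iK _ plain(1) first plain(2,3) nQ nP]) (simp_all add: i)
    have eE: "e \<in> E" "h e \<in> PP h i" using CC_head[OF plain(1)] by auto
    consider "light e" | "heavy e" | "big e"
      unfolding light_def heavy_def big_def by linarith
    then show ?thesis
    proof cases
      case 2
      then have "h e \<in> QQ h i" using plain(1) by (auto simp: CC_def counted_def heavy_def big_def light_def)
      then have "h e \<in> Qf" "qi (h e) \<le> qi v" using in_Qf[OF _ iK'] qi_le[of "h e" i] i by auto
      moreover have "qq (h e) \<le> qq v" using calculation(2) by (simp add: qq_def div_le_mono)
      ultimately show ?thesis using tr 2 by blast
    next
      case 3
      have "h e \<in> Pf" "pi (h e) \<le> qi v" using in_Pf[OF eE(2) iK'] pi_le[OF eE(2)] i by auto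
      moreover have "pp (h e) \<le> qq v" using calculation(2) by (simp add: qq_def pp_def div_le_mono)
      moreover have "bigs h v = {}" using 3 plain(4) by blast
      ultimately show ?thesis using tr 3 by blast
    qed (use tr in blast)
  next
    case fwd
    obtain j where j: "j < i" "e \<in> CC h j" "v \<in> r e" "v \<notin> PP h j" using AA_entry[OF fwd(6)] by blast
    have "pi v \<le> Suc j" using pi_le[OF CC_ends[OF j(2,3)]] .
    moreover have "\<not> pi v \<le> j" using in_PP_iff[OF vP] j(4) by simp
    ultimately have pj: "pi v = Suc j" by simp
    have "trigger v e" using primary_trigger[OF v(1) pj j(2,3) fwd(4)] .
    moreover have "primary e v" using primary_entry(1)[OF vP pj j(2,3) fwd(4)] .
    moreover have "h e \<in> Qf" "qi (h e) < qi v" using in_Qf[OF _ iK', of "h e"] fwd(7) qi_le[of "h e" i] i by auto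
    ultimately show ?thesis using fwd i by auto
  next
    case bwd
    have gP: "v \<in> PP h i"
      using bwd(1-3) mid_big by (auto simp: CC_def counted_def mid_def heavy_def light_def)
    obtain j e where je: "pi v = Suc j" "e \<in> CC h j" "v \<in> r e" "v \<noteq> h e" "v \<notin> PP h j"
      using P_entry[OF vP v(2)] .
    have ji: "Suc j \<le> i" using pi_le[OF gP] je(1) by simp
    have be: "big e"
    proof (rule ccontr)
      assume "\<not> big e"
      then have "v \<in> QQ h (Suc j)" using CC_next[OF je(2-4)] by blast
      then show False using nQ PQ_mono(2)[OF ji, of h] by blast
    qed
    have "trigger v e" using primary_trigger[OF v(1) je(1-3) be] .
    moreover have "primary e v" using primary_entry(1)[OF vP je(1-3) be] .
    moreover have "x \<in> Qf" "qi x < qi v" using in_Qf[OF _ iK', of x] bwd(7) qi_le[of x i] i by auto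
    ultimately show ?thesis using bwd by blast
  qed
qed

end

section \<open>The dual solution\<close>

text \<open>A trigger of weight \<open>x\<close> guarantees a load above \<open>T\<close> -
  \<open>x\<close>, which for \<open>x\<close> above 0.745 is less than 1.004. The charge makes up
  for this loss one to one, until it reaches the cap 0.2515.\<close>

definition small_charge :: "real \<Rightarrow> real" where "small_charge x = min (503/2000) (3/1000 + max 0 (x - 745/1000))"

context optimal_orientation begin

definition discount :: "nat \<Rightarrow> real" where "discount n = (93/100) ^ n"

definition nonloop :: "'b \<Rightarrow> bool" where "nonloop e \<longleftrightarrow> (\<exists>x\<in>r e. x \<noteq> h e)"
definition other_end :: "'b \<Rightarrow> 'a" where "other_end e = (THE x. x \<in> r e \<and> x \<noteq> h e)"

text \<open>\<open>qi (other_end e) - 1\<close> is the last stage before the other end enters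
  \<open>Q\<close>; \<open>qi (h e) < qi (other_end e)\<close> keeps the subtraction from being
  truncated.\<close>

definition forwarding :: "'b \<Rightarrow> bool" where
  "forwarding e \<longleftrightarrow> mid e \<and> nonloop e \<and> primary e (other_end e) \<and> h e \<in> Qf \<and> h e \<notin> B \<and> other_end e \<in> Qf \<and>
     qi (h e) < qi (other_end e) \<and> forward (QQ h (qi (other_end e) - 1)) h e"

definition primary_charge :: "'b \<Rightarrow> real" where "primary_charge e = (if nonloop e \<and> primary e (other_end e) then 503/2000 else 0)"
text \<open>\<open>merged_net\<close> and \<open>merged_charge\<close> have the same sum whether or
  not the edge is forwarding; a forwarding edge only moves value to the other end. Up to weight
  0.745 its holder is left with exactly 0.494 = 1/2 - 0.006, the lower bound valid for all big
  edges.\<close>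

definition merged_charge :: "'b \<Rightarrow> real" where "merged_charge e = (if forwarding e then w e - 497/1000 else small_charge (w e))"
definition merged_net :: "'b \<Rightarrow> real" where "merged_net e = min (w e) (749/1000) - 6/1000 + small_charge (w e) - merged_charge e"
definition merged_rate :: "'b \<Rightarrow> real" where
  "merged_rate e = (if nonloop e \<and> other_end e \<in> Qf then discount (max (qq (other_end e)) (pp (h e))) else 0)"

text \<open>Let \<open>v\<close> hold the edge. A big edge counts at the rate of the phase in which \<open>v\<close> enters \<open>P\<close>; from the
  moment on when \<open>v\<close> is in \<open>P\<close> and the other end is in \<open>Q\<close> (rate \<open>merged_rate\<close>) it is worth only
  \<open>merged_net\<close> to \<open>v\<close> instead of 0.743 = 0.749 - 0.006. The charge is what \<open>v\<close> cedes to the other end, so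
  that the dual variable of the edge is \<open>net e + charge e\<close>.\<close>

definition net :: "'b \<Rightarrow> real" where
  "net e = (if big e then if h e \<in> Pf then (discount (pp (h e)) - merged_rate e) * (743/1000) + merged_rate e * merged_net e else 0
     else if h e \<notin> Qf then 0
     else if heavy e then discount (qq (h e)) * (w e - 6/1000)
     else discount (if e \<in> loose (h e) then Suc (qq (h e)) else qq (h e)) * w e)"

definition charge :: "'b \<Rightarrow> real" where
  "charge e = (if \<not> nonloop e then 0
     else if big e then if h e \<in> Pf then (discount (pp (h e)) - merged_rate e) * primary_charge e + merged_rate e * merged_charge e else 0
     else if heavy e \<and> h e \<in> Qf then discount (qq (h e)) * (3/1000) else 0)"

text \<open>Per vertex the discount rate of \<open>P\<close> is split into the rate \<open>mu v\<close> of \<open>Q\<close> and an excess on which only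
  big edges live. The \<open>unit\<close> quantities are the values relative to \<open>mu v\<close>; in \<open>merged_share\<close>, \<open>mu v = 0\<close> gives
  the junk value 0, but then it is only used multiplied by \<open>mu v\<close>.\<close>

definition mu :: "'a \<Rightarrow> real" where "mu v = (if v \<in> Qf then discount (qq v) else 0)"

definition merged_share :: "'a \<Rightarrow> 'b \<Rightarrow> real" where "merged_share v g = min 1 (merged_rate g / mu v)"
definition net_unit :: "'a \<Rightarrow> 'b \<Rightarrow> real" where "net_unit v g = (1 - merged_share v g) * (743/1000) + merged_share v g * merged_net g"
definition charge_unit :: "'a \<Rightarrow> 'b \<Rightarrow> real" where "charge_unit v g = (1 - merged_share v g) * primary_charge g + merged_share v g * merged_charge g"
definition net_excess :: "'a \<Rightarrow> 'b \<Rightarrow> real" where "net_excess v g = (if merged_rate g \<le> mu v then 743/1000 else merged_net g)"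

definition prev :: "'a \<Rightarrow> 'b \<Rightarrow> bool" where
  "prev v q \<longleftrightarrow> h q \<in> Qf \<and> qq v = Suc (qq (h q))"
text \<open>A bound for the value of a light edge held elsewhere relative to \<open>mu v\<close>.
  With room for 0.42 at \<open>v\<close>, the edge counts at least one phase after the entry of
  \<open>v\<close>; an edge whose holder entered one phase earlier can be worth one discount step
  more than \<open>mu v\<close>.\<close>

definition light_scale :: "'a \<Rightarrow> 'b \<Rightarrow> real" where
  "light_scale v q = (if load h v \<le> T - 42/100 then 93/100 else if prev v q then 100/93 else 1)"
definition received_unit :: "'a \<Rightarrow> 'b \<Rightarrow> real" where
  "received_unit v e = (if big e \<and> h e \<in> Pf \<and> pp (h e) \<le> qq v then merged_charge e
     else if heavy e \<and> h e \<in> Qf \<and> qq (h e) \<le> qq v then 3/1000 else 0)"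

text \<open>The share of \<open>e\<close> in the value of \<open>v\<close> minus the value of
  \<open>C\<close>, see \<open>vertex_dual_minus_config\<close>. For an edge in \<open>C\<close> the
  part that \<open>v\<close> itself keeps or receives cancels.\<close>

definition contrib :: "'a \<Rightarrow> 'b set \<Rightarrow> 'b \<Rightarrow> real" where
  "contrib v C e = (if h e = v then if e \<in> C then - charge e else net e
     else if v \<in> r e then if e \<in> C then - net e else charge e else 0)"

text \<open>The coefficient of \<open>mu v\<close> in the lower bound \<open>contrib_lower\<close>.
  The 7/100 is 1 - 93/100, as loose edges count one phase late.\<close>

definition unit_part :: "'a \<Rightarrow> 'b set \<Rightarrow> 'b \<Rightarrow> real" where
  "unit_part v C e = (if h e = v then
       if big e then if e \<in> C then - charge_unit v e else net_unit v e
       else if heavy e then if e \<in> C then - (3/1000) else w e - 6/1000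
       else if e \<in> C then 0 else w e - (if e \<in> loose v then 7/100 * w e else 0)
     else if v \<in> r e then
       if e \<in> C then if big e then - merged_net e else if heavy e then - (w e - 6/1000) else - (light_scale v e * w e)
       else received_unit v e
     else 0)"

definition excess_part :: "'a \<Rightarrow> 'b set \<Rightarrow> 'b \<Rightarrow> real" where
  "excess_part v C e = (if \<not> big e then 0
     else if h e = v then if e \<in> C then - (503/2000) else net_excess v e
     else if v \<in> r e then if e \<in> C then - (743/1000) else if primary e v then 503/2000 else 0
     else 0)"

section \<open>Bounding the contribution of a single edge\<close>

lemma discount_pos: "0 < discount n" and discount_Suc: "discount (Suc n) = 93/100 * discount n"
  by (auto simp: discount_def)

lemma discount_mono: "m \<le> n \<Longrightarrow> discount n \<le> discount m"
  unfolding discount_def by (rule power_decreasing) auto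

lemma discount_max: "discount (max m n) = min (discount m) (discount n)"
  using discount_mono[of m n] discount_mono[of n m] by (cases "m \<le> n") (auto simp: max_def min_def)

lemma other_end_eq: assumes "e \<in> E" "x \<in> r e" "x \<noteq> h e" shows "nonloop e" "other_end e = x" "r e = {h e, x}"
proof -
  show n: "nonloop e" using assms by (auto simp: nonloop_def)
  have "h e \<in> r e" using head_in[OF h_oris assms(1)] .
  moreover have f: "finite (r e)" using finite_subset[OF r_sub[OF assms(1)] finite_V] .
  moreover have "card (r e) \<le> 2" using r_card[OF assms(1)] by auto
  moreover have "card {h e, x} = 2" using assms(3) by simp
  ultimately show r: "r e = {h e, x}" using card_seteq[of "r e" "{h e, x}"] assms(2) by auto
  show "other_end e = x" unfolding other_end_def r using assms(3) by (intro the_equality) auto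
qed

lemma other_end: assumes "e \<in> E" "nonloop e" shows "other_end e \<in> r e" "other_end e \<noteq> h e"
proof -
  obtain x where "x \<in> r e" "x \<noteq> h e" using assms(2) by (auto simp: nonloop_def)
  then show "other_end e \<in> r e" "other_end e \<noteq> h e" using other_end_eq(2)[OF assms(1)] by auto
qed

lemma small_charge_bounds: "3/1000 \<le> small_charge x" "small_charge x \<le> 503/2000" "x \<le> 745/1000 \<Longrightarrow> small_charge x = 3/1000"
  unfolding small_charge_def by linarith+

lemma forwarding_bounds:
  assumes "forwarding e"
  shows "1/2 < w e" "w e < 749/1000" "merged_charge e = w e - 497/1000" "merged_net e = 491/1000 + small_charge (w e)"
    "small_charge (w e) = 3/1000 + max 0 (w e - 745/1000)"
  using assms by (auto simp: forwarding_def mid_def merged_charge_def merged_net_def small_charge_def)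

lemma not_forwarding_bounds:
  assumes "\<not> forwarding e" shows "merged_charge e = small_charge (w e)" "merged_net e = min (w e) (749/1000) - 6/1000"
  using assms by (auto simp: merged_charge_def merged_net_def)

lemma M_bounds:
  assumes "big e"
  shows "494/1000 \<le> merged_net e" "merged_net e \<le> min (w e) (749/1000) - 6/1000" "small_charge (w e) \<le> merged_charge e"
    "mid e \<Longrightarrow> merged_charge e \<le> w e - 497/1000" "\<not> forwarding e \<Longrightarrow> merged_charge e \<le> 503/2000" "merged_net e \<le> 743/1000"
proof -
  have b: "1/2 < w e" using assms by (simp add: big_def)
  have "494/1000 \<le> merged_net e \<and> merged_net e \<le> min (w e) (749/1000) - 6/1000 \<and> small_charge (w e) \<le> merged_charge e"
    using forwarding_bounds[of e] not_forwarding_bounds[of e] b small_charge_bounds(1)[of "w e"] by (cases "forwarding e") auto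
  then show "494/1000 \<le> merged_net e" "merged_net e \<le> min (w e) (749/1000) - 6/1000" "small_charge (w e) \<le> merged_charge e" "merged_net e \<le> 743/1000" by auto
  show "mid e \<Longrightarrow> merged_charge e \<le> w e - 497/1000"
    using forwarding_bounds[of e] not_forwarding_bounds[of e] b by (cases "forwarding e") (auto simp: mid_def small_charge_def)
  show "\<not> forwarding e \<Longrightarrow> merged_charge e \<le> 503/2000" using not_forwarding_bounds small_charge_bounds by simp
qed

lemma merged_charge_nonneg: "big e \<Longrightarrow> 0 \<le> merged_charge e"
  using M_bounds(3)[of e] small_charge_bounds(1)[of "w e"] by linarith

lemma primary_charge_bounds: "0 \<le> primary_charge e" "primary_charge e \<le> 503/2000"
  by (auto simp: primary_charge_def)

lemma merged_rate_bounds: "0 \<le> merged_rate e" "merged_rate e \<le> discount (pp (h e))"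
  using discount_pos discount_mono by (auto simp: merged_rate_def less_imp_le)

lemma mu_nonneg: "0 \<le> mu v"
  using discount_pos by (simp add: mu_def less_imp_le)

lemma mu_le_rho: "mu v \<le> discount (pp v)"
  using discount_mono[OF pp_le_qq(2)] discount_pos by (simp add: mu_def less_imp_le)

lemma net_nonneg: assumes "e \<in> E" shows "0 \<le> net e"
proof -
  have w: "0 < w e" using w_pos[OF assms] .
  have "0 \<le> (discount (pp (h e)) - merged_rate e) * (743/1000) + merged_rate e * merged_net e" if "big e"
    using M_bounds(1)[OF that] merged_rate_bounds[of e] by (intro add_nonneg_nonneg mult_nonneg_nonneg) auto
  moreover have "0 \<le> discount n * (w e - 6/1000)" if "heavy e" for n
    using that discount_pos[of n] by (simp add: heavy_def)
  moreover have "0 \<le> discount n * w e" for n using w discount_pos[of n] by simp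
  ultimately show ?thesis by (simp add: net_def)
qed

lemma charge_nonneg: "0 \<le> charge e"
proof -
  have "0 \<le> (discount (pp (h e)) - merged_rate e) * primary_charge e + merged_rate e * merged_charge e" if "big e"
    using merged_charge_nonneg[OF that] merged_rate_bounds[of e] primary_charge_bounds by (intro add_nonneg_nonneg mult_nonneg_nonneg) auto
  then show ?thesis using discount_pos[of "qq (h e)"] by (simp add: charge_def)
qed

text \<open>The holder of a forwarding edge enters \<open>Q\<close> first, so its own rate is at
  least the merged one. Merged rate beyond \<open>mu\<close> thus comes only from edges whose charge
  respects the cap 0.2515.\<close>

lemma forwarding_merged_rate: assumes "forwarding e" shows "merged_rate e \<le> mu (h e)"
proof -
  have "qq (h e) \<le> qq (other_end e)" using assms unfolding forwarding_def qq_def by (simp add: div_le_mono)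
  then have "qq (h e) \<le> max (qq (other_end e)) (pp (h e))" by simp
  from discount_mono[OF this] show ?thesis using assms by (simp add: forwarding_def merged_rate_def mu_def)
qed

lemma merged_share_bounds: "0 \<le> merged_share v g" "merged_share v g \<le> 1"
  using merged_rate_bounds(1)[of g] mu_nonneg[of v] by (auto simp: merged_share_def)

lemma mu_merged_share: "mu v * merged_share v g = min (mu v) (merged_rate g) \<or> mu v = 0"
  using mu_nonneg[of v] by (auto simp: merged_share_def min_def field_simps)

text \<open>The rate of \<open>P\<close> is cut at \<open>mu v\<close>. Either the merged rate
  \<open>a\<close> lies below the cut, and the excess is purely unmerged, or it reaches into the
  excess; then \<open>g\<close> is not forwarding, and the cap bounds its charge there as
  well.\<close>

lemma held_big:
  assumes g: "big g" "h g = v" "v \<in> Pf"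
  shows "mu v * net_unit v g + (discount (pp v) - mu v) * net_excess v g \<le> net g"
    and "charge g \<le> mu v * charge_unit v g + (discount (pp v) - mu v) * (503/2000)"
proof -
  define m a p f where "m = mu v" "a = merged_rate g" "p = discount (pp v)" "f = merged_share v g"
  have b: "0 \<le> m" "m \<le> p" "0 \<le> a" "a \<le> p"
    using mu_nonneg[of v] mu_le_rho[of v] merged_rate_bounds[of g] g(2) by (auto simp: m_a_p_f_def)
  have f: "m * f = min m a \<or> m = 0" using mu_merged_share[of v g] by (simp add: m_a_p_f_def)
  have n: "494/1000 \<le> merged_net g" "merged_net g \<le> 743/1000" using M_bounds[OF g(1)] by auto
  have net: "net g = (p - a) * (743/1000) + a * merged_net g" using g by (simp add: net_def m_a_p_f_def)
  have mf: "m * f = min m a" using f b by (auto simp: min_def)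
  have N: "m * net_unit v g = (m - min m a) * (743/1000) + min m a * merged_net g"
    unfolding net_unit_def m_a_p_f_def(4)[symmetric] mf[symmetric] by (simp add: algebra_simps)
  have C: "m * charge_unit v g = (m - min m a) * primary_charge g + min m a * merged_charge g"
    unfolding charge_unit_def m_a_p_f_def(4)[symmetric] mf[symmetric] by (simp add: algebra_simps)
  have charge: "charge g \<le> (p - a) * primary_charge g + a * merged_charge g"
  proof -
    have "0 \<le> (p - a) * primary_charge g + a * merged_charge g"
      using merged_charge_nonneg[OF g(1)] b primary_charge_bounds by (intro add_nonneg_nonneg mult_nonneg_nonneg) auto
    then show ?thesis using g by (simp add: charge_def m_a_p_f_def)
  qed
  show "mu v * net_unit v g + (discount (pp v) - mu v) * net_excess v g \<le> net g"
  proof (cases "a \<le> m")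
    case True
    then have "net_excess v g = 743/1000" "m * net_unit v g = (m - a) * (743/1000) + a * merged_net g"
      using N by (auto simp: net_excess_def m_a_p_f_def)
    then have "m * net_unit v g + (p - m) * net_excess v g \<le> net g" unfolding net by (simp only: left_diff_distrib)
    then show ?thesis by (simp add: m_a_p_f_def)
  next
    case False
    then have "(p - a) * merged_net g \<le> (p - a) * (743/1000)" using n b by (intro mult_left_mono) auto
    moreover have "net_excess v g = merged_net g" "m * net_unit v g = m * merged_net g"
      using N False by (auto simp: net_excess_def m_a_p_f_def)
    moreover have "(p - m) * merged_net g + m * merged_net g = (p - a) * merged_net g + a * merged_net g" by (simp add: algebra_simps)
    ultimately have "m * net_unit v g + (p - m) * net_excess v g \<le> net g" unfolding net by (simp only: left_diff_distrib)
    then show ?thesis by (simp add: m_a_p_f_def)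
  qed
  show "charge g \<le> mu v * charge_unit v g + (discount (pp v) - mu v) * (503/2000)"
  proof (cases "a \<le> m")
    case True
    have "(p - m) * primary_charge g \<le> (p - m) * (503/2000)" using b primary_charge_bounds by (intro mult_left_mono) auto
    moreover have "m * charge_unit v g = (m - a) * primary_charge g + a * merged_charge g" using C True by simp
    moreover have "(p - a) * primary_charge g = (p - m) * primary_charge g + (m - a) * primary_charge g" by (simp add: algebra_simps)
    ultimately have "charge g \<le> m * charge_unit v g + (p - m) * (503/2000)" using charge by linarith
    then show ?thesis by (simp add: m_a_p_f_def)
  next
    case False
    then have "\<not> forwarding g" using forwarding_merged_rate[of g] g(2) by (auto simp: m_a_p_f_def)
    then have "(a - m) * merged_charge g \<le> (a - m) * (503/2000)" using M_bounds(5)[OF g(1)] False by (intro mult_left_mono) auto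
    moreover have "(p - a) * primary_charge g \<le> (p - a) * (503/2000)" using b primary_charge_bounds by (intro mult_left_mono) auto
    moreover have "m * charge_unit v g = m * merged_charge g" using C False by simp
    moreover have "(a - m) * merged_charge g + m * merged_charge g = a * merged_charge g" by (simp add: algebra_simps)
    moreover have "(a - m) * (503/2000) + (p - a) * (503/2000) = (p - m) * (503/2000)" by algebra
    ultimately have "charge g \<le> m * charge_unit v g + (p - m) * (503/2000)" using charge by linarith
    then show ?thesis by (simp add: m_a_p_f_def)
  qed
qed

text \<open>The other end enters \<open>P\<close> in no later phase than the holder, so its rate is
  at least that of the edge; if the edge is primary, the reverse holds as well and the rates
  agree.\<close>

lemma pending_big:
  assumes e: "e \<in> E" "big e" "v \<in> r e" "v \<noteq> h e" and v: "v \<in> Pf"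
  shows "net e \<le> mu v * merged_net e + (discount (pp v) - mu v) * (743/1000)"
    and "mu v * received_unit v e + (discount (pp v) - mu v) * (if primary e v then 503/2000 else 0) \<le> charge e"
proof -
  define m q p where "m = mu v" "q = discount (pp (h e))" "p = discount (pp v)"
  have b: "0 \<le> m" "m \<le> p" using mu_nonneg mu_le_rho by (auto simp: m_q_p_def)
  have n: "494/1000 \<le> merged_net e" "merged_net e \<le> 743/1000" using M_bounds[OF e(2)] by auto
  have merged_charge: "0 \<le> merged_charge e" using merged_charge_nonneg[OF e(2)] .
  have other_end: "nonloop e" "other_end e = v" using other_end_eq[OF e(1,3,4)] by auto
  show "net e \<le> mu v * merged_net e + (discount (pp v) - mu v) * (743/1000)"
  proof (cases "h e \<in> Pf")
    case True
    have qp: "q \<le> p" using discount_mono[OF big_pending(2)[OF e(1,2) True e(3)]] by (simp add: m_q_p_def)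
    have merged_rate: "merged_rate e = min m q"
      using other_end discount_pos[of "pp (h e)"] by (auto simp: merged_rate_def m_q_p_def mu_def discount_max)
    have "(q - min m q) * (743/1000) + min m q * merged_net e \<le> m * merged_net e + (p - m) * (743/1000)"
    proof (cases "m \<le> q")
      case True
      then have "min m q = m" by simp
      then show ?thesis using qp by (simp only: left_diff_distrib)
    next
      case False
      then have "q * merged_net e \<le> m * merged_net e" using n by (intro mult_right_mono) auto
      moreover have "0 \<le> (p - m) * (743/1000)" "min m q = q" using False b by auto
      ultimately show ?thesis by (simp only: diff_self mult_zero_left)
    qed
    then show ?thesis using True e(2) by (simp add: net_def merged_rate m_q_p_def)
  next
    case False
    then show ?thesis using e(2) b n by (simp add: net_def flip: m_q_p_def)
  qed
  show "mu v * received_unit v e + (discount (pp v) - mu v) * (if primary e v then 503/2000 else 0) \<le> charge e"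
  proof (cases "h e \<in> Pf")
    case he: True
    have qp: "q \<le> p" using discount_mono[OF big_pending(2)[OF e(1,2) he e(3)]] by (simp add: m_q_p_def)
    have merged_rate: "merged_rate e = min m q"
      using other_end discount_pos[of "pp (h e)"] by (auto simp: merged_rate_def m_q_p_def mu_def discount_max)
    have charge: "charge e = (q - min m q) * primary_charge e + min m q * merged_charge e"
      using he e(2) other_end by (simp add: charge_def merged_rate m_q_p_def)
    have pq: "p \<le> q" if "primary e v"
      using that discount_mono[of "pp (h e)" "pp v"] by (simp add: primary_def m_q_p_def pp_def div_le_mono)
    have primary_charge: "primary_charge e = (if primary e v then 503/2000 else 0)" using other_end by (simp add: primary_charge_def)
    have nb: "\<not> heavy e" using e(2) by (simp add: big_def heavy_def)
    show ?thesis
    proof (cases "m \<le> q")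
      case True
      have "m * received_unit v e \<le> m * merged_charge e" using b merged_charge nb by (intro mult_left_mono) (auto simp: received_unit_def)
      moreover have "(p - m) * primary_charge e = (q - m) * primary_charge e" using pq qp by (cases "primary e v") (auto simp: primary_charge)
      ultimately have "m * received_unit v e + (p - m) * primary_charge e \<le> charge e" unfolding charge min_absorb1[OF True] by linarith
      then show ?thesis by (simp add: m_q_p_def primary_charge)
    next
      case False
      then have nq: "\<not> pp (h e) \<le> qq v"
        using discount_mono[of "pp (h e)" "qq v"] discount_pos[of "pp (h e)"] by (auto simp: m_q_p_def mu_def split: if_splits)
      then have "received_unit v e = 0" using nb by (simp add: received_unit_def)
      moreover have "\<not> primary e v" using pq False b by auto
      moreover have "0 \<le> q" using discount_pos[of "pp (h e)"] by (simp add: m_q_p_def)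
      ultimately show ?thesis using False merged_charge primary_charge_bounds(1)[of e] by (simp add: charge primary_charge)
    qed
  next
    case False
    then show ?thesis using charge_nonneg[of e] e(2) by (auto simp: received_unit_def heavy_def big_def primary_def)
  qed
qed

lemma contrib_lower:
  assumes e: "e \<in> E" and v: "v \<in> Pf"
  shows "mu v * unit_part v C e + (discount (pp v) - mu v) * excess_part v C e \<le> contrib v C e"
proof (cases "big e")
  case big: True
  show ?thesis
  proof (cases "h e = v")
    case True
    then show ?thesis using held_big[OF big True v] big by (simp add: contrib_def unit_part_def excess_part_def)
  next
    case False
    then show ?thesis using pending_big[OF e big _ _ v] big by (auto simp: contrib_def unit_part_def excess_part_def)
  qed
next
  case nb: False
  have w: "0 < w e" using w_pos[OF e] .
  show ?thesis
  proof (cases "heavy e")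
    case hv: True
    have "net e \<le> mu v * (w e - 6/1000)" "mu v * received_unit v e \<le> charge e" if p: "v \<in> r e" "h e \<noteq> v"
    proof -
      have o: "nonloop e" using other_end_eq[OF e p(1)] p(2) by auto
      have "discount (qq (h e)) \<le> mu v" if "h e \<in> Qf"
        using heavy_pending[OF e hv that p(1)] p(2) discount_mono[of "qq v" "qq (h e)"] by (auto simp: mu_def)
      then have "discount (qq (h e)) * (w e - 6/1000) \<le> mu v * (w e - 6/1000)" if "h e \<in> Qf"
        using that hv by (intro mult_right_mono) (auto simp: heavy_def)
      moreover have "0 \<le> mu v * (w e - 6/1000)" using mu_nonneg[of v] hv by (simp add: heavy_def)
      ultimately show "net e \<le> mu v * (w e - 6/1000)" using nb hv by (simp add: net_def)
      have "mu v \<le> discount (qq (h e))" if "qq (h e) \<le> qq v"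
        using discount_mono[OF that] discount_pos[of "qq (h e)"] by (auto simp: mu_def)
      then show "mu v * received_unit v e \<le> charge e" using nb hv o discount_pos[of "qq (h e)"] by (auto simp: received_unit_def charge_def)
    qed
    moreover have "net e = mu v * (w e - 6/1000)" "charge e \<le> mu v * (3/1000)" if "h e = v"
      using that nb hv by (auto simp: net_def charge_def mu_def discount_pos less_imp_le)
    ultimately show ?thesis using nb hv by (auto simp: contrib_def unit_part_def excess_part_def algebra_simps)
  next
    case lt: False
    have l: "light e" using nb lt unfolding big_def heavy_def light_def by linarith
    have c0: "charge e = 0" using nb lt by (simp add: charge_def)
    have "net e \<le> mu v * (light_scale v e * w e)" if p: "v \<in> r e" "h e \<noteq> v"
    proof (cases "h e \<in> Qf")
      case True
      note lp = light_pending[OF e l True p(1) p(2)[symmetric]]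
      let ?n = "if e \<in> loose (h e) then Suc (qq (h e)) else qq (h e)"
      have net: "net e = discount ?n * w e" using True nb lt by (simp add: net_def)
      have muv: "mu v = discount (qq v)" using lp(1) by (simp add: mu_def)
      \<comment> \<open>In order: the edge counts after the phase of \<open>v\<close>, in the same
        phase at a vertex without room, or possibly earlier but with a blocked flip that forces a
        high load.\<close>
      consider "Suc (qq v) \<le> ?n" | "?n = qq v" "T - 42/100 < load h v" "\<not> prev v e"
        | "Suc ?n = qq v \<or> ?n = qq v" "prev v e" "T < load h v + w e"
      proof (cases "qq v = Suc (qq (h e))")
        case True
        then show ?thesis using that lp(3) \<open>h e \<in> Qf\<close> by (auto simp: prev_def)
      next
        case False
        then have np: "\<not> prev v e" by (simp add: prev_def)
        show ?thesis
        proof (cases "e \<in> loose (h e) \<or> qq v \<noteq> qq (h e)")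
          case True
          then have "Suc (qq v) \<le> ?n" using lp(2) False by auto
          then show ?thesis using that(1) by blast
        next
          case False
          then show ?thesis using that(2) lp(4) np by simp
        qed
      qed
      then have "discount ?n \<le> discount (qq v) * light_scale v e"
      proof cases
        case 1
        have "93/100 \<le> light_scale v e" by (simp add: light_scale_def)
        then have "discount (qq v) * (93/100) \<le> discount (qq v) * light_scale v e" using discount_pos[of "qq v"] by (intro mult_left_mono) auto
        then show ?thesis using discount_mono[OF 1] by (simp add: discount_Suc)
      next
        case 2
        then show ?thesis by (simp add: light_scale_def)
      next
        case 3
        have "light_scale v e = 100/93" using 3 l by (simp add: light_scale_def light_def)
        moreover have "discount ?n \<le> 100/93 * discount (qq v)"
          using 3(1) discount_Suc[of ?n] discount_pos[of ?n] by auto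
        ultimately show ?thesis by (simp only: mult.commute[of "100/93"])
      qed
      then have "discount ?n * w e \<le> discount (qq v) * light_scale v e * w e" using w by (intro mult_right_mono) auto
      then show ?thesis by (simp add: net muv)
    next
      case False
      moreover have "0 \<le> light_scale v e" by (simp add: light_scale_def)
      ultimately show ?thesis using nb w mu_nonneg[of v] by (simp add: net_def)
    qed
    moreover have "mu v * (w e - (if e \<in> loose v then 7/100 * w e else 0)) = net e" if "h e = v"
      using that nb lt by (auto simp: net_def mu_def discount_Suc algebra_simps)
    ultimately show ?thesis using nb lt c0 by (auto simp: contrib_def unit_part_def excess_part_def received_unit_def)
  qed
qed

end

section \<open>Big edges held by a vertex\<close>

definition plain_net :: "real \<Rightarrow> real" where "plain_net x = min x (749/1000) - 6/1000"
text \<open>A bound for big edges of a vertex holding exactly two: by \<open>forward\<close>, only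
  one of weight at most 0.55 can be forwarding there, and then it is left with 0.494.\<close>

definition pair_net :: "real \<Rightarrow> real" where "pair_net x = (if x \<le> 55/100 then 494/1000 else plain_net x)"

text \<open>In the next two definitions \<open>X\<close> is what the big edges held by a vertex contribute to its dual
  value minus that of a configuration, \<open>b\<close> is their weight and \<open>c\<close> the weight of the one in the configuration.\<close>

inductive big_case :: "real \<Rightarrow> real \<Rightarrow> real \<Rightarrow> bool" for X b c where
  none: "X = 0 \<and> b = 0 \<and> c = 0 \<Longrightarrow> big_case X b c"
| single_out: "1/2 < b \<and> b \<le> 1 \<and> c = 0 \<Longrightarrow>
    (b < 749/1000 \<and> 494/1000 \<le> X \<and> b - 251/1000 \<le> X \<or> 749/1000 \<le> b \<and> 743/1000 \<le> X) \<Longrightarrow>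
    big_case X b c"
| single_in: "1/2 < b \<and> b \<le> 1 \<and> c = b \<Longrightarrow>
    (b < 749/1000 \<and> 497/1000 - b \<le> X \<or> 749/1000 \<le> b \<and> - (503/2000) \<le> X) \<Longrightarrow> big_case X b c"
| pair_out: "1/2 < w1 \<and> w1 \<le> 1 \<and> 1/2 < w2 \<and> w2 \<le> 1 \<and> b = w1 + w2 \<and> c = 0 \<Longrightarrow>
    pair_net w1 + pair_net w2 \<le> X \<Longrightarrow> big_case X b c"
| pair_in_small: "1/2 < w1 \<and> w1 \<le> 1 \<and> 1/2 < w2 \<and> w2 \<le> 1 \<and> b = w1 + w2 \<and> c = w1 \<and> w1 \<le> 55/100 \<Longrightarrow>
    (pair_net w2 - w1 + 497/1000 \<le> X \<or> w2 \<le> 74/100 \<and> 743/1000 - 503/2000 \<le> X) \<Longrightarrow>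
    big_case X b c"
| pair_in_large: "1/2 < w1 \<and> w1 \<le> 1 \<and> 1/2 < w2 \<and> w2 \<le> 1 \<and> b = w1 + w2 \<and> c = w1 \<and> 55/100 < w1 \<Longrightarrow>
    (plain_net w2 - 503/2000 \<le> X \<or> w2 \<le> 55/100 \<and> 74/100 < w1 \<and> 494/1000 - 503/2000 \<le> X \<or> w2 \<le> 55/100 \<and> w1 \<le> 74/100 \<and> (743/1000 - 503/2000 \<le> X \<or> 494/1000 - 3/1000 \<le> X)) \<Longrightarrow> big_case X b c"
| many: "3/2 \<le> b \<Longrightarrow> (c = 0 \<and> 1482/1000 \<le> X \<or> 1/2 < c \<and> 988/1000 - 503/2000 \<le> X) \<Longrightarrow>
    big_case X b c"

inductive overloaded_big_case :: "real \<Rightarrow> real \<Rightarrow> real \<Rightarrow> bool" for X b c where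
  none: "X = 0 \<and> b = 0 \<and> c = 0 \<Longrightarrow> overloaded_big_case X b c"
| single: "1/2 < b \<and> b \<le> 1 \<Longrightarrow>
    (c = 0 \<and> plain_net b \<le> X \<or> c = b \<and> - (503/2000) \<le> X) \<Longrightarrow> overloaded_big_case X b c"
| pair: "1/2 < w1 \<and> w1 \<le> 1 \<and> 1/2 < w2 \<and> w2 \<le> 1 \<and> b = w1 + w2 \<Longrightarrow>
    (c = 0 \<and> plain_net w1 + plain_net w2 \<le> X \<or> c = w1 \<and> plain_net w2 - 503/2000 \<le> X) \<Longrightarrow>
    overloaded_big_case X b c"
| many: "3/2 \<le> b \<Longrightarrow> (c = 0 \<and> 1482/1000 \<le> X \<or> 1/2 < c \<and> 988/1000 - 503/2000 \<le> X) \<Longrightarrow>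
    overloaded_big_case X b c"

lemma convex_ge: "0 \<le> f \<Longrightarrow> f \<le> 1 \<Longrightarrow> y \<le> a \<Longrightarrow> y \<le> b \<Longrightarrow> (y::real) \<le> (1 - f) * a + f * b"
  using convex_bound_le[of "-a" "-y" "-b" "1 - f" f] by simp

lemma convex_le: "0 \<le> f \<Longrightarrow> f \<le> 1 \<Longrightarrow> a \<le> y \<Longrightarrow> b \<le> y \<Longrightarrow> (1 - f) * a + f * b \<le> (y::real)"
  by (rule convex_bound_le) auto

context optimal_orientation begin

lemma big_in_config_unique:
  assumes C: "C \<subseteq> {e\<in>E. v \<in> r e}" "(\<Sum>e\<in>C. w e) \<le> 1" and e: "e \<in> C" "big e" and f: "f \<in> C" "big f"
  shows "e = f"
proof (rule ccontr)
  assume ne: "e \<noteq> f"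
  have fin: "finite C" using finite_subset[OF C(1)] finite_E by simp
  have "(\<Sum>e\<in>{e, f}. w e) \<le> (\<Sum>e\<in>C. w e)"
    using fin e(1) f(1) C(1) w_pos by (intro sum_mono2) (auto intro: less_imp_le)
  then show False using ne C(2) e(2) f(2) by (simp add: big_def)
qed

lemma net_excess_ge: assumes "big g" shows "494/1000 \<le> net_excess v g"
  using M_bounds(1)[OF assms] by (simp add: net_excess_def)

text \<open>If the merged rate exceeds \<open>mu v\<close> and \<open>g\<close> is
  \<open>mid\<close>, the last rule of \<open>nextQ\<close> would have pulled \<open>v\<close> into
  \<open>Q\<close> in time. So \<open>g\<close> weighs at least 0.749, and merging does not lower
  its value of 0.743.\<close>

lemma net_excess_single:
  assumes v: "v \<in> Pf" and g: "bigs h v = {g}" shows "net_excess v g = 743/1000"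
proof (cases "merged_rate g \<le> mu v")
  case True
  then show ?thesis by (simp add: net_excess_def)
next
  case False
  have gv: "g \<in> E" "h g = v" "big g" using g by (auto simp: bigs_def)
  have "0 < merged_rate g" using False mu_nonneg[of v] by linarith
  then have o: "nonloop g" "other_end g \<in> Qf" by (auto simp: merged_rate_def split: if_splits)
  have "\<not> mid g"
  proof
    assume m: "mid g"
    have "v \<in> Qf" "qq v \<le> max (qq (other_end g)) (pp v)"
      using backward[OF m g v _ _ o(2)] other_end[OF gv(1) o(1)] gv(2) by auto
    then show False using False o gv(2) discount_mono[of "qq v"] by (simp add: merged_rate_def mu_def)
  qed
  then have "749/1000 \<le> w g" "\<not> forwarding g" using gv(3) by (auto simp: mid_def big_def forwarding_def)
  then show ?thesis using False not_forwarding_bounds[of g] by (simp add: net_excess_def)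
qed

text \<open>While \<open>v\<close> is in \<open>P\<close> but not in \<open>Q\<close>, it receives
  0.2515 from a primary edge and holds a big edge. A single held edge balances as 0.2515 against
  0.2515 if it is in the configuration, and as 0.743 against 0.743 if a foreign big edge is. With
  two held edges, 0.494 covers 0.2515 and twice 0.494 covers 0.743.\<close>

lemma excess_part_sum_nonneg:
  assumes v: "v \<in> Pf" and lt: "mu v < discount (pp v)"
    and C: "C \<subseteq> {e\<in>E. v \<in> r e}" "(\<Sum>e\<in>C. w e) \<le> 1"
  shows "0 \<le> (\<Sum>e\<in>E. excess_part v C e)"
proof -
  have "v \<in> Qf \<Longrightarrow> pp v < qq v" using lt discount_mono[of "qq v" "pp v"] by (simp add: mu_def) (meson leD not_le)
  from primary_exists[OF v this] obtain e0 g
    where e0: "primary e0 v" "v \<noteq> h e0" and g: "g \<in> bigs h v" by blast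
  have e0': "e0 \<in> E" "big e0" "v \<in> r e0" using e0(1) by (auto simp: primary_def)
  have g': "g \<in> E" "big g" "h g = v" using g by (auto simp: bigs_def)
  have nonneg: "0 \<le> excess_part v C e" if "\<not> (big e \<and> e \<in> C)" for e
    using that net_excess_ge[of e v] by (auto simp: excess_part_def)
  have ge: "(\<Sum>e\<in>A. excess_part v C e) \<le> (\<Sum>e\<in>E. excess_part v C e)" if "A \<subseteq> E" "b \<in> A" "b \<in> C" "big b" for A b
  proof (rule sum_mono2[OF finite_E that(1)])
    fix e assume "e \<in> E - A"
    then have "\<not> (big e \<and> e \<in> C)" using big_in_config_unique[OF C that(3,4), of e] that(2) by blast
    then show "0 \<le> excess_part v C e" by (rule nonneg)
  qed
  show ?thesis
  proof (cases "\<exists>b\<in>C. big b")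
    case False
    then show ?thesis using nonneg by (intro sum_nonneg; blast)
  next
    case True
    then obtain b where b: "b \<in> C" "big b" "b \<in> E" using C(1) by blast
    have out: "e \<notin> C" if "big e" "e \<noteq> b" for e using big_in_config_unique[OF C _ that(1) b(1,2)] that by blast
    consider (one) "bigs h v = {g}" | (two) g2 where "g2 \<in> bigs h v" "g2 \<noteq> g" using g by blast
    then show ?thesis
    proof cases
      case one
      show ?thesis
      proof (cases "h b = v")
        case True
        then have ne: "e0 \<noteq> b" using e0(2) by auto
        have "0 \<le> (\<Sum>e\<in>{b, e0}. excess_part v C e)"
          using ne True b e0 e0' out[OF e0'(2) ne] by (simp add: excess_part_def)
        then show ?thesis using ge[of "{b, e0}" b] b e0' by simp
      next
        case False
        then have ne: "g \<noteq> b" using g' by auto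
        have "v \<in> r b" using b C(1) by auto
        then have "0 \<le> (\<Sum>e\<in>{b, g}. excess_part v C e)"
          using ne False b g' out[OF g'(2) ne] net_excess_single[OF v one] by (simp add: excess_part_def)
        then show ?thesis using ge[of "{b, g}" b] b g' by simp
      qed
    next
      case two
      have g2: "g2 \<in> E" "big g2" "h g2 = v" using two by (auto simp: bigs_def)
      have s: "494/1000 \<le> net_excess v g" "494/1000 \<le> net_excess v g2" using net_excess_ge g' g2 by auto
      show ?thesis
      proof (cases "b = g \<or> b = g2")
        case True
        then have "0 \<le> (\<Sum>e\<in>{g, g2}. excess_part v C e)"
          using two b g' g2 out[OF g'(2)] out[OF g2(2)] s by (auto simp: excess_part_def)
        then show ?thesis using ge[of "{g, g2}" b] True b g' g2 by simp
      next
        case False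
        have "v \<in> r b" using b C(1) by auto
        then have "- (743/1000) \<le> excess_part v C b" using b by (simp add: excess_part_def)
        moreover have "excess_part v C g = net_excess v g" "excess_part v C g2 = net_excess v g2"
          using False g' g2 out[OF g'(2)] out[OF g2(2)] by (auto simp: excess_part_def)
        ultimately have "0 \<le> (\<Sum>e\<in>{b, g, g2}. excess_part v C e)" using False two s by simp
        then show ?thesis using ge[of "{b, g, g2}" b] b g' g2 by simp
      qed
    qed
  qed
qed

lemma net_unit_ge: assumes "big g" "y \<le> merged_net g" shows "y \<le> net_unit v g"
  unfolding net_unit_def using assms M_bounds(6)[OF assms(1)] by (intro convex_ge merged_share_bounds) auto

lemma net_unit_bounds: assumes "big g" shows "494/1000 \<le> net_unit v g" "\<not> forwarding g \<Longrightarrow> plain_net (w g) \<le> net_unit v g"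
  by (rule net_unit_ge[OF assms M_bounds(1)[OF assms]]) (rule net_unit_ge[OF assms], simp add: not_forwarding_bounds plain_net_def)

lemma charge_unit_le: assumes "primary_charge g = 0 \<or> merged_share v g = 1" "big g" shows "charge_unit v g \<le> merged_charge g"
proof -
  have "merged_share v g * merged_charge g \<le> 1 * merged_charge g" using merged_charge_nonneg[OF assms(2)] merged_share_bounds by (intro mult_right_mono) auto
  then show ?thesis using assms(1) by (auto simp: charge_unit_def)
qed

lemma charge_unit_le_cap: assumes "\<not> forwarding g" "big g" shows "charge_unit v g \<le> 503/2000"
  unfolding charge_unit_def using M_bounds(5)[OF assms(2,1)] primary_charge_bounds by (intro convex_le merged_share_bounds) auto

lemma merged_share_1:
  assumes "v \<in> Qf" "h g = v" "nonloop g" "other_end g \<in> Qf" "qq (other_end g) \<le> qq v" shows "merged_share v g = 1"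
proof -
  have "max (qq (other_end g)) (pp v) \<le> qq v" using assms(5) pp_le_qq(2)[OF assms(1)] by simp
  then have "mu v \<le> merged_rate g" using assms discount_mono by (simp add: merged_rate_def mu_def)
  moreover have "0 < mu v" using assms(1) discount_pos by (simp add: mu_def)
  ultimately show ?thesis by (simp add: merged_share_def)
qed

lemma merged_share_mono:
  assumes v: "v \<in> Qf" "h g1 = v" "h g2 = v"
    and le: "nonloop g2 \<Longrightarrow> other_end g2 \<in> Qf \<Longrightarrow>
      nonloop g1 \<and> other_end g1 \<in> Qf \<and> qq (other_end g1) \<le> max (qq v) (qq (other_end g2))"
  shows "merged_share v g2 \<le> merged_share v g1"
proof (cases "nonloop g2 \<and> other_end g2 \<in> Qf")
  case False
  then have "merged_share v g2 \<le> 0" by (auto simp: merged_share_def merged_rate_def)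
  then show ?thesis using merged_share_bounds[of v g1] by linarith
next
  case True
  then have g1: "nonloop g1" "other_end g1 \<in> Qf" "qq (other_end g1) \<le> max (qq v) (qq (other_end g2))" using le by auto
  show ?thesis
  proof (cases "qq (other_end g1) \<le> qq v")
    case True
    then show ?thesis using merged_share_1[OF v(1,2) g1(1,2)] merged_share_bounds(2)[of v g2] by simp
  next
    case False
    then have "qq (other_end g1) \<le> qq (other_end g2)" using g1(3) by auto
    then have "discount (max (qq (other_end g2)) (pp v)) \<le> discount (max (qq (other_end g1)) (pp v))" by (intro discount_mono) auto
    then have "merged_rate g2 \<le> merged_rate g1" using g1 \<open>nonloop g2 \<and> _\<close> v by (simp add: merged_rate_def)
    then have "merged_rate g2 / mu v \<le> merged_rate g1 / mu v" using mu_nonneg by (rule divide_right_mono)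
    then show ?thesis by (auto simp: merged_share_def)
  qed
qed

lemma primary_charge_primary: assumes "primary_charge g \<noteq> 0" shows "nonloop g" "primary g (other_end g)"
  using assms by (auto simp: primary_charge_def split: if_splits)

text \<open>A \<open>mid\<close> edge that is the only big one satisfies \<open>forward\<close>. If
  it is primary for its other end, that end is in \<open>Q\<close> by the phase of \<open>v\<close>;
  so the share is 1 and the high charge of the unmerged state gets weight 0.\<close>

lemma single_big:
  assumes v: "v \<in> Qf" "v \<notin> B" and g: "bigs h v = {g}"
  shows "mid g \<Longrightarrow> 494/1000 + max 0 (w g - 745/1000) \<le> net_unit v g" "mid g \<Longrightarrow> charge_unit v g \<le> w g - 497/1000"
    and "\<not> mid g \<Longrightarrow> 743/1000 \<le> net_unit v g" "\<not> mid g \<Longrightarrow> charge_unit v g \<le> 503/2000"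
proof -
  have gv: "g \<in> E" "h g = v" "big g" using g by (auto simp: bigs_def)
  have b: "1/2 < w g" using gv(3) by (simp add: big_def)
  show "494/1000 + max 0 (w g - 745/1000) \<le> net_unit v g" if m: "mid g"
  proof (rule net_unit_ge[OF gv(3)])
    show "494/1000 + max 0 (w g - 745/1000) \<le> merged_net g"
      using forwarding_bounds[of g] not_forwarding_bounds[of g] b m by (cases "forwarding g") (auto simp: mid_def)
  qed
  show "charge_unit v g \<le> w g - 497/1000" if m: "mid g"
  proof -
    have "primary_charge g = 0 \<or> merged_share v g = 1"
    proof (rule disjCI)
      assume nf: "merged_share v g \<noteq> 1"
      show "primary_charge g = 0"
      proof (rule ccontr)
        assume "primary_charge g \<noteq> 0"
        then have p: "nonloop g" "primary g (other_end g)" using primary_charge_primary by auto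
        have "forward (Qm h (qq v)) h g" using g gv(2) by (simp add: forward_def)
        then have "other_end g \<in> Qf" "qq (other_end g) \<le> qq v"
          using forwarded[OF m p(2) other_end(2)[OF gv(1) p(1)], of "qq v"] v gv(2) m0_le(2)[OF v(1)] by auto
        then have "merged_share v g = 1" using merged_share_1[OF v(1) gv(2) p(1)] by simp
        then show False using nf by simp
      qed
    qed
    from charge_unit_le[OF this gv(3)] show ?thesis using M_bounds(4)[OF gv(3) m] by linarith
  qed
  assume m: "\<not> mid g"
  then have nh: "\<not> forwarding g" by (auto simp: forwarding_def)
  have "749/1000 \<le> w g" using m b by (simp add: mid_def)
  then show "743/1000 \<le> net_unit v g" using net_unit_bounds(2)[OF gv(3) nh, of v] by (simp add: plain_net_def)
  show "charge_unit v g \<le> 503/2000" using charge_unit_le_cap[OF nh gv(3)] .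
qed

lemma forwarding_two:
  assumes "bigs h v = {g, g'}" "g \<noteq> g'" "forwarding g"
  shows "w g \<le> 55/100" "merged_net g = 494/1000"
    and "74/100 < w g' \<or> (\<exists>x\<in>r g'. x \<noteq> v \<and> x \<in> QQ h (qi (other_end g) - 1))"
proof -
  have gv: "h g = v" using assms(1) by (auto simp: bigs_def)
  have f: "forward (QQ h (qi (other_end g) - 1)) h g" using assms(3) by (simp add: forwarding_def)
  moreover have "bigs h v \<noteq> {g}" using assms(1,2) by auto
  ultimately obtain g2 where g2: "w g \<le> 55/100" "g2 \<noteq> g" "bigs h v = {g, g2}"
    "74/100 < w g2 \<or> (\<exists>x\<in>r g2. x \<noteq> v \<and> x \<in> QQ h (qi (other_end g) - 1))"
    unfolding forward_def gv by blast
  have "g2 \<in> {g, g'}" using g2(3) assms(1) by blast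
  then have "g2 = g'" using g2(2) by simp
  then show "w g \<le> 55/100" "74/100 < w g' \<or> (\<exists>x\<in>r g'. x \<noteq> v \<and> x \<in> QQ h (qi (other_end g) - 1))"
    using g2 by auto
  then show "merged_net g = 494/1000" using forwarding_bounds[OF assms(3)] by simp
qed

lemma pair_net_bounds:
  assumes "bigs h v = {g, g'}" "g \<noteq> g'"
  shows "pair_net (w g) \<le> merged_net g" "pair_net (w g) \<le> net_unit v g"
proof -
  have b: "big g" using assms(1) by (auto simp: bigs_def)
  show 1: "pair_net (w g) \<le> merged_net g"
    using forwarding_two(1,2)[OF assms] not_forwarding_bounds(2)[of g] M_bounds(1)[OF b]
    by (cases "forwarding g") (auto simp: pair_net_def plain_net_def)
  show "pair_net (w g) \<le> net_unit v g" by (rule net_unit_ge[OF b 1])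
qed

text \<open>With \<open>g1\<close> in the configuration, \<open>v\<close> keeps the net value of
  \<open>g2\<close> and cedes the charge of \<open>g1\<close>. The bad combination is
  \<open>g2\<close> merged (low net) with \<open>g1\<close> unmerged (high charge). The second
  alternative of \<open>forward\<close> is made to exclude it where it matters: a primary
  \<open>g1\<close> of weight at most 0.55 is merged at once if \<open>g2\<close> weighs more than
  0.74, and otherwise no later than \<open>g2\<close>. A forwarding \<open>g2\<close> in turn
  requires \<open>g1\<close> above 0.74 or merged no later.\<close>

lemma two_bigs:
  assumes v: "v \<in> Qf" "v \<notin> B" and g: "bigs h v = {g1, g2}" "g1 \<noteq> g2"
  shows "w g1 \<le> 55/100 \<Longrightarrow>
      pair_net (w g2) - w g1 + 497/1000 \<le> net_unit v g2 - charge_unit v g1 \<or>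
      w g2 \<le> 74/100 \<and> 743/1000 - 503/2000 \<le> net_unit v g2 - charge_unit v g1"
    and "55/100 < w g1 \<Longrightarrow>
      plain_net (w g2) - 503/2000 \<le> net_unit v g2 - charge_unit v g1 \<or>
      w g2 \<le> 55/100 \<and> 74/100 < w g1 \<and> 494/1000 - 503/2000 \<le> net_unit v g2 - charge_unit v g1 \<or>
      w g2 \<le> 55/100 \<and> w g1 \<le> 74/100 \<and>
        (743/1000 - 503/2000 \<le> net_unit v g2 - charge_unit v g1 \<or> 494/1000 - 3/1000 \<le> net_unit v g2 - charge_unit v g1)"
proof -
  have gv: "g1 \<in> E" "h g1 = v" "big g1" "g2 \<in> E" "h g2 = v" "big g2" using g by (auto simp: bigs_def)
  have g': "bigs h v = {g2, g1}" "g2 \<noteq> g1" using g by auto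
  have b: "1/2 < w g1" using gv(3) by (simp add: big_def)
  \<comment> \<open>As the merged charge is at most the cap, the share of \<open>g1\<close> may be
    lowered to that of \<open>g2\<close>. The difference is then a convex combination of its
    unmerged and its merged value.\<close>
  have mix: "743/1000 - 503/2000 \<le> net_unit v g2 - charge_unit v g1 \<or> merged_net g2 - merged_charge g1 \<le> net_unit v g2 - charge_unit v g1"
    if le: "merged_share v g2 \<le> merged_share v g1" and merged_charge: "merged_charge g1 \<le> 503/2000"
  proof -
    define f where "f = merged_share v g2"
    have "(1 - merged_share v g1) * primary_charge g1 \<le> (1 - merged_share v g1) * (503/2000)"
      using primary_charge_bounds merged_share_bounds by (intro mult_left_mono) auto
    moreover have "(merged_share v g1 - f) * merged_charge g1 \<le> (merged_share v g1 - f) * (503/2000)"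
      using le merged_charge by (intro mult_left_mono) (auto simp: f_def)
    moreover have "(1 - merged_share v g1) * (503/2000) + (merged_share v g1 - f) * (503/2000) = (1 - f) * (503/2000)" by algebra
    moreover have "(merged_share v g1 - f) * merged_charge g1 + f * merged_charge g1 = merged_share v g1 * merged_charge g1" by algebra
    ultimately have "charge_unit v g1 \<le> (1 - f) * (503/2000) + f * merged_charge g1" unfolding charge_unit_def by linarith
    moreover have "min (743/1000 - 503/2000) (merged_net g2 - merged_charge g1)
        \<le> (1 - f) * (743/1000 - 503/2000) + f * (merged_net g2 - merged_charge g1)"
      by (rule convex_ge[OF _ _ min.cobounded1 min.cobounded2]) (simp_all add: f_def merged_share_bounds)
    moreover have "(1 - f) * (743/1000 - 503/2000) + f * (merged_net g2 - merged_charge g1)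
        = ((1 - f) * (743/1000) + f * merged_net g2) - ((1 - f) * (503/2000) + f * merged_charge g1)" by algebra
    ultimately have "min (743/1000 - 503/2000) (merged_net g2 - merged_charge g1) \<le> net_unit v g2 - charge_unit v g1"
      unfolding net_unit_def f_def[symmetric] by linarith
    then show ?thesis by linarith
  qed
  show "pair_net (w g2) - w g1 + 497/1000 \<le> net_unit v g2 - charge_unit v g1 \<or>
      w g2 \<le> 74/100 \<and> 743/1000 - 503/2000 \<le> net_unit v g2 - charge_unit v g1" if small: "w g1 \<le> 55/100"
  proof -
    have m: "mid g1" using b small by (simp add: mid_def)
    have merged_charge: "merged_charge g1 \<le> w g1 - 497/1000" by (rule M_bounds(4)[OF gv(3) m])
    have first: ?thesis if "primary_charge g1 = 0 \<or> merged_share v g1 = 1"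
      using charge_unit_le[OF that gv(3)] merged_charge pair_net_bounds(2)[OF g'] by linarith
    show ?thesis
    proof (cases "primary_charge g1 = 0")
      case True
      then show ?thesis using first by blast
    next
      case False
      then have p: "nonloop g1" "primary g1 (other_end g1)" using primary_charge_primary by auto
      note fwd = forwarded[OF m p(2) other_end(2)[OF gv(1) p(1)], unfolded gv(2), OF v]
      show ?thesis
      proof (cases "74/100 < w g2")
        case True
        have "forward (Qm h (qq v)) h g1" unfolding forward_def gv(2) using g small True by blast
        then have "merged_share v g1 = 1" using fwd[of "qq v"] m0_le(2)[OF v(1)] merged_share_1[OF v(1) gv(2) p(1)] by simp
        then show ?thesis using first by blast
      next
        case False
        have "merged_share v g2 \<le> merged_share v g1"
        proof (rule merged_share_mono[OF v(1) gv(2,5)])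
          assume o2: "nonloop g2" "other_end g2 \<in> Qf"
          let ?m = "max (qq v) (qq (other_end g2))"
          have m: "?m \<le> m0" using m0_le(2) v(1) o2(2) by simp
          have "other_end g2 \<in> Qm h ?m" using in_Qm_iff[OF o2(2)] by simp
          then have "forward (Qm h ?m) h g1"
            unfolding forward_def gv(2) using g small other_end[OF gv(4) o2(1)] gv(5) by blast
          then show "nonloop g1 \<and> other_end g1 \<in> Qf \<and> qq (other_end g1) \<le> ?m" using fwd[of ?m] m p(1) by simp
        qed
        from mix[OF this] show ?thesis using merged_charge small False pair_net_bounds(1)[OF g'] by argo
      qed
    qed
  qed
  show "plain_net (w g2) - 503/2000 \<le> net_unit v g2 - charge_unit v g1 \<or>
      w g2 \<le> 55/100 \<and> 74/100 < w g1 \<and> 494/1000 - 503/2000 \<le> net_unit v g2 - charge_unit v g1 \<or>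
      w g2 \<le> 55/100 \<and> w g1 \<le> 74/100 \<and>
        (743/1000 - 503/2000 \<le> net_unit v g2 - charge_unit v g1 \<or> 494/1000 - 3/1000 \<le> net_unit v g2 - charge_unit v g1)"
    if large: "55/100 < w g1"
  proof -
    have nh: "\<not> forwarding g1" using forwarding_two(1)[OF g] large by auto
    have c1: "charge_unit v g1 \<le> 503/2000" using charge_unit_le_cap[OF nh gv(3)] .
    show ?thesis
    proof (cases "forwarding g2")
      case False
      then show ?thesis using net_unit_bounds(2)[OF gv(6), of v] c1 by linarith
    next
      case True
      note h2 = forwarding_two[OF g' True]
      show ?thesis
      proof (cases "74/100 < w g1")
        case True
        then show ?thesis using h2(1) net_unit_bounds(1)[OF gv(6), of v] c1 by linarith
      next
        case small: False
        then obtain x where x: "x \<in> r g1" "x \<noteq> v" "x \<in> QQ h (qi (other_end g2) - 1)" using h2(3) by auto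
        have o2: "other_end g2 \<in> Qf" using True by (simp add: forwarding_def)
        have "qi (other_end g2) - 1 \<le> K * Suc m0" using stage_bound(1)[OF o2] by simp
        then have xQ: "x \<in> Qf" using in_Qf x(3) by blast
        have "qi x \<le> qi (other_end g2)" using qi_le[OF x(3)] by simp
        then have "qq x \<le> qq (other_end g2)" by (simp add: qq_def div_le_mono)
        moreover have "nonloop g1" "other_end g1 = x" using other_end_eq[OF gv(1) x(1)] x(2) gv(2) by auto
        ultimately have "merged_share v g2 \<le> merged_share v g1" using xQ by (intro merged_share_mono[OF v(1) gv(2,5)]) auto
        moreover have "merged_charge g1 = 3/1000" using not_forwarding_bounds(1)[OF nh] small_charge_bounds(3)[of "w g1"] small by simp
        ultimately show ?thesis using mix h2(1,2) small by argo
      qed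
    qed
  qed
qed

end

declare [[argo_timeout = 60]]

section \<open>Numerical estimates\<close>

lemma pair_net_cases: "x \<le> 55/100 \<and> pair_net x = 494/1000 \<or> 55/100 < x \<and> x \<le> 749/1000 \<and> pair_net x = x - 6/1000 \<or>
    749/1000 \<le> x \<and> pair_net x = 743/1000"
  by (auto simp: pair_net_def plain_net_def min_def)

lemma plain_net_cases: "x \<le> 749/1000 \<and> plain_net x = x - 6/1000 \<or> 749/1000 \<le> x \<and> plain_net x = 743/1000"
  by (auto simp: plain_net_def min_def)

lemma small_charge_cases: "x \<le> 745/1000 \<and> small_charge x = 3/1000 \<or> 745/1000 \<le> x \<and> x \<le> 9935/10000 \<and> small_charge x = x - 742/1000 \<or>
    9935/10000 \<le> x \<and> small_charge x = 2515/10000"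
  unfolding small_charge_def by linarith

text \<open>Weights and numbers at a vertex with load \<open>L\<close> and a configuration: \<open>kH\<close>, \<open>WH\<close> for held heavy edges,
  \<open>kK\<close>, \<open>WK\<close> for those of them in the configuration, \<open>kN\<close>, \<open>WN\<close> for heavy edges in the configuration held
  by the other end; \<open>S\<close> and \<open>SC\<close> for held light edges and those in the configuration, \<open>lo\<close> for loose ones
  outside of it; \<open>pl\<close>, \<open>pr\<close> for light edges held elsewhere and in the configuration, \<open>P\<close> for their value; \<open>f\<close> and
  \<open>F\<close> for weight and value of a big edge of that kind. In \<open>trigger_numbers\<close>, \<open>we\<close> is the weight of the trigger
  and \<open>n\<close> the excess of the load over \<open>T\<close> after flipping it.\<close>

locale vertex_numbers =
  fixes kH kK kN WH WK WN S SC lo pl pr P f F b c L :: real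
  assumes kH: "kH = 0 \<or> kH = 1 \<or> kH = 2 \<or> kH \<ge> 3"
    and kK: "kK = 0 \<or> kK = 1 \<or> kK = 2"
    and kN: "kN = 0 \<or> kN = 1 \<or> kN = 2"
    and WH: "42/100 * kH \<le> WH"
    and WK: "42/100 * kK \<le> WK"
    and WK': "WK \<le> 1/2 * kK"
    and KH: "WK \<le> WH"
    and WN: "42/100 * kN \<le> WN"
    and WN': "WN \<le> 1/2 * kN"
    and SC: "0 \<le> SC"
    and lo: "0 \<le> lo"
    and lo': "lo \<le> S - SC"
    and pl: "0 \<le> pl"
    and pr: "0 \<le> pr"
    and L: "L = b + WH + S"
    and cap: "c + f + WK + WN + SC + pl + pr \<le> 1"
    and P: "P \<le> 93/100 * pl \<and> pr = 0 \<and> L \<le> 1329/1000 \<or> L > 1329/1000 \<and> P \<le> pl + 100/93 * pr \<and> (pr \<le> 84/100 \<or> L > 1749/1000 - 1/3)"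
    and F: "f = 0 \<and> F = 0 \<or> c = 0 \<and> 1/2 < f \<and> f \<le> 1 \<and> (f \<le> 749/1000 \<and> F \<le> f - 6/1000 \<or> 749/1000 \<le> f \<and> F \<le> 743/1000)"
begin

end

locale trigger_numbers = vertex_numbers +
  fixes we n :: real
  assumes n: "n = L + we - 1749/1000"
    and n0: "0 \<le> n"
    and nl: "n \<le> 2/10 \<longrightarrow> lo \<le> n"
begin

text \<open>\<open>R\<close> is the charge received at \<open>v\<close>. Left is the value of the
  configuration and right that of the vertex, with shared terms cancelled as in
  \<open>unit_part_total\<close>. The estimates are linear after splitting finitely many
  disjunctions.\<close>

lemma heavy_trigger:
  assumes "42/100 < we \<and> we \<le> 1/2 \<and> R \<ge> 3/1000" "big_case X b c"
  shows "WK - 3/1000 * kK + WN - 6/1000 * kN + SC + P + F \<le> X + R + (WH - 6/1000 * kH) + S - 7/100 * lo"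
  using assms(2)
proof (cases rule: big_case.cases)
  case none
  then show ?thesis using assms(1) WH WK WK' KH WN WN' SC lo' pl L cap P F n n0 by argo
next
  case single_out
  then show ?thesis using assms(1) kK WH WK WK' KH WN WN' SC lo' pl L cap P F n n0 nl by argo
next
  case single_in
  then show ?thesis using assms(1) kH kK kN WH WK WK' WN WN' SC lo' pl L cap P F n n0 nl by argo
next
  case (pair_out w1 w2)
  then show ?thesis using assms(1) WH WK WK' KH WN WN' SC lo lo' pl L cap P F pair_net_cases[of w1] pair_net_cases[of w2] by argo
next
  case (pair_in_small w1 w2)
  then show ?thesis using assms(1) WH WK WK' KH WN WN' SC lo lo' pl L cap P F n nl pair_net_cases[of w2] by argo
next
  case (pair_in_large w1 w2)
  then show ?thesis using assms(1) kH kN WH WK WK' KH WN WN' SC lo lo' pl L cap P F n nl plain_net_cases[of w2] by argo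
next
  case many
  then show ?thesis using assms(1) WH WK WK' KH WN WN' SC lo lo' pl cap P F by argo
qed

text \<open>Here no charge from the trigger is available, but the trigger takes up capacity of the
  configuration.\<close>

lemma heavy_trigger_in_config:
  assumes "42/100 < we \<and> we \<le> 1/2 \<and> R \<ge> 0 \<and> 1 \<le> kN \<and> we \<le> WN \<and> WN - we \<le> 1/2 * (kN - 1)" "big_case X b c"
  shows "WK - 3/1000 * kK + WN - 6/1000 * kN + SC + P + F \<le> X + R + (WH - 6/1000 * kH) + S - 7/100 * lo"
  using assms(2)
proof (cases rule: big_case.cases)
  case none
  then show ?thesis using assms(1) WH WK WK' KH SC lo' pl L cap P F n n0 by argo
next
  case single_out
  then show ?thesis using assms(1) kH WH WK WK' KH SC lo' pl L cap P F n n0 nl by argo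
next
  case single_in
  then show ?thesis using assms(1) WH WK WK' KH SC lo' pl L cap P F n n0 by argo
next
  case (pair_out w1 w2)
  then show ?thesis using assms(1) WH WK WK' KH SC lo lo' pl L cap P F pair_net_cases[of w1] pair_net_cases[of w2] by argo
next
  case (pair_in_small w1 w2)
  then show ?thesis using assms(1) WH WK WK' KH SC lo' pl L cap P F n n0 pair_net_cases[of w2] by argo
next
  case (pair_in_large w1 w2)
  then show ?thesis using assms(1) WH WK WK' KH SC lo lo' pl L cap P F n nl plain_net_cases[of w2] by argo
next
  case many
  then show ?thesis using assms(1) WH WK WK' KH SC lo lo' pl cap P F by argo
qed

text \<open>A light trigger cedes nothing, but it forces a load above \<open>T\<close> - 0.42 =
  1.329.\<close>

lemma light_trigger:
  assumes "0 < we \<and> we \<le> 42/100 \<and> R \<ge> 0 \<and> 1329/1000 < L" "big_case X b c"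
  shows "WK - 3/1000 * kK + WN - 6/1000 * kN + SC + P + F \<le> X + R + (WH - 6/1000 * kH) + S - 7/100 * lo"
  using assms(2)
proof (cases rule: big_case.cases)
  case none
  then show ?thesis using assms(1) WH WK WK' KH WN WN' SC lo' pl L cap P F by argo
next
  case single_out
  then show ?thesis using assms(1) WH WK WK' KH WN WN' SC lo' pl L cap P F n nl by argo
next
  case single_in
  then show ?thesis using assms(1) WH WK WK' KH WN WN' SC lo' pl L cap P F by argo
next
  case (pair_out w1 w2)
  then show ?thesis using assms(1) WH WK WK' KH WN WN' SC lo lo' pl L cap P F pair_net_cases[of w1] pair_net_cases[of w2] by argo
next
  case (pair_in_small w1 w2)
  then show ?thesis using assms(1) WH WK WK' KH WN WN' SC lo' pl L cap P F pair_net_cases[of w2] by argo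
next
  case (pair_in_large w1 w2)
  then show ?thesis using assms(1) WH WK WK' KH WN WN' SC lo lo' pl L cap P F n nl plain_net_cases[of w2] by argo
next
  case many
  then show ?thesis using assms(1) WH WK WK' KH WN WN' SC lo lo' pl cap P F by argo
qed

lemma forward_trigger:
  assumes "1/2 < we \<and> we < 749/1000 \<and> we - 497/1000 \<le> R" "big_case X b c"
  shows "WK - 3/1000 * kK + WN - 6/1000 * kN + SC + P + F \<le> X + R + (WH - 6/1000 * kH) + S - 7/100 * lo"
  using assms(2)
proof (cases rule: big_case.cases)
  case none
  then show ?thesis using assms(1) WH WK WK' KH WN WN' SC lo' pl L cap P F n n0 by argo
next
  case single_out
  then show ?thesis using assms(1) kK WH WK WK' KH WN WN' SC lo' pl L cap P F n n0 nl by argo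
next
  case single_in
  then show ?thesis using assms(1) kH kK kN WH WK WK' WN WN' SC lo' pl L cap P F n n0 nl by argo
next
  case (pair_out w1 w2)
  then show ?thesis using assms(1) WH WK WK' KH WN WN' SC lo lo' pl L cap P F pair_net_cases[of w1] pair_net_cases[of w2] by argo
next
  case (pair_in_small w1 w2)
  then show ?thesis using assms(1) WH WK WK' KH WN WN' SC lo lo' pl L cap P F n nl pair_net_cases[of w2] by argo
next
  case (pair_in_large w1 w2)
  then show ?thesis using assms(1) kH kN WH WK WK' KH WN WN' SC lo lo' pl L cap P F n nl plain_net_cases[of w2] by argo
next
  case many
  then show ?thesis using assms(1) WH WK WK' KH WN WN' SC lo lo' pl cap P F by argo
qed

text \<open>What the trigger fails to pay is offset by its low value in the configuration: a
  forwarding edge is left with 0.494 up to weight 0.745.\<close>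

lemma forward_trigger_in_config:
  assumes "1/2 < we \<and> we < 749/1000 \<and> R \<ge> 0 \<and> f = we" "we \<le> 745/1000 \<and> F \<le> 494/1000 \<or> 745/1000 \<le> we \<and> F \<le> we - 251/1000" "big_case X b c"
  shows "WK - 3/1000 * kK + WN - 6/1000 * kN + SC + P + F \<le> X + R + (WH - 6/1000 * kH) + S - 7/100 * lo"
  using assms(3)
proof (cases rule: big_case.cases)
  case none
  then show ?thesis using assms(1,2) WH WK WK' KH WN WN' SC lo' pl L cap P n n0 by argo
next
  case single_out
  then show ?thesis using assms(1,2) kH kN WH WK WK' KH WN WN' SC lo' pl L cap P n n0 nl by argo
next
  case single_in
  then show ?thesis using assms(1,2) F by argo
next
  case (pair_out w1 w2)
  then show ?thesis using assms(1,2) WH WK WK' KH WN WN' SC lo lo' pl L cap P pair_net_cases[of w1] pair_net_cases[of w2] by argo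
next
  case (pair_in_small w1 w2)
  then show ?thesis using assms(1,2) F pair_net_cases[of w2] by argo
next
  case (pair_in_large w1 w2)
  then show ?thesis using assms(1,2) F plain_net_cases[of w2] by argo
next
  case many
  then show ?thesis using assms(1,2) WH WK WK' KH WN WN' SC lo lo' pl cap P by argo
qed

lemma big_trigger:
  assumes "1/2 < we" "we \<le> 1" "small_charge we \<le> R" "X = 0" "b = 0" "c = 0"
  shows "WK - 3/1000 * kK + WN - 6/1000 * kN + SC + P + F \<le> X + R + (WH - 6/1000 * kH) + S - 7/100 * lo"
  using assms kH WH WK WK' KH WN WN' SC lo' pl L cap P F n n0 nl small_charge_cases[of we] by argo

lemma big_trigger_in_config:
  assumes "1/2 < we" "we \<le> 1" "0 \<le> R" "f = we" "X = 0" "b = 0" "c = 0"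
  shows "WK - 3/1000 * kK + WN - 6/1000 * kN + SC + P + F \<le> X + R + (WH - 6/1000 * kH) + S - 7/100 * lo"
  using assms kH kK kN WH WK WK' WN WN' SC lo' pl L cap P F n n0 nl by argo

text \<open>The held big edge is fully merged and not forwarding here, so in the configuration it
  costs only \<open>small_charge b\<close>.\<close>

lemma back_trigger:
  assumes "1/2 < we" "we \<le> 1" "small_charge we \<le> R" "1/2 < b" "b < 749/1000" "c = 0 \<and> b - 6/1000 \<le> X \<or> c = b \<and> - small_charge b \<le> X"
  shows "WK - 3/1000 * kK + WN - 6/1000 * kN + SC + P + F \<le> X + R + (WH - 6/1000 * kH) + S - 7/100 * lo"
  using assms kH kN WH WK WK' KH WN WN' SC lo' pl L cap P F n n0 nl small_charge_cases[of we] small_charge_cases[of b] by argo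

lemma back_trigger_in_config:
  assumes "1/2 < we" "we \<le> 1" "0 \<le> R" "f = we" "1/2 < b" "b < 749/1000" "c = 0 \<and> b - 6/1000 \<le> X \<or> c = b \<and> - small_charge b \<le> X"
  shows "WK - 3/1000 * kK + WN - 6/1000 * kN + SC + P + F \<le> X + R + (WH - 6/1000 * kH) + S - 7/100 * lo"
  using assms kH kK kN WH WK WK' WN WN' SC lo' pl L cap P F n n0 nl small_charge_cases[of b] by argo

end

lemma (in vertex_numbers) overload:
  assumes LB: "1749/1000 < L" and "overloaded_big_case X b c"
  shows "WK - 3/1000 * kK + WN - 6/1000 * kN + SC + P + F + 1/100 \<le> X + (WH - 6/1000 * kH) + S - 7/100 * lo"
  using assms(2)
proof (cases rule: overloaded_big_case.cases)
  case none
  then show ?thesis using WH WK WK' KH WN WN' SC lo' pl L cap P F LB by argo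
next
  case single
  then show ?thesis using WH WK WK' KH WN WN' SC lo' pl L cap P F LB plain_net_cases[of b] by argo
next
  case (pair w1 w2)
  then show ?thesis using WH WK WK' KH WN WN' SC lo' pl L cap P F LB plain_net_cases[of w1] plain_net_cases[of w2] by argo
next
  case many
  then show ?thesis using WH WK WK' KH WN WN' SC lo lo' pl cap P F by argo
qed

section \<open>The local inequality\<close>

lemma sum_indicator:
  fixes f :: "'a \<Rightarrow> real"
  assumes "finite E" "A \<subseteq> E" shows "sum f A = (\<Sum>e\<in>E. if e \<in> A then f e else 0)"
  using assms by (simp add: sum.If_cases Int_absorb1)

context optimal_orientation begin

lemma forwarding_not_bad: "h g \<in> B \<Longrightarrow> \<not> forwarding g"
  by (simp add: forwarding_def)

lemma forwarding_card: assumes "forwarding g" "h g = v" shows "card (bigs h v) \<le> 2"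
proof -
  have "bigs h v = {g} \<or> (\<exists>g2. bigs h v = {g, g2})"
    using assms unfolding forwarding_def forward_def by blast
  then show ?thesis by (auto simp: card_insert_if)
qed

lemma bigs_facts: "g \<in> bigs h v \<Longrightarrow> g \<in> E \<and> h g = v \<and> big g \<and> 1/2 < w g \<and> w g \<le> 1"
  using w_le_1 by (auto simp: bigs_def big_def)

end

section \<open>Splitting a vertex and a configuration into weight classes\<close>

locale config_at = optimal_orientation +
  fixes v :: 'a and C :: "'b set"
  assumes v: "v \<in> Qf" and C: "C \<subseteq> {e\<in>E. v \<in> r e}" "(\<Sum>e\<in>C. w e) \<le> 1"
begin

abbreviation "Bg \<equiv> bigs h v"
definition "big_part = (\<Sum>g\<in>Bg - C. net_unit v g) - (\<Sum>g\<in>Bg \<inter> C. charge_unit v g)"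
definition "HU = {e\<in>E. h e = v \<and> heavy e \<and> e \<notin> C}"
definition "HK = {e\<in>E. h e = v \<and> heavy e \<and> e \<in> C}"
definition "LU = {e\<in>E. h e = v \<and> light e \<and> e \<notin> C}"
definition "LK = {e\<in>E. h e = v \<and> light e \<and> e \<in> C}"
definition "NB = {e\<in>E. h e \<noteq> v \<and> big e \<and> e \<in> C}"
definition "NH = {e\<in>E. h e \<noteq> v \<and> heavy e \<and> e \<in> C}"
definition "NL = {e\<in>E. h e \<noteq> v \<and> light e \<and> e \<in> C}"
definition "PO = {e\<in>E. h e \<noteq> v \<and> v \<in> r e \<and> e \<notin> C}"

lemma classes: "light e \<longleftrightarrow> \<not> big e \<and> \<not> heavy e" "heavy e \<Longrightarrow> \<not> big e"
  unfolding light_def big_def heavy_def by linarith+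

lemma sets_sub: "HU \<subseteq> E" "HK \<subseteq> E" "LU \<subseteq> E" "LK \<subseteq> E" "NB \<subseteq> E" "NH \<subseteq> E" "NL \<subseteq> E" "PO \<subseteq> E"
    "Bg - C \<subseteq> E" "Bg \<inter> C \<subseteq> E" "Bg \<subseteq> E" "loose v - C \<subseteq> E" "C \<subseteq> E" "{e\<in>E. h e = v} \<subseteq> E"
  using C by (auto simp: HU_def HK_def LU_def LK_def NB_def NH_def NL_def PO_def bigs_def loose_def loose_at_def)

text \<open>All class sums become sums over \<open>E\<close>, so that the splitting identities are
  checked edge by edge.\<close>

lemmas indicators = sets_sub[THEN sum_indicator[OF finite_E]]

lemma load_split: "load h v = (\<Sum>e\<in>Bg. w e) + ((\<Sum>e\<in>HU. w e) + (\<Sum>e\<in>HK. w e)) + ((\<Sum>e\<in>LU. w e) + (\<Sum>e\<in>LK. w e))"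
  unfolding load_def indicators sum.distrib[symmetric]
  by (rule sum.cong) (auto simp: HU_def HK_def LU_def LK_def bigs_def classes)

lemma config_split: "(\<Sum>e\<in>C. w e) = (\<Sum>e\<in>Bg \<inter> C. w e) + (\<Sum>e\<in>NB. w e) + (\<Sum>e\<in>HK. w e) + (\<Sum>e\<in>NH. w e)
    + (\<Sum>e\<in>LK. w e) + (\<Sum>e\<in>NL. w e)"
  unfolding indicators sum.distrib[symmetric]
  by (rule sum.cong) (auto simp: HK_def LK_def NB_def NH_def NL_def bigs_def classes)

lemma unit_part_split: "(\<Sum>e\<in>E. unit_part v C e) = big_part + ((\<Sum>e\<in>HU. w e) - (\<Sum>e\<in>HU. 6/1000)) - (\<Sum>e\<in>HK. 3/1000)
    + (\<Sum>e\<in>LU. w e) - (\<Sum>e\<in>loose v - C. 7/100 * w e) - (\<Sum>e\<in>NB. merged_net e)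
    - ((\<Sum>e\<in>NH. w e) - (\<Sum>e\<in>NH. 6/1000)) - (\<Sum>e\<in>NL. light_scale v e * w e) + (\<Sum>e\<in>PO. received_unit v e)"
proof -
  have l: "e \<in> loose v \<Longrightarrow> light e \<and> h e = v" for e by (auto simp: loose_def loose_at_def)
  have hv: "h e = v \<Longrightarrow> e \<in> E \<Longrightarrow> v \<in> r e" for e using head_in[OF h_oris] by blast
  show ?thesis
    unfolding big_part_def indicators sum.distrib[symmetric] sum_subtractf[symmetric]
  proof (rule sum.cong[OF refl])
    fix e assume e: "e \<in> E"
    have vr: "e \<in> C \<Longrightarrow> v \<in> r e" using C(1) by blast
    have mem: "e \<in> Bg - C \<longleftrightarrow> h e = v \<and> big e \<and> e \<notin> C" "e \<in> Bg \<inter> C \<longleftrightarrow> h e = v \<and> big e \<and> e \<in> C"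
      "e \<in> HU \<longleftrightarrow> h e = v \<and> heavy e \<and> e \<notin> C" "e \<in> HK \<longleftrightarrow> h e = v \<and> heavy e \<and> e \<in> C"
      "e \<in> LU \<longleftrightarrow> h e = v \<and> light e \<and> e \<notin> C"
      "e \<in> NB \<longleftrightarrow> h e \<noteq> v \<and> big e \<and> e \<in> C" "e \<in> NH \<longleftrightarrow> h e \<noteq> v \<and> heavy e \<and> e \<in> C"
      "e \<in> NL \<longleftrightarrow> h e \<noteq> v \<and> light e \<and> e \<in> C" "e \<in> PO \<longleftrightarrow> h e \<noteq> v \<and> v \<in> r e \<and> e \<notin> C"
      by (simp_all add: HU_def HK_def LU_def NB_def NH_def NL_def PO_def bigs_def e)
    have lo: "e \<in> loose v - C \<longleftrightarrow> h e = v \<and> light e \<and> e \<in> loose v \<and> e \<notin> C"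
      using l[of e] by blast
    show "unit_part v C e = (if e \<in> Bg - C then net_unit v e else 0) - (if e \<in> Bg \<inter> C then charge_unit v e else 0)
      + ((if e \<in> HU then w e else 0) - (if e \<in> HU then 6/1000 else 0)) - (if e \<in> HK then 3/1000 else 0)
      + (if e \<in> LU then w e else 0) - (if e \<in> loose v - C then 7/100 * w e else 0) - (if e \<in> NB then merged_net e else 0)
      - ((if e \<in> NH then w e else 0) - (if e \<in> NH then 6/1000 else 0)) - (if e \<in> NL then light_scale v e * w e else 0)
      + (if e \<in> PO then received_unit v e else 0)"
      unfolding mem lo classes(1) unit_part_def using vr classes(2)[of e]
      by (cases "h e = v"; cases "e \<in> C"; cases "big e"; cases "heavy e"; simp)
  qed
qed

lemma fin: "A \<subseteq> E \<Longrightarrow> finite A" using finite_E finite_subset by blast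

lemma sum_w_nonneg: "A \<subseteq> E \<Longrightarrow> 0 \<le> (\<Sum>e\<in>A. w e)"
  using w_pos by (intro sum_nonneg) (auto intro: less_imp_le)

lemma received_unit_nonneg: "0 \<le> received_unit v e"
  using merged_charge_nonneg by (simp add: received_unit_def)

lemma big_in_C: assumes "g \<in> Bg" "g \<in> C" shows "Bg \<inter> C = {g}" "NB = {}"
proof -
  have g: "big g" "h g = v" using assms(1) by (auto simp: bigs_def)
  have u: "f = g" if "f \<in> C" "big f" for f using big_in_config_unique[OF C that assms(2) g(1)] .
  show "Bg \<inter> C = {g}" using assms u unfolding bigs_def by blast
  show "NB = {}" using u g(2) unfolding NB_def by blast
qed

lemma NB_cases: "NB = {} \<or> (\<exists>f. NB = {f} \<and> f \<in> E \<and> big f \<and> f \<in> C \<and> h f \<noteq> v \<and> Bg \<inter> C = {})"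
proof (cases "NB = {}")
  case False
  then obtain f where f: "f \<in> NB" by blast
  then have f': "f \<in> E" "big f" "f \<in> C" "h f \<noteq> v" by (auto simp: NB_def)
  have u: "e = f" if "e \<in> C" "big e" for e using big_in_config_unique[OF C that f'(3,2)] .
  have "NB = {f}" using u f unfolding NB_def by blast
  moreover have "Bg \<inter> C = {}" using u f'(4) unfolding bigs_def by blast
  ultimately show ?thesis using f' by blast
qed simp

lemma heavy_card:
  assumes "A \<subseteq> E" "\<And>e. e \<in> A \<Longrightarrow> heavy e"
  shows "42/100 * real (card A) \<le> (\<Sum>e\<in>A. w e)" "(\<Sum>e\<in>A. w e) \<le> 1/2 * real (card A)"
proof -
  have w: "42/100 \<le> w e" "w e \<le> 1/2" if "e \<in> A" for e using assms(2)[OF that] by (auto simp: heavy_def)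
  show "42/100 * real (card A) \<le> (\<Sum>e\<in>A. w e)" using sum_bounded_below[of A "42/100" w, OF w(1)] by simp
  show "(\<Sum>e\<in>A. w e) \<le> 1/2 * real (card A)" using sum_bounded_above[of A w "1/2", OF w(2)] by simp
qed

lemma heavy_card_in_C:
  assumes "A \<subseteq> C" "\<And>e. e \<in> A \<Longrightarrow> heavy e"
  shows "card A = 0 \<or> card A = 1 \<or> card A = 2"
proof -
  have "(\<Sum>e\<in>A. w e) \<le> (\<Sum>e\<in>C. w e)"
    using assms(1) C(1) w_pos fin[OF sets_sub(13)] by (intro sum_mono2) (auto intro: less_imp_le)
  moreover have "A \<subseteq> E" using assms(1) sets_sub(13) by blast
  ultimately have "42/100 * real (card A) \<le> 1" using heavy_card(1)[OF _ assms(2), of A] C(2) by linarith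
  then have "card A < 3" by simp
  then show ?thesis by linarith
qed

lemma three_bigs:
  assumes "3 \<le> card Bg" and nh: "\<And>g. g \<in> Bg \<Longrightarrow> \<not> forwarding g"
  shows "3/2 \<le> (\<Sum>e\<in>Bg. w e)"
    and "(\<Sum>e\<in>Bg \<inter> C. w e) = 0 \<and> 1482/1000 \<le> big_part \<or>
      1/2 < (\<Sum>e\<in>Bg \<inter> C. w e) \<and> 988/1000 - 503/2000 \<le> big_part"
proof -
  have finB: "finite Bg" using fin sets_sub by blast
  have "real (card Bg) * (1/2) \<le> (\<Sum>e\<in>Bg. w e)"
    using bigs_facts[of _ v] by (intro sum_bounded_below) (auto intro: less_imp_le)
  then show "3/2 \<le> (\<Sum>e\<in>Bg. w e)" using assms(1) by linarith
  have n: "real (card A) * (494/1000) \<le> (\<Sum>g\<in>A. net_unit v g)" if "A \<subseteq> Bg" for A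
    using that bigs_facts[of _ v] net_unit_bounds(1) by (intro sum_bounded_below) blast
  show "(\<Sum>e\<in>Bg \<inter> C. w e) = 0 \<and> 1482/1000 \<le> big_part \<or>
      1/2 < (\<Sum>e\<in>Bg \<inter> C. w e) \<and> 988/1000 - 503/2000 \<le> big_part"
  proof (cases "Bg \<inter> C = {}")
    case True
    then have "Bg - C = Bg" by blast
    then have "1482/1000 \<le> big_part" using True n[of Bg] assms(1) by (simp add: big_part_def)
    then show ?thesis unfolding True by simp
  next
    case False
    then obtain g where g: "g \<in> Bg" "g \<in> C" by blast
    note i = big_in_C(1)[OF g]
    have "Bg - C = Bg - {g}" using i by blast
    then have "2 \<le> card (Bg - C)" using g assms(1) finB by (simp add: card_Diff_singleton)
    then have "988/1000 \<le> (\<Sum>g\<in>Bg - C. net_unit v g)" using n[of "Bg - C"] by simp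
    moreover have "charge_unit v g \<le> 503/2000" using charge_unit_le_cap nh g(1) bigs_facts by blast
    ultimately have "988/1000 - 503/2000 \<le> big_part" unfolding big_part_def i by simp
    moreover have "1/2 < w g" using bigs_facts g by blast
    ultimately show ?thesis unfolding i by simp
  qed
qed

lemma card_cases:
  obtains "Bg = {}" | g where "Bg = {g}" | g1 g2 where "Bg = {g1, g2}" "g1 \<noteq> g2" | "3 \<le> card Bg"
proof -
  have f: "finite Bg" using fin sets_sub by blast
  consider "card Bg = 0" | "card Bg = 1" | "card Bg = 2" | "3 \<le> card Bg" by linarith
  then show ?thesis
  proof cases
    case 1 then show ?thesis using that(1) f by simp
  next
    case 2
    then obtain g where "Bg = {g}" by (rule card_1_singletonE)
    then show ?thesis by (rule that(2))
  next
    case 3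
    then obtain g1 g2 where "Bg = {g1, g2}" "g1 \<noteq> g2" by (meson card_2_iff)
    then show ?thesis by (rule that(3))
  qed (use that(4) in blast)
qed

lemma single:
  assumes "Bg = {g}"
  shows "g \<notin> C \<Longrightarrow> big_part = net_unit v g \<and> (\<Sum>e\<in>Bg \<inter> C. w e) = 0" "g \<in> C \<Longrightarrow> big_part = - charge_unit v g \<and> (\<Sum>e\<in>Bg \<inter> C. w e) = w g"
proof -
  assume "g \<notin> C"
  then have "Bg \<inter> C = {}" "Bg - C = {g}" using assms by auto
  then show "big_part = net_unit v g \<and> (\<Sum>e\<in>Bg \<inter> C. w e) = 0" unfolding big_part_def by (simp only:) simp
next
  assume "g \<in> C"
  then have "Bg \<inter> C = {g}" "Bg - C = {}" using assms by auto
  moreover from this(2) have "(\<Sum>e\<in>Bg - C. net_unit v e) = 0" by (simp only: sum.empty)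
  ultimately show "big_part = - charge_unit v g \<and> (\<Sum>e\<in>Bg \<inter> C. w e) = w g" by (simp add: big_part_def)
qed

lemma pair:
  assumes "Bg = {g1, g2}" "g1 \<noteq> g2"
  obtains "big_part = net_unit v g1 + net_unit v g2" "(\<Sum>e\<in>Bg \<inter> C. w e) = 0"
    | a a' where "Bg = {a, a'}" "a \<noteq> a'" "big_part = net_unit v a' - charge_unit v a" "(\<Sum>e\<in>Bg \<inter> C. w e) = w a"
proof -
  note that2 = that(2)
  have one: thesis if "Bg = {a, a'}" "a \<noteq> a'" "a \<in> C" for a a'
  proof -
    have i: "Bg \<inter> C = {a}" using big_in_C(1)[of a] that by blast
    then have "Bg - C = {a'}" using that(1,2,3) by auto
    then have "big_part = net_unit v a' - charge_unit v a" "(\<Sum>e\<in>Bg \<inter> C. w e) = w a" unfolding big_part_def i by simp_all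
    then show thesis by (rule that2[OF \<open>Bg = {a, a'}\<close> \<open>a \<noteq> a'\<close>])
  qed
  show thesis
  proof (cases "g1 \<in> C \<or> g2 \<in> C")
    case True
    then show thesis using one[of g1 g2] one[of g2 g1] assms by (auto simp: insert_commute)
  next
    case False
    then have "Bg \<inter> C = {}" "Bg - C = Bg" using assms(1) by auto
    then show thesis using that(1) assms by (simp add: big_part_def)
  qed
qed

lemma big_case: assumes vB: "v \<notin> B" shows "big_case big_part (\<Sum>e\<in>Bg. w e) (\<Sum>e\<in>Bg \<inter> C. w e)"
proof (cases rule: card_cases)
  case 1
  then show ?thesis by (intro big_case.none) (simp add: big_part_def)
next
  case (2 g)
  note f = bigs_facts[of g v, unfolded 2, simplified] and s = single[OF 2] and sb = single_big[OF v vB 2]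
  have m: "mid g \<longleftrightarrow> w g < 749/1000" using f by (simp add: mid_def)
  show ?thesis
  proof (cases "g \<in> C")
    case False
    then have "494/1000 \<le> big_part \<and> w g - 251/1000 \<le> big_part \<or> \<not> mid g \<and> 743/1000 \<le> big_part"
      using s(1) sb(1,3) by (cases "mid g") auto
    then show ?thesis using s(1)[OF False] sb(1,3) f m unfolding 2 by (intro big_case.single_out; cases "mid g"; auto)
  next
    case True
    then show ?thesis using s(2)[OF True] sb(2,4) f m unfolding 2 by (intro big_case.single_in; cases "mid g"; auto)
  qed
next
  case (3 g1 g2)
  show ?thesis
  proof (cases rule: pair[OF 3])
    case 1
    have "Bg = {g2, g1}" using 3 by auto
    then have "pair_net (w g1) + pair_net (w g2) \<le> big_part" using 1 pair_net_bounds(2)[OF 3] pair_net_bounds(2)[of v g2 g1] 3(2) by auto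
    then show ?thesis using 1 bigs_facts[of g1 v] bigs_facts[of g2 v] 3 by (intro big_case.pair_out[of "w g1" "w g2"]) auto
  next
    case (2 a a')
    have f: "1/2 < w a \<and> w a \<le> 1 \<and> 1/2 < w a' \<and> w a' \<le> 1 \<and> (\<Sum>e\<in>Bg. w e) = w a + w a' \<and> (\<Sum>e\<in>Bg \<inter> C. w e) = w a"
      using 2 bigs_facts[of a v] bigs_facts[of a' v] by (auto simp: 2(1))
    note t = two_bigs[OF v vB 2(1,2), folded 2(3)]
    show ?thesis
    proof (cases "w a \<le> 55/100")
      case True
      show ?thesis by (rule big_case.pair_in_small[of "w a" "w a'"]) (use f t(1) True in auto)
    next
      case False
      show ?thesis by (rule big_case.pair_in_large[of "w a" "w a'"]) (use f t(2) False in auto)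
    qed
  qed
next
  case 4
  have "\<not> forwarding g" if "g \<in> Bg" for g using forwarding_card[of g v] bigs_facts[OF that] 4 by auto
  from three_bigs[OF 4 this] show ?thesis by (rule big_case.many)
qed

lemma overloaded_big_case: assumes vB: "v \<in> B" shows "overloaded_big_case big_part (\<Sum>e\<in>Bg. w e) (\<Sum>e\<in>Bg \<inter> C. w e)"
proof -
  have b: "plain_net (w g) \<le> net_unit v g" "charge_unit v g \<le> 503/2000" if "g \<in> Bg" for g
    using that net_unit_bounds(2) charge_unit_le_cap forwarding_not_bad vB bigs_facts by blast+
  show ?thesis
  proof (cases rule: card_cases)
    case 1
    then show ?thesis by (intro overloaded_big_case.none) (simp add: big_part_def)
  next
    case (2 g)
    then show ?thesis using b[of g] bigs_facts[of g v] single[OF 2] by (intro overloaded_big_case.single; cases "g \<in> C"; auto)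
  next
    case (3 g1 g2)
    show ?thesis
    proof (cases rule: pair[OF 3])
      case 1
      then have "plain_net (w g1) + plain_net (w g2) \<le> big_part" using b[of g1] b[of g2] 3 by auto
      then show ?thesis using 1 bigs_facts[of g1 v] bigs_facts[of g2 v] 3 by (intro overloaded_big_case.pair[of "w g1" "w g2"]) auto
    next
      case (2 a a')
      then have "plain_net (w a') - 503/2000 \<le> big_part" using b[of a] b[of a'] by auto
      then show ?thesis using 2 bigs_facts[of a v] bigs_facts[of a' v] by (intro overloaded_big_case.pair[of "w a" "w a'"]) (auto simp: 2(1))
    qed
  next
    case 4
    have "\<not> forwarding g" if "g \<in> Bg" for g using forwarding_not_bad vB bigs_facts[OF that] by auto
    from three_bigs[OF 4 this] show ?thesis by (rule overloaded_big_case.many)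
  qed
qed

end

section \<open>Applying the numerical estimates\<close>

context config_at begin

text \<open>Such an edge was blocked at \<open>v\<close>, so it weighs more than 1/3 at this load. A
  configuration has at most two of them, each of weight at most 0.42.\<close>

lemma prev_sum:
  assumes "load h v \<le> T - 1/3" shows "(\<Sum>e\<in>{e\<in>NL. prev v e}. w e) \<le> 84/100"
proof -
  let ?A = "{e\<in>NL. prev v e}"
  have sub: "?A \<subseteq> C" by (auto simp: NL_def)
  have w: "1/3 < w e" "w e \<le> 42/100" if "e \<in> ?A" for e
  proof -
    have e: "e \<in> E" "light e" "e \<in> C" "h e \<noteq> v" "h e \<in> Qf" "qq v = Suc (qq (h e))"
      using that by (auto simp: NL_def prev_def)
    have "v \<in> r e" using e(3) C(1) by blast
    from light_pending(3)[OF e(1,2,5) this e(4)[symmetric] e(6)] show "1/3 < w e" using assms by linarith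
    show "w e \<le> 42/100" using e(2) by (simp add: light_def)
  qed
  have finA: "finite ?A" using fin[OF sets_sub(7)] by simp
  have "(\<Sum>e\<in>?A. w e) \<le> (\<Sum>e\<in>C. w e)"
    using sub C(1) w_pos fin[OF sets_sub(13)] by (intro sum_mono2) (auto intro: less_imp_le)
  then have le: "(\<Sum>e\<in>?A. w e) \<le> 1" using C(2) by linarith
  have "card ?A \<le> 2"
  proof (rule ccontr)
    assume a: "\<not> ?thesis"
    then have "?A \<noteq> {}" by (metis card.empty zero_le)
    then have "(\<Sum>e\<in>?A. 1/3) < (\<Sum>e\<in>?A. w e)" using w(1) finA by (intro sum_strict_mono) auto
    then have "real (card ?A) < 3" using le by simp
    then show False using a by simp
  qed
  moreover have "(\<Sum>e\<in>?A. w e) \<le> real (card ?A) * (42/100)" using w(2) by (intro sum_bounded_above) auto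
  ultimately show ?thesis by linarith
qed

definition "kK = real (card HK)"
definition "kN = real (card NH)"
definition "kH = real (card HU) + kK"
definition "WK = (\<Sum>e\<in>HK. w e)"
definition "WN = (\<Sum>e\<in>NH. w e)"
definition "WH = (\<Sum>e\<in>HU. w e) + WK"
definition "SC = (\<Sum>e\<in>LK. w e)"
definition "S = (\<Sum>e\<in>LU. w e) + SC"
definition "lo = (\<Sum>e\<in>loose v - C. w e)"
definition "pr = (if load h v \<le> T - 42/100 then 0 else \<Sum>e\<in>{e\<in>NL. prev v e}. w e)"
definition "pl = (\<Sum>e\<in>NL. w e) - pr"
definition "lights_value = (\<Sum>e\<in>NL. light_scale v e * w e)"
definition "foreign_big = (\<Sum>e\<in>NB. w e)"
definition "foreign_net = (\<Sum>e\<in>NB. merged_net e)"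
definition "bigs_load = (\<Sum>e\<in>Bg. w e)"
definition "bigs_in_C = (\<Sum>e\<in>Bg \<inter> C. w e)"
definition "received = (\<Sum>e\<in>PO. received_unit v e)"

lemma unit_part_total: "(\<Sum>e\<in>E. unit_part v C e) = big_part + received + (WH - 6/1000 * kH) + S - 7/100 * lo
    - (WK - 3/1000 * kK + WN - 6/1000 * kN + SC + lights_value + foreign_net)"
  unfolding unit_part_split received_def WH_def kH_def S_def lo_def WK_def kK_def WN_def kN_def SC_def lights_value_def foreign_net_def
  by (simp add: sum_distrib_left add_divide_distrib algebra_simps)

lemma prev_bounds: "0 \<le> pr" "0 \<le> pl"
proof -
  have "0 \<le> (\<Sum>e\<in>{e\<in>NL. prev v e}. w e)" "(\<Sum>e\<in>{e\<in>NL. prev v e}. w e) \<le> (\<Sum>e\<in>NL. w e)" "0 \<le> (\<Sum>e\<in>NL. w e)"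
    using w_pos fin[OF sets_sub(7)]
    by (auto intro!: sum_nonneg sum_mono2 intro: less_imp_le simp: NL_def)
  then show "0 \<le> pr" "0 \<le> pl" by (auto simp: pr_def pl_def)
qed

lemma scaled_sum:
  "lights_value \<le> 93/100 * pl \<and> pr = 0 \<and> load h v \<le> 1329/1000 \<or>
   1329/1000 < load h v \<and> lights_value \<le> pl + 100/93 * pr \<and> (pr \<le> 84/100 \<or> 1749/1000 - 1/3 < load h v)"
proof (cases "load h v \<le> T - 42/100")
  case True
  then have "lights_value = (\<Sum>e\<in>NL. 93/100 * w e)" unfolding lights_value_def by (intro sum.cong) (auto simp: light_scale_def)
  then show ?thesis using True by (simp add: pl_def pr_def sum_distrib_left)
next
  case False
  have "lights_value = (\<Sum>e\<in>NL. (if prev v e then 100/93 * w e else w e))"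
    unfolding lights_value_def using False by (intro sum.cong) (auto simp: light_scale_def)
  also have "\<dots> = (\<Sum>e\<in>{e\<in>NL. prev v e}. 100/93 * w e) + (\<Sum>e\<in>{e\<in>NL. \<not> prev v e}. w e)"
    using fin[OF sets_sub(7)] by (subst sum.If_cases) (auto simp: Int_def)
  also have "(\<Sum>e\<in>{e\<in>NL. \<not> prev v e}. w e) = pl"
  proof -
    have "{e\<in>NL. \<not> prev v e} = NL - {e\<in>NL. prev v e}" by blast
    then show ?thesis using fin[OF sets_sub(7)] False by (simp add: pl_def pr_def sum_diff)
  qed
  finally have "lights_value = 100/93 * pr + pl" using False by (simp add: pr_def sum_distrib_left)
  then show ?thesis using False prev_sum by (auto simp: pr_def)
qed

lemma vertex: "vertex_numbers kH kK kN WH WK WN S SC lo pl pr lights_value foreign_big foreign_net bigs_load bigs_in_C (load h v)"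
proof
  show "kH = 0 \<or> kH = 1 \<or> kH = 2 \<or> 3 \<le> kH"
  proof -
    have "kH = real (card HU + card HK)" by (simp add: kH_def kK_def)
    moreover have "card HU + card HK = 0 \<or> card HU + card HK = 1 \<or> card HU + card HK = 2 \<or> 3 \<le> card HU + card HK"
      by linarith
    ultimately show ?thesis by auto
  qed
  have K: "HK \<subseteq> C" "\<And>e. e \<in> HK \<Longrightarrow> heavy e" and N: "NH \<subseteq> C" "\<And>e. e \<in> NH \<Longrightarrow> heavy e"
    and U: "\<And>e. e \<in> HU \<Longrightarrow> heavy e" by (auto simp: HK_def NH_def HU_def)
  show "kK = 0 \<or> kK = 1 \<or> kK = 2" using heavy_card_in_C[OF K] by (auto simp: kK_def)
  show "kN = 0 \<or> kN = 1 \<or> kN = 2" using heavy_card_in_C[OF N] by (auto simp: kN_def)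
  show "42/100 * kK \<le> WK" "WK \<le> 1/2 * kK" using heavy_card[OF sets_sub(2) K(2)] by (auto simp: kK_def WK_def)
  show "42/100 * kN \<le> WN" "WN \<le> 1/2 * kN" using heavy_card[OF sets_sub(6) N(2)] by (auto simp: kN_def WN_def)
  show "42/100 * kH \<le> WH"
    using heavy_card(1)[OF sets_sub(1) U] heavy_card(1)[OF sets_sub(2) K(2)] by (simp add: kH_def kK_def WH_def WK_def)
  show "WK \<le> WH" using sum_w_nonneg[OF sets_sub(1)] by (simp add: WH_def)
  show "0 \<le> SC" using sum_w_nonneg[OF sets_sub(4)] by (simp add: SC_def)
  show "0 \<le> lo" using sum_w_nonneg[OF sets_sub(12)] by (simp add: lo_def)
  show "lo \<le> S - SC"
  proof -
    have "(\<Sum>e\<in>loose v - C. w e) \<le> (\<Sum>e\<in>LU. w e)"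
      using w_pos fin[OF sets_sub(3)]
      by (intro sum_mono2) (auto intro: less_imp_le simp: LU_def loose_def loose_at_def)
    then show ?thesis by (simp add: lo_def S_def)
  qed
  show "0 \<le> pl" "0 \<le> pr" using prev_bounds by auto
  show "load h v = bigs_load + WH + S" using load_split by (simp add: bigs_load_def WH_def WK_def S_def SC_def)
  show "bigs_in_C + foreign_big + WK + WN + SC + pl + pr \<le> 1"
    using config_split C(2) by (simp add: bigs_in_C_def foreign_big_def WK_def WN_def SC_def pl_def)
  show "lights_value \<le> 93/100 * pl \<and> pr = 0 \<and> load h v \<le> 1329/1000 \<or>
   load h v > 1329/1000 \<and> lights_value \<le> pl + 100/93 * pr \<and> (pr \<le> 84/100 \<or> load h v > 1749/1000 - 1/3)"
    using scaled_sum by blast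
  show "foreign_big = 0 \<and> foreign_net = 0 \<or> bigs_in_C = 0 \<and> 1/2 < foreign_big \<and> foreign_big \<le> 1 \<and>
      (foreign_big \<le> 749/1000 \<and> foreign_net \<le> foreign_big - 6/1000 \<or> 749/1000 \<le> foreign_big \<and> foreign_net \<le> 743/1000)"
    using NB_cases
  proof (elim disjE exE conjE)
    fix f assume f: "NB = {f}" "f \<in> E" "big f" "Bg \<inter> C = {}"
    then show ?thesis using M_bounds(2)[OF f(3)] w_le_1[OF f(2)]
      by (auto simp: foreign_big_def foreign_net_def bigs_in_C_def big_def)
  qed (simp add: foreign_big_def foreign_net_def)
qed

lemma received_nonneg: "0 \<le> received"
  unfolding received_def by (rule sum_nonneg) (rule received_unit_nonneg)

lemma received_ge: assumes "e \<in> E" "v \<in> r e" "v \<noteq> h e" "e \<notin> C" shows "received_unit v e \<le> received"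
  unfolding received_def
proof (rule member_le_sum)
  show "e \<in> PO" using assms by (simp add: PO_def)
qed (use received_unit_nonneg fin[OF sets_sub(8)] in blast)+

lemma unit_part_overloaded: assumes "v \<in> B" shows "1/100 \<le> (\<Sum>e\<in>E. unit_part v C e)"
proof -
  interpret vertex_numbers kH kK kN WH WK WN S SC lo pl pr lights_value foreign_big foreign_net bigs_load bigs_in_C "load h v" by (rule vertex)
  have "1749/1000 < load h v" using assms by (simp add: bad_def)
  from overload[OF this overloaded_big_case[OF assms, folded bigs_load_def bigs_in_C_def]] show ?thesis unfolding unit_part_total using received_nonneg by linarith
qed

lemma unit_part_not_overloaded: assumes vB: "v \<notin> B" shows "0 \<le> (\<Sum>e\<in>E. unit_part v C e)"
proof -
  obtain e where tr: "trigger v e" and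
    kind: "heavy e \<and> h e \<in> Qf \<and> qq (h e) \<le> qq v
     \<or> light e
     \<or> big e \<and> bigs h v = {} \<and> h e \<in> Pf \<and> pp (h e) \<le> qq v
     \<or> primary e v \<and> (\<exists>g x. mid g \<and> bigs h v = {g} \<and> x \<in> r g \<and> x \<noteq> v \<and> x \<in> Qf \<and> qi x < qi v)
     \<or> mid e \<and> primary e v \<and> h e \<in> Qf \<and> h e \<notin> B \<and> qi (h e) < qi v \<and>
         forward (QQ h (qi v - 1)) h e"
    using trigger_exists[OF v vB] by (elim exE conjE) (rule that)
  have e: "e \<in> E" "v \<in> r e" "v \<noteq> h e" "T < load h v + w e"
    "load h v + w e - T \<le> 2/10 \<longrightarrow> (\<Sum>q\<in>loose v. w q) \<le> load h v + w e - T"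
    using tr unfolding trigger_def by blast+
  have w1: "w e \<le> 1" "0 < w e" using w_le_1 w_pos e(1) by auto
  have "lo \<le> (\<Sum>q\<in>loose v. w q)"
    unfolding lo_def using w_pos finite_E
    by (intro sum_mono2) (auto intro: less_imp_le simp: loose_def loose_at_def)
  then have "trigger_numbers kH kK kN WH WK WN S SC lo pl pr lights_value foreign_big foreign_net bigs_load bigs_in_C (load h v) (w e) (load h v + w e - T)"
    by (intro trigger_numbers.intro[OF vertex] trigger_numbers_axioms.intro) (use e(4,5) in linarith)+
  then interpret trigger_numbers kH kK kN WH WK WN S SC lo pl pr lights_value foreign_big foreign_net bigs_load bigs_in_C "load h v" "w e" "load h v + w e - T" .
  note xc = big_case[OF vB, folded bigs_load_def bigs_in_C_def]
  have pend: "e \<notin> C \<Longrightarrow> received_unit v e \<le> received" using received_ge[OF e(1-3)] .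
  have nbh: "\<not> heavy e" if "big e" using classes(2) that by blast
  have inNB: "NB = {e}" if "e \<in> C" "big e"
  proof -
    have "e \<in> NB" using that e unfolding NB_def by blast
    then show ?thesis using NB_cases by (auto simp only: empty_iff singleton_iff)
  qed
  have prim: "big e" "h e \<in> Pf" "pp (h e) \<le> qq v" if "primary e v"
  proof -
    show "big e" "h e \<in> Pf" using that by (auto simp: primary_def)
    have "pp (h e) \<le> pp v" using that by (simp add: primary_def pp_def div_le_mono)
    then show "pp (h e) \<le> qq v" using pp_le_qq(2)[OF v] by simp
  qed
  have received_unit_big: "merged_charge e \<le> received" if "big e" "h e \<in> Pf" "pp (h e) \<le> qq v" "e \<notin> C"
    using pend that by (simp add: received_unit_def)
  have "WK - 3/1000 * kK + WN - 6/1000 * kN + SC + lights_value + foreign_net \<le> big_part + received + (WH - 6/1000 * kH) + S - 7/100 * lo"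
    using kind
  proof (elim disjE)
    assume k: "heavy e \<and> h e \<in> Qf \<and> qq (h e) \<le> qq v"
    then have we: "42/100 < w e" "w e \<le> 1/2" by (auto simp: heavy_def)
    show ?thesis
    proof (cases "e \<in> C")
      case False
      then have "3/1000 \<le> received" using pend k classes(2)[of e] by (simp add: received_unit_def)
      then show ?thesis using heavy_trigger xc we by blast
    next
      case True
      then have eN: "e \<in> NH" using k e by (auto simp: NH_def)
      have "card NH = Suc (card (NH - {e}))" using card_Suc_Diff1[OF fin[OF sets_sub(6)] eN] by simp
      then have c: "1 \<le> kN" "real (card (NH - {e})) = kN - 1" by (simp_all add: kN_def)
      have "WN - w e = (\<Sum>q\<in>NH - {e}. w q)" using eN fin[OF sets_sub(6)] by (simp add: WN_def sum_diff1)
      also have "\<dots> \<le> 1/2 * (kN - 1)" unfolding c(2)[symmetric]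
        using sets_sub(6) by (intro heavy_card) (auto simp: NH_def)
      finally have "WN - w e \<le> 1/2 * (kN - 1)" .
      moreover have "w e \<le> WN" unfolding WN_def
        using eN fin[OF sets_sub(6)] w_pos by (intro member_le_sum) (auto simp: NH_def less_imp_le)
      ultimately show ?thesis using heavy_trigger_in_config xc we received_nonneg c(1) by blast
    qed
  next
    assume "light e"
    then have we: "w e \<le> 42/100" by (simp add: light_def)
    then have "1329/1000 < load h v" using e(4) by linarith
    then show ?thesis using light_trigger xc we w1 received_nonneg by blast
  next
    assume k: "big e \<and> bigs h v = {} \<and> h e \<in> Pf \<and> pp (h e) \<le> qq v"
    have z: "big_part = 0" "bigs_load = 0" "bigs_in_C = 0" using k by (simp_all add: big_part_def bigs_load_def bigs_in_C_def)
    have b: "1/2 < w e" using k by (simp add: big_def)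
    show ?thesis
    proof (cases "e \<in> C")
      case False
      then have "small_charge (w e) \<le> received" using received_unit_big M_bounds(3)[of e] k by fastforce
      then show ?thesis using big_trigger b w1 z by blast
    next
      case True
      then have "foreign_big = w e" using inNB k by (simp add: foreign_big_def)
      then show ?thesis using big_trigger_in_config b w1 z received_nonneg by blast
    qed
  next
    assume k: "primary e v \<and> (\<exists>g x. mid g \<and> bigs h v = {g} \<and> x \<in> r g \<and> x \<noteq> v \<and> x \<in> Qf \<and> qi x < qi v)"
    then obtain g x where g: "mid g" "Bg = {g}" "x \<in> r g" "x \<noteq> v" "x \<in> Qf" "qi x < qi v" by blast
    have gv: "g \<in> E" "h g = v" "big g" using g(2) by (auto simp: bigs_def)
    have o: "nonloop g" "other_end g = x" using other_end_eq[OF gv(1) g(3)] g(4) gv(2) by auto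
    \<comment> \<open>The other end \<open>x\<close> of \<open>g\<close> entered \<open>Q\<close>
      before \<open>v\<close>, whereas a forwarding edge has its holder in \<open>Q\<close>
      first.\<close>
    have nh: "\<not> forwarding g" using g(6) gv(2) o by (auto simp: forwarding_def)
    have "qq x \<le> qq v" using g(6) by (simp add: qq_def div_le_mono)
    then have merged_share: "merged_share v g = 1" using merged_share_1[OF v gv(2) o(1)] o(2) g(5) by simp
    have wg: "1/2 < w g" "w g < 749/1000" using g(1) by (auto simp: mid_def)
    have nc: "net_unit v g = w g - 6/1000" "charge_unit v g = small_charge (w g)"
      using not_forwarding_bounds[OF nh] wg by (simp_all add: net_unit_def charge_unit_def merged_share)
    have bigs_load: "bigs_load = w g" using g(2) by (simp add: bigs_load_def)
    have X: "bigs_in_C = 0 \<and> bigs_load - 6/1000 \<le> big_part \<or> bigs_in_C = bigs_load \<and> - small_charge bigs_load \<le> big_part"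
      using single[OF g(2)] nc by (cases "g \<in> C") (auto simp: bigs_load bigs_in_C_def)
    have p: "primary e v" using k by blast
    note prim = prim[OF p]
    have b: "1/2 < w e" using prim(1) by (simp add: big_def)
    show ?thesis
    proof (cases "e \<in> C")
      case False
      then have "small_charge (w e) \<le> received" using received_unit_big[OF prim] M_bounds(3)[OF prim(1)] by simp
      then show ?thesis using back_trigger b w1 X wg bigs_load by simp
    next
      case True
      then have "foreign_big = w e" using inNB prim(1) by (simp add: foreign_big_def)
      then show ?thesis using back_trigger_in_config b w1 X wg bigs_load received_nonneg by simp
    qed
  next
    assume k: "mid e \<and> primary e v \<and> h e \<in> Qf \<and> h e \<notin> B \<and> qi (h e) < qi v \<and> forward (QQ h (qi v - 1)) h e"
    then have p: "primary e v" by blast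
    note prim = prim[OF p]
    have o: "nonloop e" "other_end e = v" using other_end_eq[OF e(1-3)] by auto
    have hm: "forwarding e" using k o v by (simp add: forwarding_def)
    note hb = forwarding_bounds[OF hm]
    show ?thesis
    proof (cases "e \<in> C")
      case False
      then have "w e - 497/1000 \<le> received" using received_unit_big[OF prim] hb(3) by simp
      then show ?thesis using forward_trigger xc hb(1,2) by blast
    next
      case True
      then have f: "foreign_big = w e" "foreign_net = merged_net e" using inNB prim(1) by (simp_all add: foreign_big_def foreign_net_def)
      have "w e \<le> 745/1000 \<and> foreign_net \<le> 494/1000 \<or> 745/1000 < w e \<and> foreign_net \<le> w e - 251/1000"
        using hb f by auto
      then show ?thesis using forward_trigger_in_config xc hb(1,2) f(1) received_nonneg by auto
    qed
  qed
  then show ?thesis unfolding unit_part_total by linarith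
qed

end

section \<open>Weak duality\<close>

context balancing begin

definition configurations :: "'v \<Rightarrow> 'e set set" where
  "configurations v = {C. C \<subseteq> {e\<in>E. v \<in> r e} \<and> (\<Sum>e\<in>C. w e) \<le> 1}"

lemma finite_configurations: "finite (configurations v)"
proof (rule finite_subset)
  show "configurations v \<subseteq> Pow E" by (auto simp: configurations_def)
qed (simp add: finite_E)

lemma weak_duality:
  fixes x :: "'v \<Rightarrow> 'e set \<Rightarrow> real" and y :: "'v \<Rightarrow> real" and z :: "'e \<Rightarrow> real"
  assumes x: "\<And>v C. v \<in> V \<Longrightarrow> C \<in> configurations v \<Longrightarrow> 0 \<le> x v C"
    and packing: "\<And>v. v \<in> V \<Longrightarrow> (\<Sum>C\<in>configurations v. x v C) \<le> 1"
    and covering: "\<And>e. e \<in> E \<Longrightarrow> 1 \<le> (\<Sum>v\<in>r e. \<Sum>C\<in>{C\<in>configurations v. e \<in> C}. x v C)"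
    and z: "\<And>e. e \<in> E \<Longrightarrow> 0 \<le> z e"
    and y: "\<And>v. v \<in> V \<Longrightarrow> 0 \<le> y v"
    and le: "\<And>v C. v \<in> V \<Longrightarrow> C \<in> configurations v \<Longrightarrow> (\<Sum>e\<in>C. z e) \<le> y v"
  shows "(\<Sum>e\<in>E. z e) \<le> (\<Sum>v\<in>V. y v)"
proof -
  have cover: "1 \<le> (\<Sum>v\<in>V. \<Sum>C\<in>configurations v. if e \<in> C then x v C else 0)" if e: "e \<in> E" for e
  proof -
    have "(\<Sum>C\<in>{C\<in>configurations v. e \<in> C}. x v C) = (\<Sum>C\<in>configurations v. if e \<in> C then x v C else 0)" for v
      by (rule sum.inter_filter[OF finite_configurations])
    then have "1 \<le> (\<Sum>v\<in>r e. \<Sum>C\<in>configurations v. if e \<in> C then x v C else 0)" using covering[OF e] by simp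
    also have "\<dots> = (\<Sum>v\<in>V. \<Sum>C\<in>configurations v. if e \<in> C then x v C else 0)"
    proof (rule sum.mono_neutral_left[OF finite_V r_sub[OF e]])
      show "\<forall>v\<in>V - r e. (\<Sum>C\<in>configurations v. if e \<in> C then x v C else 0) = 0"
        by (auto intro!: sum.neutral simp: configurations_def)
    qed
    finally show ?thesis .
  qed
  have "(\<Sum>e\<in>E. z e) \<le> (\<Sum>e\<in>E. z e * (\<Sum>v\<in>V. \<Sum>C\<in>configurations v. if e \<in> C then x v C else 0))"
  proof (rule sum_mono)
    fix e assume e: "e \<in> E"
    show "z e \<le> z e * (\<Sum>v\<in>V. \<Sum>C\<in>configurations v. if e \<in> C then x v C else 0)"
      using mult_left_mono[OF cover[OF e] z[OF e]] by simp
  qed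
  also have "\<dots> = (\<Sum>v\<in>V. \<Sum>e\<in>E. \<Sum>C\<in>configurations v. z e * (if e \<in> C then x v C else 0))"
    unfolding sum_distrib_left by (rule sum.swap)
  also have "\<dots> = (\<Sum>v\<in>V. \<Sum>C\<in>configurations v. \<Sum>e\<in>E. z e * (if e \<in> C then x v C else 0))"
    by (rule sum.cong[OF refl], rule sum.swap)
  also have "\<dots> \<le> (\<Sum>v\<in>V. \<Sum>C\<in>configurations v. x v C * y v)"
  proof (rule sum_mono, rule sum_mono)
    fix v C assume v: "v \<in> V" and C: "C \<in> configurations v"
    have sub: "C \<subseteq> E" using C by (auto simp: configurations_def)
    have "(\<Sum>e\<in>E. z e * (if e \<in> C then x v C else 0)) = (\<Sum>e\<in>C. z e) * x v C"
      unfolding sum_distrib_right sum_indicator[OF finite_E sub] by (rule sum.cong) auto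
    also have "\<dots> \<le> y v * x v C" using le[OF v C] x[OF v C] by (rule mult_right_mono)
    finally show "(\<Sum>e\<in>E. z e * (if e \<in> C then x v C else 0)) \<le> x v C * y v" by (simp only: mult.commute)
  qed
  also have "\<dots> \<le> (\<Sum>v\<in>V. y v)"
  proof (rule sum_mono)
    fix v assume v: "v \<in> V"
    have "(\<Sum>C\<in>configurations v. x v C * y v) = (\<Sum>C\<in>configurations v. x v C) * y v"
      by (rule sum_distrib_right[symmetric])
    also have "\<dots> \<le> 1 * y v" using packing[OF v] y[OF v] by (rule mult_right_mono)
    finally show "(\<Sum>C\<in>configurations v. x v C * y v) \<le> y v" by simp
  qed
  finally show ?thesis .
qed

end

context optimal_orientation begin

definition edge_dual :: "'b \<Rightarrow> real" where "edge_dual e = net e + charge e"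
definition vertex_dual :: "'a \<Rightarrow> real" where
  "vertex_dual v = (\<Sum>e\<in>E. (if h e = v then net e else 0) + (if h e \<noteq> v \<and> v \<in> r e then charge e else 0))"

lemma sum_vertex_dual: "(\<Sum>v\<in>V. vertex_dual v) = (\<Sum>e\<in>E. edge_dual e)"
proof -
  have "(\<Sum>v\<in>V. vertex_dual v) = (\<Sum>e\<in>E. \<Sum>v\<in>V. (if h e = v then net e else 0) + (if h e \<noteq> v \<and> v \<in> r e then charge e else 0))"
    unfolding vertex_dual_def by (rule sum.swap)
  also have "\<dots> = (\<Sum>e\<in>E. edge_dual e)"
  proof (rule sum.cong[OF refl])
    fix e assume e: "e \<in> E"
    have hV: "h e \<in> V" using head_in[OF h_oris e] r_sub[OF e] by blast
    have "(\<Sum>v\<in>V. if h e \<noteq> v \<and> v \<in> r e then charge e else 0) = charge e"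
    proof (cases "nonloop e")
      case True
      have o: "h e \<noteq> v \<and> v \<in> r e \<longleftrightarrow> v = other_end e" for v
        using other_end[OF e True] other_end_eq(2)[OF e, of v] by auto
      have "other_end e \<in> V" using other_end(1)[OF e True] r_sub[OF e] by blast
      then show ?thesis unfolding o using finite_V by simp
    next
      case False
      then have c: "charge e = 0" by (simp add: charge_def)
      show ?thesis unfolding c by simp
    qed
    then show "(\<Sum>v\<in>V. (if h e = v then net e else 0) + (if h e \<noteq> v \<and> v \<in> r e then charge e else 0)) = edge_dual e"
      using hV finite_V by (simp add: sum.distrib edge_dual_def)
  qed
  finally show ?thesis .
qed

lemma vertex_dual_minus_config:
  assumes "C \<subseteq> {e\<in>E. v \<in> r e}" shows "vertex_dual v - (\<Sum>e\<in>C. edge_dual e) = (\<Sum>e\<in>E. contrib v C e)"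
proof -
  have sub: "C \<subseteq> E" using assms by blast
  show ?thesis unfolding vertex_dual_def sum_indicator[OF finite_E sub] sum_subtractf[symmetric]
    by (rule sum.cong) (use assms in \<open>auto simp: contrib_def edge_dual_def\<close>)
qed

lemma contrib_inactive: assumes "e \<in> E" "v \<notin> Pf" shows "contrib v C e = 0"
proof -
  have vQ: "v \<notin> Qf" using assms(2) PQf by blast
  have l: "light e" if "\<not> big e" "\<not> heavy e" using that unfolding light_def big_def heavy_def by linarith
  have "net e = 0 \<and> charge e = 0" if "h e = v"
    using that assms(2) vQ by (simp add: net_def charge_def)
  moreover have "net e = 0 \<and> charge e = 0" if p: "v \<in> r e" "v \<noteq> h e"
  proof -
    have "\<not> (big e \<and> h e \<in> Pf)" using big_pending(1)[OF assms(1) _ _ p(1)] assms(2) by blast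
    moreover have "\<not> (heavy e \<and> h e \<in> Qf)" using heavy_pending(1)[OF assms(1) _ _ p] vQ by blast
    moreover have "\<not> (light e \<and> h e \<in> Qf)" using light_pending(1)[OF assms(1) _ _ p] vQ by blast
    ultimately show ?thesis using l by (auto simp: net_def charge_def)
  qed
  ultimately show ?thesis by (auto simp: contrib_def)
qed

lemma local_inequality:
  assumes C: "C \<in> configurations v"
  shows "(\<Sum>e\<in>C. edge_dual e) + (if v \<in> B then 1/100 else 0) \<le> vertex_dual v"
proof -
  have C': "C \<subseteq> {e\<in>E. v \<in> r e}" "(\<Sum>e\<in>C. w e) \<le> 1" using C by (auto simp: configurations_def)
  have "(if v \<in> B then 1/100 else 0) \<le> (\<Sum>e\<in>E. contrib v C e)"
  proof (cases "v \<in> Pf")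
    case False
    then show ?thesis using contrib_inactive PQf by (auto intro!: sum_nonneg)
  next
    case True
    have "mu v * (\<Sum>e\<in>E. unit_part v C e) + (discount (pp v) - mu v) * (\<Sum>e\<in>E. excess_part v C e) \<le> (\<Sum>e\<in>E. contrib v C e)"
      unfolding sum_distrib_left sum.distrib[symmetric] by (rule sum_mono) (rule contrib_lower[OF _ True])
    moreover have "0 \<le> (discount (pp v) - mu v) * (\<Sum>e\<in>E. excess_part v C e)"
    proof (cases "mu v < discount (pp v)")
      case less: True
      then show ?thesis using excess_part_sum_nonneg[OF True less C'] by simp
    next
      case False
      then have "mu v = discount (pp v)" using mu_le_rho[of v] by linarith
      then show ?thesis by simp
    qed
    moreover have "(if v \<in> B then 1/100 else 0) \<le> mu v * (\<Sum>e\<in>E. unit_part v C e)"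
    proof (cases "v \<in> Qf")
      case Q: True
      interpret config_at V E r w h v C by unfold_locales (use Q C' in auto)
      show ?thesis
      proof (cases "v \<in> B")
        case True
        then have "mu v = 1" using Q bad_index(4)[OF True] by (simp add: mu_def discount_def)
        then show ?thesis using unit_part_overloaded[OF True] True by simp
      next
        case False
        then show ?thesis using unit_part_not_overloaded[OF False] mu_nonneg[of v] by simp
      qed
    next
      case False
      then show ?thesis using PQf by (auto simp: mu_def)
    qed
    ultimately show ?thesis by linarith
  qed
  then show ?thesis using vertex_dual_minus_config[OF C'(1)] by linarith
qed

end

context balancing begin

theorem good_orientation:
  fixes x :: "'v \<Rightarrow> 'e set \<Rightarrow> real"
  assumes x: "\<And>v C. v \<in> V \<Longrightarrow> C \<in> configurations v \<Longrightarrow> 0 \<le> x v C"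
    and packing: "\<And>v. v \<in> V \<Longrightarrow> (\<Sum>C\<in>configurations v. x v C) \<le> 1"
    and covering: "\<And>e. e \<in> E \<Longrightarrow> 1 \<le> (\<Sum>v\<in>r e. \<Sum>C\<in>{C\<in>configurations v. e \<in> C}. x v C)"
  shows "\<exists>h\<in>oris. \<forall>v\<in>V. load h v \<le> T"
proof -
  obtain h where "optimal (K * (2 * card V + 3)) h" using ex_optimal by blast
  then interpret optimal_orientation V E r w h by unfold_locales
  \<comment> \<open>Removing the surplus at overloaded vertices keeps the dual feasible but lowers
    the sum of the vertex values by \<open>card B\<close> / 100; weak duality allows this only if
    \<open>B\<close> is empty.\<close>
  let ?y = "\<lambda>v. vertex_dual v - (if v \<in> B then 1/100 else 0)"
  have li: "(\<Sum>e\<in>C. edge_dual e) \<le> ?y v" if "C \<in> configurations v" for v C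
    using local_inequality[OF that] by simp
  have "(\<Sum>e\<in>E. edge_dual e) \<le> (\<Sum>v\<in>V. ?y v)"
  proof (rule weak_duality[OF x packing covering])
    show "0 \<le> edge_dual e" if "e \<in> E" for e using net_nonneg[OF that] charge_nonneg by (simp add: edge_dual_def)
    show "0 \<le> ?y v" for v using li[of "{}" v] by (simp add: configurations_def)
  qed (use li in auto)
  also have "\<dots> = (\<Sum>e\<in>E. edge_dual e) - (\<Sum>v\<in>V. if v \<in> B then 1/100 else 0)"
    by (simp only: sum_subtractf sum_vertex_dual)
  also have "(\<Sum>v\<in>V. if v \<in> B then 1/100 else 0) = (\<Sum>v\<in>B. 1/100::real)"
    by (rule sum_indicator[symmetric, OF finite_V]) (auto simp: bad_def)
  finally have "real (card B) = 0" by simp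
  moreover have "finite B" using finite_V by (simp add: bad_def)
  ultimately have "B = {}" by simp
  then have "\<forall>v\<in>V. load h v \<le> T" by (auto simp: bad_def not_less)
  then show ?thesis using h_oris by blast
qed

end

section \<open>Scaling back to the given graph\<close>

lemma opt_integral_le:
  fixes G :: "('v, 'e) weighted_multigraph"
  assumes wf: "wf_graph G" and ne: "edges G \<noteq> {}"
  shows "0 < opt_LP G" "opt_integral G \<le> 1749/1000 * opt_LP G"
proof -
  define \<tau> where "\<tau> = opt_LP G"
  obtain x where sol: "config_LP_solution G \<tau> x"
    using opt_LP_is_least(1)[OF wf ne] by (auto simp: \<tau>_def config_LP_feasible_def)
  have g: "finite (verts G)" "finite (edges G)"
    "\<And>e. e \<in> edges G \<Longrightarrow> ends G e \<subseteq> verts G \<and> card (ends G e) \<in> {1, 2} \<and> weight G e > 0"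
    using wf by (auto simp: wf_graph_def)
  \<comment> \<open>A heavier edge lies in no configuration and could not be covered. This gives
    both \<open>0 < \<tau>\<close> and the bound 1 on the scaled weights.\<close>
  have le: "weight G e \<le> \<tau>" if e: "e \<in> edges G" for e
  proof (rule ccontr)
    assume a: "\<not> ?thesis"
    have none: "{C \<in> configs G v \<tau>. e \<in> C} = {}" for v
    proof -
      have "weight G e \<le> (\<Sum>e\<in>C. weight G e)" if "C \<subseteq> incident G v" "e \<in> C" for C
        using that(2) finite_subset[OF that(1) finite_incident[OF wf]]
      proof (intro member_le_sum)
        show "0 \<le> weight G x" if "x \<in> C - {e}" for x
          using that \<open>C \<subseteq> incident G v\<close> g(3) by (auto simp: incident_def less_imp_le)
      qed
      then show ?thesis using a order_trans unfolding configs_def by blast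
    qed
    have "(\<Sum>v\<in>ends G e. \<Sum>C\<in>{C \<in> configs G v \<tau>. e \<in> C}. x v C) = 0" unfolding none by simp
    moreover have "(\<Sum>v\<in>ends G e. \<Sum>C\<in>{C \<in> configs G v \<tau>. e \<in> C}. x v C) \<ge> 1"
      using sol e by (simp add: config_LP_solution_def)
    ultimately show False by linarith
  qed
  obtain e0 where e0: "e0 \<in> edges G" using ne by blast
  have pos: "0 < \<tau>" using le[OF e0] g(3)[OF e0] by linarith
  then show "0 < opt_LP G" by (simp add: \<tau>_def)
  interpret balancing "verts G" "edges G" "ends G" "\<lambda>e. weight G e / \<tau>"
    by unfold_locales (use g le pos in \<open>simp_all add: less_imp_le\<close>)
  have conf: "configurations v = configs G v \<tau>" for v
    using pos by (auto simp: configurations_def configs_def incident_def sum_divide_distrib[symmetric])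
  have "\<exists>h\<in>oris. \<forall>v\<in>verts G. load h v \<le> 1749/1000"
    by (rule good_orientation[of x]) (use sol in \<open>simp_all add: conf config_LP_solution_def\<close>)
  then obtain h where h: "h \<in> oris" "\<And>v. v \<in> verts G \<Longrightarrow> load h v \<le> 1749/1000" by blast
  have h': "h \<in> orientations G" using h(1) by (simp add: oris_def orientations_def)
  have "(\<Sum>e\<in>in_edges G h v. weight G e) \<le> 1749/1000 * \<tau>" if "v \<in> verts G" for v
  proof -
    have "load h v = (\<Sum>e\<in>in_edges G h v. weight G e) / \<tau>"
      by (simp add: load_def in_edges_def sum_divide_distrib)
    then show ?thesis using h(2)[OF that] pos by (simp add: pos_divide_le_eq)
  qed
  moreover have "ends G e0 \<noteq> {}" using g(3)[OF e0] by auto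
  then have "verts G \<noteq> {}" using g(3)[OF e0] by blast
  ultimately have "max_indegree G h \<le> 1749/1000 * \<tau>"
    unfolding max_indegree_def using g(1) by (subst Max_le_iff) auto
  moreover have "opt_integral G \<le> max_indegree G h"
    unfolding opt_integral_def using h' finite_oris
    by (intro Min_le) (auto simp: oris_def orientations_def)
  ultimately show "opt_integral G \<le> 1749/1000 * opt_LP G" by (simp add: \<tau>_def)
qed

theorem theorem1:
  "integrality_gap TYPE(('v, 'e) weighted_multigraph) \<le> ereal 1.749"
  unfolding integrality_gap_def
proof (rule SUP_least)
  fix G :: "('v, 'e) weighted_multigraph"
  assume "G \<in> {G. wf_graph G \<and> edges G \<noteq> {}}"
  then have G: "wf_graph G" "edges G \<noteq> {}" by auto
  from opt_integral_le[OF this] have "opt_integral G / opt_LP G \<le> 1749/1000"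
    by (simp add: field_simps)
  then show "ereal (opt_integral G / opt_LP G) \<le> ereal 1.749" by simp
qed

end
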